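(* Let $(T,m)$ be a locally doubling flow tree which is not isomorphic to $\mathbb{Z}$, i.e., such that $q(x)>1$ for some $x\in T$. Let $\mathcal{R}=\nabla\mathcal{L}^{-1/2}$ be the Riesz transform on $(T,m)$. Then $\mathcal{R}^*$ is unbounded from $H^1(m)$ to $L^1(m)$ and, consequently, $\mathcal{R}$ is unbounded from $L^\infty(m)$ to $BMO(m)$.
   Context: Trees. A tree $T$ is an infinite connected graph without cycles, locally finite, identified with its set of vertices and equipped with the graph distance $d$. A tree with root at infinity is such a tree with a fixed boundary point (end) $\omega_*\in\partial T$. For $x\in T$, the predecessor $\mathfrak{p}(x)$ is the neighbour of $x$ lying on the semi-infinite geodesic from $x$ to $\omega_*$; the remaining neighbours form the set $\mathfrak{s}(x)$ of successors, and $q(x)=\#\mathfrak{s}(x)$. Write $x\le y$ if $y$ belongs to the semi-infinite geodesic from $x$ to $\omega_*$. A flow measure on $T$ is a function $m:T\to(0,\infty)$ with $m(x)=\sum_{y\in\mathfrak{s}(x)}m(y)$ for all $x\in T$, identified with the measure of density $m$ with respect to counting measure; $(T,m)$ is then a flow tree. It is locally doubling if for every $R>0$ there is $D_R$ such that $m(B_{2r}(x))\le D_R\,m(B_r(x))$ for all $x\in T$, $r\in(0,R]$, where $B_r(x)$ is the ball for $d$. The flow gradient is $\nabla f(x)=f(x)-f(\mathfrak{p}(x))$ and the flow Laplacian is $\mathcal{L}=\frac12\nabla^*\nabla$ on $L^2(m)$. Since $\mathcal{L}$ is injective and $\|\mathcal{L}^{1/2}f\|_2^2=\frac12\|\nabla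 f\|_2^2$, the Riesz transform $\mathcal{R}=\nabla\mathcal{L}^{-1/2}$ is bounded on $L^2(m)$; $\mathcal{R}^*$ is its $L^2(m)$ adjoint. Boundedness between function spaces means that the corresponding norm inequality holds for all functions in $L^2(m)$ intersected with the domain space; unboundedness is its negation. Hardy and BMO spaces. For $x\in T$ and integers $1\le h'<h''$ let $R_{h'}^{h''}(x)=\{y\in T:y\le x,\ h'\le d(x,y)<h''\}$. An admissible trapezoid is either a singleton or a set $R_{h'}^{h''}(x)$ with $2\le h''/h'\le12$. An atom is a function $a$ supported in an admissible trapezoid $R$ with $\sum_xa(x)m(x)=0$ and $\|a\|_\infty\le1/m(R)$. $H^1(m)$ is the space of all sums $\sum_j\lambda_ja_j$ (convergence in $L^1(m)$) with $a_j$ atoms and $\sum_j|\lambda_j|<\infty$, normed by the infimum of $\sum_j|\lambda_j|$. $BMO(m)$ is the space of functions $f$ on $T$, modulo constants, with $\sup_R\frac1{m(R)}\sum_{x\in R}|f(x)-f_R|m(x)<\infty$, the supremum over admissible trapezoids $R$, $f_R$ being the $m$-average of $f$ on $R$; it is the dual of $H^1(m)$. *)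

theory Defs
  imports "HOL-Analysis.Analysis"
begin

section \<open>Trees with root at infinity\<close>

text \<open>A graph is given by its adjacency relation; the vertex set is the whole type.\<close>

definition graph_dist :: "('a \<Rightarrow> 'a \<Rightarrow> bool) \<Rightarrow> 'a \<Rightarrow> 'a \<Rightarrow> nat" where
  "graph_dist E x y = (LEAST n. (E ^^ n) x y)"

definition cycle :: "('a \<Rightarrow> 'a \<Rightarrow> bool) \<Rightarrow> 'a list \<Rightarrow> bool" where
  "cycle E xs \<longleftrightarrow> 3 \<le> length xs \<and> distinct xs \<and> successively E xs \<and> E (last xs) (hd xs)"

definition geodesic_ray :: "('a \<Rightarrow> 'a \<Rightarrow> bool) \<Rightarrow> (nat \<Rightarrow> 'a) \<Rightarrow> bool" where
  "geodesic_ray E \<rho> \<longleftrightarrow> (\<forall>i j. i \<le> j \<longrightarrow> graph_dist E (\<rho> i) (\<rho> j) = j - i)"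

text \<open>Two rays in a tree define the same end iff they agree up to finite initial segments.\<close>

definition cofinal :: "('a \<Rightarrow> 'a \<Rightarrow> bool) \<Rightarrow> ((nat \<Rightarrow> 'a) \<times> (nat \<Rightarrow> 'a)) set" where
  "cofinal E = {(\<rho>, \<sigma>). geodesic_ray E \<rho> \<and> geodesic_ray E \<sigma> \<and>
                  (\<exists>k l. \<forall>n. \<rho> (n + k) = \<sigma> (n + l))}"

definition boundary :: "('a \<Rightarrow> 'a \<Rightarrow> bool) \<Rightarrow> (nat \<Rightarrow> 'a) set set" where
  "boundary E = {\<rho>. geodesic_ray E \<rho>} // cofinal E"

locale infinite_tree =
  fixes E :: "'a \<Rightarrow> 'a \<Rightarrow> bool"
  assumes adj_sym: "E x y \<Longrightarrow> E y x"
    and adj_irrefl: "\<not> E x x"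
    and connected: "E\<^sup>*\<^sup>* x y"
    and acyclic: "\<not> cycle E xs"
    and infinite_vertices: "infinite (UNIV :: 'a set)"
    and locally_finite: "finite {y. E x y}"

locale rooted_tree = infinite_tree E
  for E :: "'a \<Rightarrow> 'a \<Rightarrow> bool" +
  fixes \<omega> :: "(nat \<Rightarrow> 'a) set"
  assumes root_end: "\<omega> \<in> boundary E"

text \<open>The semi-infinite geodesic from a vertex to an end is the unique ray in the class
  that starts at the vertex.\<close>

definition geodesic_to :: "(nat \<Rightarrow> 'a) set \<Rightarrow> 'a \<Rightarrow> nat \<Rightarrow> 'a" where
  "geodesic_to \<omega> x = (THE \<rho>. \<rho> \<in> \<omega> \<and> \<rho> 0 = x)"

definition predecessor :: "(nat \<Rightarrow> 'a) set \<Rightarrow> 'a \<Rightarrow> 'a" where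
  "predecessor \<omega> x = geodesic_to \<omega> x 1"

definition successors :: "('a \<Rightarrow> 'a \<Rightarrow> bool) \<Rightarrow> (nat \<Rightarrow> 'a) set \<Rightarrow> 'a \<Rightarrow> 'a set" where
  "successors E \<omega> x = {y. E x y} - {predecessor \<omega> x}"

definition below :: "(nat \<Rightarrow> 'a) set \<Rightarrow> 'a \<Rightarrow> 'a \<Rightarrow> bool" where
  "below \<omega> x y \<longleftrightarrow> y \<in> range (geodesic_to \<omega> x)"


section \<open>Flow measures\<close>

locale flow_tree = rooted_tree E \<omega>
  for E :: "'a \<Rightarrow> 'a \<Rightarrow> bool" and \<omega> :: "(nat \<Rightarrow> 'a) set" +
  fixes m :: "'a \<Rightarrow> real"
  assumes flow_pos: "0 < m x"
    and flow: "m x = (\<Sum>y\<in>successors E \<omega> x. m y)"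

abbreviation flow_measure :: "('a \<Rightarrow> real) \<Rightarrow> 'a measure" where
  "flow_measure m \<equiv> point_measure UNIV (\<lambda>x. ennreal (m x))"

definition graph_ball :: "('a \<Rightarrow> 'a \<Rightarrow> bool) \<Rightarrow> real \<Rightarrow> 'a \<Rightarrow> 'a set" where
  "graph_ball E r x = {y. real (graph_dist E x y) \<le> r}"

definition locally_doubling :: "('a \<Rightarrow> 'a \<Rightarrow> bool) \<Rightarrow> ('a \<Rightarrow> real) \<Rightarrow> bool" where
  "locally_doubling E m \<longleftrightarrow>
     (\<forall>R>0. \<exists>D. \<forall>x. \<forall>r. 0 < r \<and> r \<le> R \<longrightarrow>
        measure (flow_measure m) (graph_ball E (2 * r) x)
          \<le> D * measure (flow_measure m) (graph_ball E r x))"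


section \<open>Lebesgue spaces\<close>

text \<open>As the density is positive at every vertex, no null-set identification is needed.\<close>

definition L1 :: "('a \<Rightarrow> real) \<Rightarrow> ('a \<Rightarrow> complex) set" where
  "L1 m = {f. integrable (flow_measure m) f}"

definition norm_L1 :: "('a \<Rightarrow> real) \<Rightarrow> ('a \<Rightarrow> complex) \<Rightarrow> real" where
  "norm_L1 m f = (\<integral>x. norm (f x) \<partial>flow_measure m)"

definition L2 :: "('a \<Rightarrow> real) \<Rightarrow> ('a \<Rightarrow> complex) set" where
  "L2 m = {f. integrable (flow_measure m) (\<lambda>x. (norm (f x))\<^sup>2)}"

definition norm_L2 :: "('a \<Rightarrow> real) \<Rightarrow> ('a \<Rightarrow> complex) \<Rightarrow> real" where
  "norm_L2 m f = sqrt (\<integral>x. (norm (f x))\<^sup>2 \<partial>flow_measure m)"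

definition inner_L2 :: "('a \<Rightarrow> real) \<Rightarrow> ('a \<Rightarrow> complex) \<Rightarrow> ('a \<Rightarrow> complex) \<Rightarrow> complex" where
  "inner_L2 m f g = (\<integral>x. f x * cnj (g x) \<partial>flow_measure m)"

definition Linf :: "('a \<Rightarrow> complex) set" where
  "Linf = {f. bdd_above (range (\<lambda>x. norm (f x)))}"

definition norm_Linf :: "('a \<Rightarrow> complex) \<Rightarrow> real" where
  "norm_Linf f = (SUP x. norm (f x))"


section \<open>Operators on \<open>L\<^sup>2(m)\<close>\<close>

text \<open>Operators are extensional, i.e. take a fixed dummy value off \<open>L\<^sup>2(m)\<close>, so that an operator is
  determined by its values on \<open>L\<^sup>2(m)\<close>; the definite descriptions below rely on this.\<close>

definition bounded_op_L2 ::
    "('a \<Rightarrow> real) \<Rightarrow> (('a \<Rightarrow> complex) \<Rightarrow> ('a \<Rightarrow> complex)) \<Rightarrow> bool" where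
  "bounded_op_L2 m A \<longleftrightarrow>
     A \<in> L2 m \<rightarrow>\<^sub>E L2 m \<and>
     (\<forall>f\<in>L2 m. \<forall>g\<in>L2 m. A (\<lambda>x. f x + g x) = (\<lambda>x. A f x + A g x)) \<and>
     (\<forall>c. \<forall>f\<in>L2 m. A (\<lambda>x. c * f x) = (\<lambda>x. c * A f x)) \<and>
     (\<exists>C. \<forall>f\<in>L2 m. norm_L2 m (A f) \<le> C * norm_L2 m f)"

definition adjoint_L2 ::
    "('a \<Rightarrow> real) \<Rightarrow> (('a \<Rightarrow> complex) \<Rightarrow> ('a \<Rightarrow> complex)) \<Rightarrow> ('a \<Rightarrow> complex) \<Rightarrow> ('a \<Rightarrow> complex)" where
  "adjoint_L2 m A = (THE B. bounded_op_L2 m B \<and>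
     (\<forall>f\<in>L2 m. \<forall>g\<in>L2 m. inner_L2 m (A f) g = inner_L2 m f (B g)))"

definition positive_op_L2 ::
    "('a \<Rightarrow> real) \<Rightarrow> (('a \<Rightarrow> complex) \<Rightarrow> ('a \<Rightarrow> complex)) \<Rightarrow> bool" where
  "positive_op_L2 m A \<longleftrightarrow>
     bounded_op_L2 m A \<and>
     (\<forall>f\<in>L2 m. \<forall>g\<in>L2 m. inner_L2 m (A f) g = inner_L2 m f (A g)) \<and>
     (\<forall>f\<in>L2 m. 0 \<le> Re (inner_L2 m (A f) f))"

definition sqrt_op_L2 ::
    "('a \<Rightarrow> real) \<Rightarrow> (('a \<Rightarrow> complex) \<Rightarrow> ('a \<Rightarrow> complex)) \<Rightarrow> ('a \<Rightarrow> complex) \<Rightarrow> ('a \<Rightarrow> complex)" where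
  "sqrt_op_L2 m A = (THE S. positive_op_L2 m S \<and> (\<forall>f\<in>L2 m. S (S f) = A f))"


section \<open>Flow Laplacian and Riesz transform\<close>

definition flow_gradient :: "(nat \<Rightarrow> 'a) set \<Rightarrow> ('a \<Rightarrow> complex) \<Rightarrow> 'a \<Rightarrow> complex" where
  "flow_gradient \<omega> f x = f x - f (predecessor \<omega> x)"

definition flow_laplacian ::
    "(nat \<Rightarrow> 'a) set \<Rightarrow> ('a \<Rightarrow> real) \<Rightarrow> ('a \<Rightarrow> complex) \<Rightarrow> 'a \<Rightarrow> complex" where
  "flow_laplacian \<omega> m f x = (1 / 2) * adjoint_L2 m (flow_gradient \<omega>) (flow_gradient \<omega> f) x"

definition laplacian_half ::
    "(nat \<Rightarrow> 'a) set \<Rightarrow> ('a \<Rightarrow> real) \<Rightarrow> ('a \<Rightarrow> complex) \<Rightarrow> 'a \<Rightarrow> complex" where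
  "laplacian_half \<omega> m = sqrt_op_L2 m (flow_laplacian \<omega> m)"

text \<open>Only meaningful on the domain, the range of \<open>\<L>\<^sup>1\<^sup>/\<^sup>2\<close>.\<close>

definition laplacian_minus_half ::
    "(nat \<Rightarrow> 'a) set \<Rightarrow> ('a \<Rightarrow> real) \<Rightarrow> ('a \<Rightarrow> complex) \<Rightarrow> 'a \<Rightarrow> complex" where
  "laplacian_minus_half \<omega> m = inv_into (L2 m) (laplacian_half \<omega> m)"

text \<open>\<open>\<nabla>\<L>\<^sup>-\<^sup>1\<^sup>/\<^sup>2\<close> is defined on the range of \<open>\<L>\<^sup>1\<^sup>/\<^sup>2\<close>, which is dense in \<open>L\<^sup>2(m)\<close> by injectivity of
  \<open>\<L>\<close>; the Riesz transform is its unique bounded extension to \<open>L\<^sup>2(m)\<close>.\<close>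

definition riesz ::
    "(nat \<Rightarrow> 'a) set \<Rightarrow> ('a \<Rightarrow> real) \<Rightarrow> ('a \<Rightarrow> complex) \<Rightarrow> 'a \<Rightarrow> complex" where
  "riesz \<omega> m = (THE R. bounded_op_L2 m R \<and>
     (\<forall>f\<in>laplacian_half \<omega> m ` L2 m. R f = flow_gradient \<omega> (laplacian_minus_half \<omega> m f)))"

definition riesz_adjoint ::
    "(nat \<Rightarrow> 'a) set \<Rightarrow> ('a \<Rightarrow> real) \<Rightarrow> ('a \<Rightarrow> complex) \<Rightarrow> 'a \<Rightarrow> complex" where
  "riesz_adjoint \<omega> m = adjoint_L2 m (riesz \<omega> m)"


section \<open>Hardy and BMO spaces\<close>

definition trapezoid ::
    "('a \<Rightarrow> 'a \<Rightarrow> bool) \<Rightarrow> (nat \<Rightarrow> 'a) set \<Rightarrow> nat \<Rightarrow> nat \<Rightarrow> 'a \<Rightarrow> 'a set" where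
  "trapezoid E \<omega> h' h'' x = {y. below \<omega> y x \<and> h' \<le> graph_dist E x y \<and> graph_dist E x y < h''}"

definition admissible ::
    "('a \<Rightarrow> 'a \<Rightarrow> bool) \<Rightarrow> (nat \<Rightarrow> 'a) set \<Rightarrow> 'a set \<Rightarrow> bool" where
  "admissible E \<omega> R \<longleftrightarrow>
     (\<exists>x. R = {x}) \<or>
     (\<exists>x h' h''. 1 \<le> h' \<and> h' < h'' \<and> 2 \<le> real h'' / real h' \<and> real h'' / real h' \<le> 12 \<and>
        R = trapezoid E \<omega> h' h'' x)"

definition atom ::
    "('a \<Rightarrow> 'a \<Rightarrow> bool) \<Rightarrow> (nat \<Rightarrow> 'a) set \<Rightarrow> ('a \<Rightarrow> real) \<Rightarrow> ('a \<Rightarrow> complex) \<Rightarrow> bool" where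
  "atom E \<omega> m a \<longleftrightarrow>
     (\<exists>R. admissible E \<omega> R \<and> (\<forall>x. x \<notin> R \<longrightarrow> a x = 0) \<and>
        (\<integral>x. a x \<partial>flow_measure m) = 0 \<and>
        (\<forall>x. norm (a x) \<le> 1 / measure (flow_measure m) R))"

definition atomic_decomposition ::
    "('a \<Rightarrow> 'a \<Rightarrow> bool) \<Rightarrow> (nat \<Rightarrow> 'a) set \<Rightarrow> ('a \<Rightarrow> real) \<Rightarrow> ('a \<Rightarrow> complex) \<Rightarrow>
      (nat \<Rightarrow> complex) \<Rightarrow> (nat \<Rightarrow> 'a \<Rightarrow> complex) \<Rightarrow> bool" where
  "atomic_decomposition E \<omega> m f c a \<longleftrightarrow>
     (\<forall>j. atom E \<omega> m (a j)) \<and> summable (\<lambda>j. norm (c j)) \<and>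
     f \<in> L1 m \<and> (\<lambda>n. norm_L1 m (\<lambda>x. f x - (\<Sum>j<n. c j * a j x))) \<longlonglongrightarrow> 0"

definition H1 ::
    "('a \<Rightarrow> 'a \<Rightarrow> bool) \<Rightarrow> (nat \<Rightarrow> 'a) set \<Rightarrow> ('a \<Rightarrow> real) \<Rightarrow> ('a \<Rightarrow> complex) set" where
  "H1 E \<omega> m = {f. \<exists>c a. atomic_decomposition E \<omega> m f c a}"

definition norm_H1 ::
    "('a \<Rightarrow> 'a \<Rightarrow> bool) \<Rightarrow> (nat \<Rightarrow> 'a) set \<Rightarrow> ('a \<Rightarrow> real) \<Rightarrow> ('a \<Rightarrow> complex) \<Rightarrow> real" where
  "norm_H1 E \<omega> m f = Inf {\<Sum>j. norm (c j) | c a. atomic_decomposition E \<omega> m f c a}"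

definition average :: "('a \<Rightarrow> real) \<Rightarrow> ('a \<Rightarrow> complex) \<Rightarrow> 'a set \<Rightarrow> complex" where
  "average m f R =
     (\<integral>x\<in>R. f x \<partial>flow_measure m) / complex_of_real (measure (flow_measure m) R)"

definition mean_oscillation :: "('a \<Rightarrow> real) \<Rightarrow> ('a \<Rightarrow> complex) \<Rightarrow> 'a set \<Rightarrow> real" where
  "mean_oscillation m f R =
     (1 / measure (flow_measure m) R) * (\<integral>x\<in>R. norm (f x - average m f R) \<partial>flow_measure m)"

text \<open>Elements of BMO are represented by functions; the norm, which vanishes on constants, is then a
  seminorm.\<close>

definition BMO ::
    "('a \<Rightarrow> 'a \<Rightarrow> bool) \<Rightarrow> (nat \<Rightarrow> 'a) set \<Rightarrow> ('a \<Rightarrow> real) \<Rightarrow> ('a \<Rightarrow> complex) set" where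
  "BMO E \<omega> m = {f. bdd_above (mean_oscillation m f ` {R. admissible E \<omega> R})}"

definition norm_BMO ::
    "('a \<Rightarrow> 'a \<Rightarrow> bool) \<Rightarrow> (nat \<Rightarrow> 'a) set \<Rightarrow> ('a \<Rightarrow> real) \<Rightarrow> ('a \<Rightarrow> complex) \<Rightarrow> real" where
  "norm_BMO E \<omega> m f = (SUP R\<in>{R. admissible E \<omega> R}. mean_oscillation m f R)"


section \<open>Boundedness between function spaces\<close>

definition bounded_between ::
    "('a \<Rightarrow> real) \<Rightarrow> (('a \<Rightarrow> complex) \<Rightarrow> ('a \<Rightarrow> complex)) \<Rightarrow>
      ('a \<Rightarrow> complex) set \<Rightarrow> (('a \<Rightarrow> complex) \<Rightarrow> real) \<Rightarrow>
      ('a \<Rightarrow> complex) set \<Rightarrow> (('a \<Rightarrow> complex) \<Rightarrow> real) \<Rightarrow> bool" where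
  "bounded_between m T X norm_X Y norm_Y \<longleftrightarrow>
     (\<exists>C. \<forall>f\<in>L2 m \<inter> X. T f \<in> Y \<and> norm_Y (T f) \<le> C * norm_X f)"

end

theory Submission
  imports Defs
begin

text \<open>The operator \<open>f \<mapsto> f \<circ> \<pp>\<close> is an isometry \<open>\<Sigma>\<close> of \<open>L\<^sup>2(m)\<close>, and \<open>\<L> = I - X\<close> with
  \<open>X = (\<Sigma> + \<Sigma>\<^sup>*) / 2\<close>, so \<open>\<L>\<^sup>1\<^sup>/\<^sup>2\<close> is the binomial series in \<open>X\<close>. Pick a vertex with at least two successors
  and an atom \<open>a\<close> on them. Then \<open>\<Sigma>\<^sup>* a = 0\<close>, hence \<open>u = \<R>\<^sup>* a\<close> solves \<open>\<L>\<^sup>1\<^sup>/\<^sup>2 u = \<nabla>\<^sup>* a = a\<close>, and on the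
  orthogonal, disjointly supported functions \<open>\<Sigma>\<^sup>j a\<close> the operator \<open>X\<close> is the simple random walk on the half
  line, killed on leaving it. If \<open>u\<close> were integrable, pairing the truncations of
  \<open>(I - X)\<^sup>-\<^sup>1\<^sup>/\<^sup>2 a = \<Sum>\<^sub>n \<alpha>\<^sub>n X\<^sup>n a\<close> with \<open>\<Sum>\<^sub>j \<Sigma>\<^sup>j a\<close> would bound \<open>\<Sum>\<^sub>n \<alpha>\<^sub>n p\<^sub>n\<close>, where \<open>p\<^sub>n\<close> is the survival
  probability of the walk; but both \<open>\<alpha>\<^sub>n\<close> and \<open>p\<^sub>n\<close> are of order \<open>n\<^sup>-\<^sup>1\<^sup>/\<^sup>2\<close>. So \<open>\<R>\<^sup>* a\<close> is not in \<open>L\<^sup>1(m)\<close>. If \<open>\<R>\<close>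
  were bounded from \<open>L\<^sup>\<infinity>(m)\<close> to \<open>BMO(m)\<close>, testing it on finite truncations of the sign of \<open>\<R>\<^sup>* a\<close> against
  \<open>a\<close> would put \<open>\<R>\<^sup>* a\<close> in \<open>L\<^sup>1(m)\<close>.\<close>

section \<open>Binomial coefficients of the square root\<close>

text \<open>Formally \<open>u\<close> is \<open>(I - X)^(-1/2) a\<close>, but the coefficients
  \<alpha>_n are not summable and \<open>X\<close> may have norm 1, so that series cannot simply be
  summed. Instead, truncations of it are multiplied by \<open>(I - X)^(1/2)\<close> before they act
  on \<open>u\<close>; the coefficients of these products have absolute sum at most 2, whatever the
  truncation, and this uniform bound replaces the missing bounded inverse. The operators of the
  statement are definite descriptions, so each identification needs uniqueness as well as existence:
  of adjoints, of the positive square root, and of the extension from the dense range of the root.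
  These questions are moved to a real Hilbert space, where the root of \<open>I - T\<close> for a
  symmetric contraction \<open>T\<close> is an absolutely convergent series, and no spectral theorem
  enters. Multiplication by \<open>sqrt (m x)\<close> carries L2(m) to that setting; complex
  linearity survives there as commutation with complex scalars.\<close>

definition sqrt_coeff :: "nat \<Rightarrow> real" where
  "sqrt_coeff n = (- 1) ^ n * ((1 / 2) gchoose n)"

text \<open>With their signs, these are the Taylor coefficients 1, 1/2, 3/8, ... of
  \<open>(1 - t)^(-1/2)\<close>, as those above are the coefficients 1, -1/2, -1/8, ... of
  \<open>(1 - t)^(1/2)\<close>.\<close>

definition inv_sqrt_coeff :: "nat \<Rightarrow> real" where
  "inv_sqrt_coeff n = (- 1) ^ n * ((- 1 / 2) gchoose n)"

text \<open>The square of \<open>(1 - t)^(1/2)\<close> is \<open>1 - t\<close>; on coefficients this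
  is Vandermonde with 1/2 + 1/2 = 1.\<close>

lemma sqrt_coeff_convolution:
  "(\<Sum>k\<le>n. sqrt_coeff k * sqrt_coeff (n - k)) = (if n = 0 then 1 else if n = 1 then - 1 else 0)"
proof -
  have "(\<Sum>k\<le>n. sqrt_coeff k * sqrt_coeff (n - k))
      = (\<Sum>k\<le>n. (- 1) ^ n * (((1 / 2) gchoose k) * ((1 / 2) gchoose (n - k))))"
  proof (intro sum.cong refl)
    fix k assume "k \<in> {..n}"
    then have "(- 1 :: real) ^ n = (- 1) ^ k * (- 1) ^ (n - k)"
      by (simp flip: power_add)
    then show "sqrt_coeff k * sqrt_coeff (n - k)
        = (- 1) ^ n * (((1 / 2) gchoose k) * ((1 / 2) gchoose (n - k)))"
      by (simp add: sqrt_coeff_def)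
  qed
  also have "\<dots> = (- 1) ^ n * ((1 :: real) gchoose n)"
    using gbinomial_Vandermonde [of "1 / 2 :: real" "1 / 2" n]
    by (simp add: atMost_atLeast0 sum_distrib_left [symmetric])
  also have "(1 :: real) gchoose n = of_nat (1 choose n)"
    using binomial_gbinomial [of 1 n, where 'a = real] by simp
  finally show ?thesis
    by (cases "n \<le> 1") (auto simp: le_Suc_eq binomial_eq_0)
qed

lemma inv_sqrt_coeff_convolution:
  "(\<Sum>k\<le>n. inv_sqrt_coeff k * sqrt_coeff (n - k)) = (if n = 0 then 1 else 0)"
proof -
  have "(\<Sum>k\<le>n. inv_sqrt_coeff k * sqrt_coeff (n - k))
      = (\<Sum>k\<le>n. (- 1) ^ n * (((- 1 / 2) gchoose k) * ((1 / 2) gchoose (n - k))))"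
  proof (intro sum.cong refl)
    fix k assume "k \<in> {..n}"
    then have "(- 1 :: real) ^ n = (- 1) ^ k * (- 1) ^ (n - k)"
      by (simp flip: power_add)
    then show "inv_sqrt_coeff k * sqrt_coeff (n - k)
        = (- 1) ^ n * (((- 1 / 2) gchoose k) * ((1 / 2) gchoose (n - k)))"
      by (simp add: sqrt_coeff_def inv_sqrt_coeff_def)
  qed
  also have "\<dots> = (- 1) ^ n * ((0 :: real) gchoose n)"
    using gbinomial_Vandermonde [of "- 1 / 2 :: real" "1 / 2" n]
    by (simp add: atMost_atLeast0 sum_distrib_left [symmetric])
  finally show ?thesis
    by (cases n) auto
qed

text \<open>Partial sums of coefficients correspond to division by \<open>1 - t\<close>, which turns
  \<open>(1 - t)^(1/2)\<close> into \<open>(1 - t)^(-1/2)\<close>.\<close>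

lemma sum_sqrt_coeff: "(\<Sum>k\<le>n. sqrt_coeff k) = inv_sqrt_coeff n"
  using gbinomial_sum_lower_neg [of "1 / 2 :: real" n]
  by (simp add: sqrt_coeff_def inv_sqrt_coeff_def mult.commute)

lemma inv_sqrt_coeff_0 [simp]: "inv_sqrt_coeff 0 = 1"
  by (simp add: inv_sqrt_coeff_def)

lemma sqrt_coeff_0 [simp]: "sqrt_coeff 0 = 1"
  by (simp add: sqrt_coeff_def)

lemma inv_sqrt_coeff_Suc:
  "inv_sqrt_coeff (Suc n) = inv_sqrt_coeff n * ((2 * real n + 1) / (2 * real n + 2))"
proof -
  have "(- 1 / 2 :: real) gchoose Suc n = ((- 1 / 2) gchoose n) * (- 1 / 2 - real n) / (real n + 1)"
    using gbinomial_mult_1 [of "- 1 / 2 :: real" n] by (simp add: field_simps)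
  then have "inv_sqrt_coeff (Suc n)
      = - ((- 1) ^ n * (((- 1 / 2) gchoose n) * (- 1 / 2 - real n) / (real n + 1)))"
    by (simp add: inv_sqrt_coeff_def)
  also have "\<dots> = inv_sqrt_coeff n * ((1 / 2 + real n) / (real n + 1))"
    by (simp add: inv_sqrt_coeff_def divide_simps algebra_simps)
  also have "(1 / 2 + real n) / (real n + 1) = (2 * real n + 1) / (2 * real n + 2)"
    by (simp add: divide_simps)
  finally show ?thesis .
qed

lemma inv_sqrt_coeff_pos: "0 < inv_sqrt_coeff n"
  by (induction n) (auto simp: inv_sqrt_coeff_Suc)

lemma inv_sqrt_coeff_Suc_le: "inv_sqrt_coeff (Suc n) \<le> inv_sqrt_coeff n"
  using inv_sqrt_coeff_pos [of n] by (simp add: inv_sqrt_coeff_Suc field_simps)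

lemma inv_sqrt_coeff_antimono: "k \<le> n \<Longrightarrow> inv_sqrt_coeff n \<le> inv_sqrt_coeff k"
  by (rule lift_Suc_antimono_le [of inv_sqrt_coeff]) (auto simp: inv_sqrt_coeff_Suc_le)

text \<open>The quantity \<open>n * (inv_sqrt_coeff n)^2\<close> starts at 1/4 for
  \<open>n = 1\<close> and does not decrease, because
  \<open>(2 * y + 1)^2 \<ge> 4 * y * (y + 1)\<close>.\<close>

lemma inv_sqrt_coeff_ge: "1 / (2 * sqrt (real (Suc n))) \<le> inv_sqrt_coeff (Suc n)"
proof -
  have aux: "(y + 1) * ((2 * y + 1) / (2 * y + 2))\<^sup>2 = (2 * y + 1)\<^sup>2 / (4 * (y + 1))"
    if "y \<ge> 0" for y :: real
  proof -
    have "2 * y + 2 = 2 * (y + 1)" by simp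
    then show ?thesis
      using that by (simp only: power_divide power_mult_distrib) (simp add: power2_eq_square)
  qed
  have "1 / 4 \<le> real (Suc n) * (inv_sqrt_coeff (Suc n))\<^sup>2"
  proof (induction n)
    case 0
    show ?case by (simp add: inv_sqrt_coeff_Suc power2_eq_square)
  next
    case (Suc n)
    let ?a = "inv_sqrt_coeff (Suc n)" and ?x = "real (Suc n)"
    have "real (Suc (Suc n)) * (inv_sqrt_coeff (Suc (Suc n)))\<^sup>2
        = ?a\<^sup>2 * ((?x + 1) * ((2 * ?x + 1) / (2 * ?x + 2))\<^sup>2)"
      by (simp only: inv_sqrt_coeff_Suc [of "Suc n"] power_mult_distrib) (simp add: mult_ac add_ac)
    also have "(?x + 1) * ((2 * ?x + 1) / (2 * ?x + 2))\<^sup>2 = (2 * ?x + 1)\<^sup>2 / (4 * (?x + 1))"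
      by (rule aux) simp
    also have "?a\<^sup>2 * \<dots> \<ge> ?a\<^sup>2 * ?x"
      by (intro mult_left_mono) (auto simp: field_simps power2_eq_square)
    finally show ?case using Suc by (simp add: mult.commute)
  qed
  then have "(1 / (2 * sqrt (real (Suc n))))\<^sup>2 \<le> (inv_sqrt_coeff (Suc n))\<^sup>2"
    by (simp add: power_divide power_mult_distrib field_simps del: of_nat_Suc)
  then show ?thesis
    using inv_sqrt_coeff_pos [of "Suc n"] by (simp add: power2_le_iff_abs_le)
qed

lemma sqrt_coeff_Suc: "sqrt_coeff (Suc n) = inv_sqrt_coeff (Suc n) - inv_sqrt_coeff n"
  using sum_sqrt_coeff [of "Suc n"] sum_sqrt_coeff [of n] by simp

lemma sqrt_coeff_Suc_nonpos: "sqrt_coeff (Suc n) \<le> 0"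
  using inv_sqrt_coeff_Suc_le [of n] by (simp add: sqrt_coeff_Suc)

text \<open>After the constant term all coefficients are nonpositive, so their absolute values
  telescope. The resulting total of at most 1 gives both absolute convergence at an operator of norm
  1 and positivity of the root.\<close>

lemma sum_abs_sqrt_coeff_Suc: "(\<Sum>n<N. \<bar>sqrt_coeff (Suc n)\<bar>) = 1 - inv_sqrt_coeff N"
proof (induction N)
  case (Suc N)
  then show ?case
    using sqrt_coeff_Suc_nonpos [of N] sqrt_coeff_Suc [of N] by simp
qed simp

lemma summable_abs_sqrt_coeff: "summable (\<lambda>n. \<bar>sqrt_coeff n\<bar>)"
proof -
  have "summable (\<lambda>n. \<bar>sqrt_coeff (Suc n)\<bar>)"
    by (rule summableI_nonneg_bounded [where x = 1])
       (auto simp: sum_abs_sqrt_coeff_Suc less_imp_le [OF inv_sqrt_coeff_pos])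
  then show ?thesis
    by (rule summable_Suc_iff [THEN iffD1])
qed

lemma suminf_abs_sqrt_coeff_Suc_le: "(\<Sum>n. \<bar>sqrt_coeff (Suc n)\<bar>) \<le> 1"
proof (rule suminf_le_const)
  show "summable (\<lambda>n. \<bar>sqrt_coeff (Suc n)\<bar>)"
    using summable_abs_sqrt_coeff by (rule summable_Suc_iff [THEN iffD2])
  show "\<And>n. (\<Sum>n<n. \<bar>sqrt_coeff (Suc n)\<bar>) \<le> 1"
    by (auto simp: sum_abs_sqrt_coeff_Suc less_imp_le [OF inv_sqrt_coeff_pos])
qed

section \<open>Square roots in real Hilbert spaces\<close>

text \<open>A zero of a nonnegative form is a minimum, so the form cannot decrease to first order in
  the direction \<open>- P y\<close>.\<close>

lemma psd_form_eq_0: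
  fixes P :: "'h :: real_inner \<Rightarrow> 'h"
  assumes "bounded_linear P" and sym: "\<And>x y. inner (P x) y = inner x (P y)"
    and pos: "\<And>x. 0 \<le> inner (P x) x" and "inner (P y) y = 0"
  shows "P y = 0"
proof (rule ccontr)
  interpret P: bounded_linear P by fact
  assume "P y \<noteq> 0"
  define a b where "a = inner (P y) (P y)" and "b = inner (P (P y)) (P y)"
  have "a > 0" using \<open>P y \<noteq> 0\<close> by (simp add: a_def)
  have "b \<ge> 0" using pos by (simp add: b_def)
  have "inner (P (y - t *\<^sub>R P y)) (y - t *\<^sub>R P y) = t * (t * b - 2 * a)" for t
    using assms(4) sym [of y "P y"]
    by (simp add: P.diff P.scaleR inner_diff_left inner_diff_right a_def b_def algebra_simps inner_commute)
  then have nonneg: "0 \<le> t * (t * b - 2 * a)" for t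
    using pos [of "y - t *\<^sub>R P y"] by simp
  \<comment> \<open>This \<open>t\<close> gives \<open>t * b \<le> a\<close>, so the factor
    \<open>t * b - 2 * a\<close> is negative; the \<open>+ 1\<close> covers
    \<open>b = 0\<close>.\<close>
  define t where "t = a / (b + 1)"
  have "t > 0" using \<open>a > 0\<close> \<open>b \<ge> 0\<close> by (simp add: t_def)
  then have "0 \<le> t * b - 2 * a"
    using nonneg [of t] by (simp add: zero_le_mult_iff)
  moreover have "t * b \<le> a"
    using \<open>a > 0\<close> \<open>b \<ge> 0\<close> by (simp add: t_def field_simps)
  ultimately show False using \<open>a > 0\<close> by linarith
qed

locale symmetric_contraction = bounded_linear T for T :: "'h :: {real_inner, banach} \<Rightarrow> 'h" +
  assumes symmetric: "inner (T x) y = inner x (T y)"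
    and contraction: "norm (T x) \<le> norm x"
begin

lemma bounded_linear_funpow: "bounded_linear (T ^^ n)"
proof (induction n)
  case 0
  show ?case by (simp add: id_def bounded_linear_ident)
next
  case (Suc n)
  then show ?case
    using bounded_linear_compose [OF bounded_linear_axioms Suc] by (simp add: o_def)
qed

lemma norm_funpow_le: "norm ((T ^^ n) x) \<le> norm x"
  by (induction n) (auto intro: order_trans [OF contraction])

lemma funpow_symmetric: "inner ((T ^^ n) x) y = inner x ((T ^^ n) y)"
  by (induction n arbitrary: x y) (simp_all add: symmetric funpow_swap1)

definition power_series :: "(nat \<Rightarrow> real) \<Rightarrow> 'h \<Rightarrow> 'h" where
  "power_series c x = (\<Sum>n. c n *\<^sub>R (T ^^ n) x)"

lemma norm_power_series_term_le: "norm (c n *\<^sub>R (T ^^ n) x) \<le> \<bar>c n\<bar> * norm x"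
  using norm_funpow_le [of n x] by (simp add: mult_left_mono)

context
  fixes c :: "nat \<Rightarrow> real"
  assumes c: "summable (\<lambda>n. \<bar>c n\<bar>)"
begin

lemma summable_norm_power_series: "summable (\<lambda>n. norm (c n *\<^sub>R (T ^^ n) x))"
  by (rule summable_comparison_test' [OF summable_mult2 [OF c, of "norm x"]])
     (use norm_power_series_term_le [of c _ x] in simp)

lemma summable_power_series: "summable (\<lambda>n. c n *\<^sub>R (T ^^ n) x)"
  by (rule summable_norm_cancel [OF summable_norm_power_series])

lemma norm_power_series_le: "norm (power_series c x) \<le> (\<Sum>n. \<bar>c n\<bar>) * norm x"
proof -
  have "norm (power_series c x) \<le> (\<Sum>n. norm (c n *\<^sub>R (T ^^ n) x))"
    unfolding power_series_def by (rule summable_norm [OF summable_norm_power_series])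
  also have "\<dots> \<le> (\<Sum>n. \<bar>c n\<bar> * norm x)"
    by (intro suminf_le norm_power_series_term_le summable_norm_power_series summable_mult2 c)
  finally show ?thesis
    by (simp add: suminf_mult2 [OF c])
qed

lemma power_series_commute:
  assumes "bounded_linear C" and "\<And>x. C (T x) = T (C x)"
  shows "C (power_series c x) = power_series c (C x)"
proof -
  interpret C: bounded_linear C by fact
  have "C ((T ^^ n) x) = (T ^^ n) (C x)" for n x
    by (induction n) (simp_all add: assms)
  then show ?thesis
    unfolding power_series_def
    by (simp add: C.suminf [OF summable_power_series] C.scaleR)
qed

lemma bounded_linear_power_series: "bounded_linear (power_series c)"
proof (rule bounded_linear_intro)
  fix x y :: 'h and r :: real
  show "power_series c (x + y) = power_series c x + power_series c y"
    unfolding power_series_def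
    by (simp add: suminf_add summable_power_series scaleR_add_right
        linear_add [OF bounded_linear.linear [OF bounded_linear_funpow]])
  show "power_series c (r *\<^sub>R x) = r *\<^sub>R power_series c x"
    by (rule power_series_commute [symmetric])
       (simp_all add: bounded_linear_scaleR_right scaleR)
  show "norm (power_series c x) \<le> norm x * (\<Sum>n. \<bar>c n\<bar>)"
    using norm_power_series_le by (simp add: mult.commute)
qed

lemma inner_power_series: "inner (power_series c x) y = (\<Sum>n. c n * inner ((T ^^ n) x) y)"
  unfolding power_series_def
  by (simp add: bounded_linear.suminf [OF bounded_linear_inner_left summable_power_series])

lemma summable_inner_power_series: "summable (\<lambda>n. c n * inner ((T ^^ n) x) y)"
  using bounded_linear.summable [OF bounded_linear_inner_left summable_power_series, of x y] by simp

lemma power_series_symmetric: "inner (power_series c x) y = inner x (power_series c y)"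
proof -
  have "inner (power_series c x) y = (\<Sum>n. c n * inner x ((T ^^ n) y))"
    by (simp add: inner_power_series funpow_symmetric)
  also have "\<dots> = inner (power_series c y) x"
    by (simp add: inner_power_series inner_commute [of x])
  finally show ?thesis by (simp add: inner_commute)
qed

end

text \<open>Both sides are limits of one double family \<open>f k l\<close>, summed over squares
  \<open>S1 N\<close> and over triangles \<open>S2 N\<close>. The difference is dominated by that of
  the scalar family of absolute values, whose square sums and triangle sums share their
  limit.\<close>

lemma power_series_compose:
  assumes c: "summable (\<lambda>n. \<bar>c n\<bar>)" and d: "summable (\<lambda>n. \<bar>d n\<bar>)"
    and cd: "summable (\<lambda>n. \<bar>\<Sum>k\<le>n. c k * d (n - k)\<bar>)"
  shows "power_series c (power_series d x) = power_series (\<lambda>n. \<Sum>k\<le>n. c k * d (n - k)) x"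
proof -
  define f where "f = (\<lambda>k l. (c k * d l) *\<^sub>R (T ^^ (k + l)) x)"
  define S1 where "S1 = (\<lambda>N. {..<N} \<times> {..<N :: nat})"
  define S2 where "S2 = (\<lambda>N. {(i, j). i + j < (N :: nat)})"
  have fin: "finite (S1 N)" and sub: "S2 N \<subseteq> S1 N" for N
    by (auto simp: S1_def S2_def)
  define y where "y = power_series d x"
  define Y where "Y = (\<lambda>N. \<Sum>l<N. d l *\<^sub>R (T ^^ l) x)"
  define P where "P = (\<lambda>N z. \<Sum>k<N. c k *\<^sub>R (T ^^ k) z)"
  have Y: "Y \<longlonglongrightarrow> y"
    unfolding Y_def y_def power_series_def by (rule summable_LIMSEQ [OF summable_power_series [OF d]])
  have P: "(\<lambda>N. P N y) \<longlonglongrightarrow> power_series c y"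
    unfolding P_def power_series_def by (rule summable_LIMSEQ [OF summable_power_series [OF c]])
  have P_diff: "P N (a - b) = P N a - P N b" for N a b
    unfolding P_def
    by (simp add: linear_diff [OF bounded_linear.linear [OF bounded_linear_funpow]]
        scaleR_diff_right sum_subtractf)
  have P_bound: "norm (P N z) \<le> (\<Sum>n. \<bar>c n\<bar>) * norm z" for N z
  proof -
    have "norm (P N z) \<le> (\<Sum>k<N. \<bar>c k\<bar> * norm z)"
      unfolding P_def by (intro sum_norm_le norm_power_series_term_le)
    also have "\<dots> \<le> (\<Sum>n. \<bar>c n\<bar>) * norm z"
      unfolding sum_distrib_right [symmetric]
      by (intro mult_right_mono sum_le_suminf c) auto
    finally show ?thesis .
  qed
  \<comment> \<open>The outer partial sum acts on a moving argument; \<open>P_bound\<close> is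
    uniform in \<open>N\<close>, which allows \<open>Y N\<close> to take the place of its
    limit.\<close>
  have "(\<lambda>N. P N (Y N - y)) \<longlonglongrightarrow> 0"
  proof (rule Lim_null_comparison)
    show "\<forall>\<^sub>F N in sequentially. norm (P N (Y N - y)) \<le> (\<Sum>n. \<bar>c n\<bar>) * norm (Y N - y)"
      by (simp add: P_bound)
    show "(\<lambda>N. (\<Sum>n. \<bar>c n\<bar>) * norm (Y N - y)) \<longlonglongrightarrow> 0"
      using tendsto_mult_right_zero [OF tendsto_norm_zero [OF LIM_zero [OF Y]]] by simp
  qed
  then have "(\<lambda>N. P N (Y N - y) + P N y) \<longlonglongrightarrow> 0 + power_series c y"
    by (intro tendsto_add P)
  then have square: "(\<lambda>N. P N (Y N)) \<longlonglongrightarrow> power_series c y"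
    by (simp add: P_diff)
  have square_eq: "P N (Y N) = (\<Sum>(k, l)\<in>S1 N. f k l)" for N
    unfolding P_def Y_def S1_def f_def
    by (simp add: sum.cartesian_product [symmetric] linear_sum [OF bounded_linear.linear [OF bounded_linear_funpow]]
        linear_scale [OF bounded_linear.linear [OF bounded_linear_funpow]] scaleR_sum_right funpow_add)
  have triangle_eq: "(\<Sum>n<N. (\<Sum>k\<le>n. c k * d (n - k)) *\<^sub>R (T ^^ n) x) = (\<Sum>(k, l)\<in>S2 N. f k l)" for N
    unfolding S2_def f_def sum.triangle_reindex scaleR_sum_left
    by (intro sum.cong refl) simp
  define a where "a = (\<lambda>k l. \<bar>c k\<bar> * \<bar>d l\<bar>)"
  have "(\<lambda>N. (\<Sum>n<N. \<Sum>k\<le>n. \<bar>c k\<bar> * \<bar>d (n - k)\<bar>)) \<longlonglongrightarrow> (\<Sum>n. \<bar>c n\<bar>) * (\<Sum>n. \<bar>d n\<bar>)"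
    using Cauchy_product_sums [of "\<lambda>n. \<bar>c n\<bar>" "\<lambda>n. \<bar>d n\<bar>"] c d by (simp add: sums_def)
  then have a2: "(\<lambda>N. \<Sum>(k, l)\<in>S2 N. a k l) \<longlonglongrightarrow> (\<Sum>n. \<bar>c n\<bar>) * (\<Sum>n. \<bar>d n\<bar>)"
    unfolding S2_def a_def sum.triangle_reindex .
  have "(\<lambda>N. (\<Sum>n<N. \<bar>c n\<bar>) * (\<Sum>n<N. \<bar>d n\<bar>)) \<longlonglongrightarrow> (\<Sum>n. \<bar>c n\<bar>) * (\<Sum>n. \<bar>d n\<bar>)"
    by (intro tendsto_mult summable_LIMSEQ c d)
  then have a1: "(\<lambda>N. \<Sum>(k, l)\<in>S1 N. a k l) \<longlonglongrightarrow> (\<Sum>n. \<bar>c n\<bar>) * (\<Sum>n. \<bar>d n\<bar>)"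
    unfolding S1_def a_def by (simp add: sum_product sum.cartesian_product)
  have "(\<lambda>N. (\<Sum>(k, l)\<in>S1 N. f k l) - (\<Sum>(k, l)\<in>S2 N. f k l)) \<longlonglongrightarrow> 0"
  proof (rule Lim_null_comparison)
    show "\<forall>\<^sub>F N in sequentially. norm ((\<Sum>(k, l)\<in>S1 N. f k l) - (\<Sum>(k, l)\<in>S2 N. f k l))
        \<le> ((\<Sum>(k, l)\<in>S1 N. a k l) - (\<Sum>(k, l)\<in>S2 N. a k l)) * norm x"
    proof (intro always_eventually allI)
      fix N
      have "norm (f k l) \<le> a k l * norm x" for k l
        using norm_power_series_term_le [of "\<lambda>_. c k * d l" "k + l" x]
        by (simp add: f_def a_def abs_mult)
      then have "norm (\<Sum>(k, l)\<in>S1 N - S2 N. f k l) \<le> (\<Sum>(k, l)\<in>S1 N - S2 N. a k l * norm x)"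
        by (intro sum_norm_le) auto
      then show "norm ((\<Sum>(k, l)\<in>S1 N. f k l) - (\<Sum>(k, l)\<in>S2 N. f k l))
          \<le> ((\<Sum>(k, l)\<in>S1 N. a k l) - (\<Sum>(k, l)\<in>S2 N. a k l)) * norm x"
        by (simp add: sum_diff [OF fin sub, symmetric] sum_distrib_right case_prod_unfold)
    qed
    show "(\<lambda>N. ((\<Sum>(k, l)\<in>S1 N. a k l) - (\<Sum>(k, l)\<in>S2 N. a k l)) * norm x) \<longlonglongrightarrow> 0"
      using tendsto_mult_left_zero [OF tendsto_diff [OF a1 a2, simplified]] by simp
  qed
  from tendsto_diff [OF square this] have
    "(\<lambda>N. \<Sum>n<N. (\<Sum>k\<le>n. c k * d (n - k)) *\<^sub>R (T ^^ n) x) \<longlonglongrightarrow> power_series c y"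
    by (simp add: square_eq triangle_eq)
  moreover have "(\<lambda>N. \<Sum>n<N. (\<Sum>k\<le>n. c k * d (n - k)) *\<^sub>R (T ^^ n) x)
      \<longlonglongrightarrow> power_series (\<lambda>n. \<Sum>k\<le>n. c k * d (n - k)) x"
    unfolding power_series_def by (rule summable_LIMSEQ [OF summable_power_series [OF cd]])
  ultimately show ?thesis
    unfolding y_def by (rule LIMSEQ_unique)
qed

definition sqrt_op :: "'h \<Rightarrow> 'h" where
  "sqrt_op = power_series sqrt_coeff"

lemmas sqrt_op_commute = power_series_commute [OF summable_abs_sqrt_coeff, folded sqrt_op_def]
  and bounded_linear_sqrt_op = bounded_linear_power_series [OF summable_abs_sqrt_coeff, folded sqrt_op_def]
  and sqrt_op_symmetric = power_series_symmetric [OF summable_abs_sqrt_coeff, folded sqrt_op_def]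

lemma sqrt_op_sqrt_op: "sqrt_op (sqrt_op x) = x - T x"
proof -
  have eq: "(\<lambda>n. (\<Sum>k\<le>n. sqrt_coeff k * sqrt_coeff (n - k)) *\<^sub>R (T ^^ n) x)
      = (\<lambda>n. if n \<in> {0, 1} then (if n = 0 then 1 else - 1) *\<^sub>R (T ^^ n) x else 0)"
    by (auto simp: sqrt_coeff_convolution fun_eq_iff)
  have "summable (\<lambda>n. \<bar>\<Sum>k\<le>n. sqrt_coeff k * sqrt_coeff (n - k)\<bar>)"
    by (rule summable_finite [of "{0, 1}"]) (auto simp: sqrt_coeff_convolution)
  from power_series_compose [OF summable_abs_sqrt_coeff summable_abs_sqrt_coeff this, of x]
  have "sqrt_op (sqrt_op x) = (\<Sum>n. if n \<in> {0, 1} then (if n = 0 then 1 else - 1) *\<^sub>R (T ^^ n) x else 0)"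
    by (simp add: sqrt_op_def power_series_def eq)
  also have "\<dots> = (\<Sum>n\<in>{0, 1 :: nat}. (if n = 0 then 1 else - 1) *\<^sub>R (T ^^ n) x)"
    by (subst suminf_finite [of "{0, 1}"]) auto
  finally show ?thesis by simp
qed

text \<open>The constant term contributes the squared norm of \<open>x\<close>, and the remaining
  coefficients, of absolute sum at most 1, cannot outweigh it.\<close>

lemma sqrt_op_nonneg: "0 \<le> inner (sqrt_op x) x"
proof -
  let ?f = "\<lambda>n. sqrt_coeff n * inner ((T ^^ n) x) x"
  have sum: "summable ?f"
    by (rule summable_inner_power_series [OF summable_abs_sqrt_coeff])
  have sum': "summable (\<lambda>n. \<bar>sqrt_coeff (Suc n)\<bar>)"
    using summable_abs_sqrt_coeff by (rule summable_Suc_iff [THEN iffD2])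
  have "- (\<Sum>n. \<bar>sqrt_coeff (Suc n)\<bar> * (norm x)\<^sup>2) \<le> (\<Sum>n. ?f (Suc n))"
  proof (subst suminf_minus [symmetric], goal_cases)
    case 1
    show ?case by (rule summable_mult2 [OF sum'])
  next
    case 2
    have "- (\<bar>sqrt_coeff n\<bar> * (norm x)\<^sup>2) \<le> ?f n" for n
    proof -
      have "\<bar>inner ((T ^^ n) x) x\<bar> \<le> norm x * norm x"
        by (rule order_trans [OF Cauchy_Schwarz_ineq2]) (simp add: mult_right_mono norm_funpow_le)
      then have "\<bar>?f n\<bar> \<le> \<bar>sqrt_coeff n\<bar> * (norm x)\<^sup>2"
        by (simp add: abs_mult power2_eq_square mult_left_mono)
      then show ?thesis by linarith
    qed
    then show ?case
      by (intro suminf_le summable_minus summable_mult2 sum' summable_Suc_iff [THEN iffD2] sum)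
  qed
  moreover have "(\<Sum>n. \<bar>sqrt_coeff (Suc n)\<bar> * (norm x)\<^sup>2) \<le> 1 * (norm x)\<^sup>2"
    unfolding suminf_mult2 [OF sum', symmetric]
    by (rule mult_right_mono [OF suminf_abs_sqrt_coeff_Suc_le]) simp
  moreover have "inner (sqrt_op x) x = (norm x)\<^sup>2 + (\<Sum>n. ?f (Suc n))"
    unfolding sqrt_op_def inner_power_series [OF summable_abs_sqrt_coeff]
    using suminf_split_head [OF sum] by (simp add: power2_norm_eq_inner)
  ultimately show ?thesis by linarith
qed

text \<open>A competitor \<open>S\<close> commutes with \<open>T\<close>, which is the identity
  minus its square, hence with the series. For \<open>y = sqrt_op x - S x\<close> the sum of the two
  roots then kills \<open>y\<close>, so both nonnegative forms vanish at \<open>y\<close> and each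
  root kills \<open>y\<close> by itself.\<close>

lemma sqrt_op_unique:
  assumes "bounded_linear S" and sym: "\<And>x y. inner (S x) y = inner x (S y)"
    and pos: "\<And>x. 0 \<le> inner (S x) x" and sq: "\<And>x. S (S x) = x - T x"
  shows "S = sqrt_op"
proof
  fix x
  interpret S: bounded_linear S by fact
  interpret Q: bounded_linear sqrt_op by (rule bounded_linear_sqrt_op)
  have ST: "S (T x) = T (S x)" for x
  proof -
    have "S x - T (S x) = S (x - T x)" by (metis sq)
    then show ?thesis by (simp add: S.diff)
  qed
  have comm: "S (sqrt_op x) = sqrt_op (S x)" for x
    by (rule sqrt_op_commute [OF assms(1) ST])
  define y where "y = sqrt_op x - S x"
  have "sqrt_op y + S y = 0"
    by (simp add: y_def Q.diff S.diff comm sq sqrt_op_sqrt_op)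
  then have "inner (sqrt_op y) y + inner (S y) y = 0"
    by (simp flip: inner_add_left)
  then have "inner (sqrt_op y) y = 0" "inner (S y) y = 0"
    using pos [of y] sqrt_op_nonneg [of y] by auto
  then have "sqrt_op y = 0" "S y = 0"
    by (auto intro: psd_form_eq_0 assms bounded_linear_sqrt_op sqrt_op_symmetric sqrt_op_nonneg)
  moreover have "inner y y = inner (sqrt_op y) x - inner (S y) x"
    by (simp add: sym sqrt_op_symmetric flip: inner_diff_right y_def)
  ultimately have "y = 0" by simp
  then show "S x = sqrt_op x" by (simp add: y_def)
qed

text \<open>The powers of \<open>T\<close> itself need not converge, as minus the identity shows;
  averaging with the identity repairs this. By symmetry the inner product of two powers of
  \<open>P\<close> depends on the sum of the exponents only, and for even exponents it is again a
  squared norm \<open>s k\<close>. These decrease, so the even powers form a Cauchy sequence; its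
  limit is fixed by \<open>P\<close> applied twice.\<close>

lemma funpow_half_converges:
  assumes inj: "\<And>x. T x = x \<Longrightarrow> x = 0"
  defines "P \<equiv> \<lambda>x. (1 / 2) *\<^sub>R (x + T x)"
  shows "(\<lambda>n. (P ^^ (2 * n)) x) \<longlonglongrightarrow> 0"
proof -
  have linP: "bounded_linear P"
    unfolding P_def
    by (intro bounded_linear_scaleR_right bounded_linear_add bounded_linear_ident bounded_linear_axioms
        bounded_linear_compose [OF bounded_linear_scaleR_right])
  have contrP: "norm (P z) \<le> norm z" for z
    using norm_triangle_ineq [of z "T z"] contraction [of z] by (simp add: P_def)
  interpret P: symmetric_contraction P
    by (intro symmetric_contraction.intro symmetric_contraction_axioms.intro linP contrP)
       (simp add: P_def inner_add_left inner_add_right symmetric)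
  define s where "s n = (norm ((P ^^ n) x))\<^sup>2" for n
  have inner_P: "inner ((P ^^ i) x) ((P ^^ j) x) = s k" if "i + j = 2 * k" for i j k
  proof -
    have "inner ((P ^^ i) x) ((P ^^ j) x) = inner x ((P ^^ (i + j)) x)"
      by (simp add: P.funpow_symmetric funpow_add)
    also have "\<dots> = s k"
      by (simp add: that s_def mult_2 funpow_add power2_norm_eq_inner P.funpow_symmetric)
    finally show ?thesis .
  qed
  have "decseq s"
    unfolding s_def by (intro decseq_SucI power_mono) (auto simp: P.contraction)
  then obtain L where "s \<longlonglongrightarrow> L"
    by (rule decseq_convergent [of s 0]) (auto simp: s_def)
  then have Cs: "Cauchy s" by (rule LIMSEQ_imp_Cauchy)
  have dist_eq: "(norm ((P ^^ (2 * n)) x - (P ^^ (2 * k)) x))\<^sup>2 = (s (2 * n) - s (n + k)) + (s (2 * k) - s (n + k))" for n k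
  proof -
    have "(norm ((P ^^ (2 * n)) x - (P ^^ (2 * k)) x))\<^sup>2
        = inner ((P ^^ (2 * n)) x) ((P ^^ (2 * n)) x) - 2 * inner ((P ^^ (2 * n)) x) ((P ^^ (2 * k)) x)
          + inner ((P ^^ (2 * k)) x) ((P ^^ (2 * k)) x)"
      by (simp add: power2_norm_eq_inner inner_diff_left inner_diff_right inner_commute)
    also have "\<dots> = s (2 * n) - 2 * s (n + k) + s (2 * k)"
      using inner_P [of "2 * n" "2 * n" "2 * n"] inner_P [of "2 * n" "2 * k" "n + k"]
        inner_P [of "2 * k" "2 * k" "2 * k"] by simp
    finally show ?thesis by simp
  qed
  have "Cauchy (\<lambda>n. (P ^^ (2 * n)) x)"
  proof (rule CauchyI)
    fix e :: real assume "e > 0"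
    then obtain M where M: "\<And>i j. i \<ge> M \<Longrightarrow> j \<ge> M \<Longrightarrow> norm (s i - s j) < e\<^sup>2 / 2"
      using CauchyD [OF Cs, of "e\<^sup>2 / 2"] by auto
    show "\<exists>M. \<forall>m\<ge>M. \<forall>n\<ge>M. norm ((P ^^ (2 * m)) x - (P ^^ (2 * n)) x) < e"
    proof (intro exI [of _ M] allI impI)
      fix i j assume "M \<le> i" "M \<le> j"
      then have "norm (s (2 * i) - s (i + j)) < e\<^sup>2 / 2" "norm (s (2 * j) - s (i + j)) < e\<^sup>2 / 2"
        using M [of "2 * i" "i + j"] M [of "2 * j" "i + j"] by simp_all
      then have "(norm ((P ^^ (2 * i)) x - (P ^^ (2 * j)) x))\<^sup>2 < e\<^sup>2"
        unfolding dist_eq real_norm_def by linarith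
      then show "norm ((P ^^ (2 * i)) x - (P ^^ (2 * j)) x) < e"
        using \<open>e > 0\<close> by (simp add: power2_less_imp_less)
    qed
  qed
  then obtain h where h: "(\<lambda>n. (P ^^ (2 * n)) x) \<longlonglongrightarrow> h"
    by (auto simp: Cauchy_convergent_iff convergent_def)
  have "(\<lambda>n. P (P ((P ^^ (2 * n)) x))) \<longlonglongrightarrow> P (P h)"
    by (intro P.tendsto h)
  moreover have "(\<lambda>n. P (P ((P ^^ (2 * n)) x))) \<longlonglongrightarrow> h"
    using LIMSEQ_Suc [OF h] by simp
  ultimately have "P (P h) = h" by (rule LIMSEQ_unique)
  then have "norm h \<le> norm (P h)" using contrP [of "P h"] by simp
  \<comment> \<open>equality in the triangle inequality for \<open>h + T h\<close> forces \<open>T h = h\<close>\<close>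
  then have "4 * (norm h)\<^sup>2 \<le> (norm (h + T h))\<^sup>2"
    using power_mono [of "2 * norm h" "norm (h + T h)" 2] by (simp add: P_def power_mult_distrib)
  moreover have "(norm (T h))\<^sup>2 \<le> (norm h)\<^sup>2"
    by (intro power_mono contraction) simp
  moreover have "(norm (h - T h))\<^sup>2 + (norm (h + T h))\<^sup>2 = 2 * (norm h)\<^sup>2 + 2 * (norm (T h))\<^sup>2"
    by (simp add: power2_norm_eq_inner inner_diff_left inner_diff_right inner_add_left inner_add_right)
  ultimately have "(norm (h - T h))\<^sup>2 \<le> 0" by linarith
  then have "T h = h" by simp
  with inj have "h = 0" by blast
  with h show ?thesis by simp
qed

text \<open>\<open>I - P\<close> is half of \<open>I - T\<close>, so every
  \<open>x - (P ^^ n) x\<close> lies in the range of \<open>I - T\<close> and hence of the root,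
  while the even powers of \<open>P\<close> tend to 0.\<close>

lemma closure_range_sqrt_op:
  assumes inj: "\<And>x. T x = x \<Longrightarrow> x = 0"
  shows "closure (range sqrt_op) = UNIV"
proof -
  define P where "P = (\<lambda>x. (1 / 2) *\<^sub>R (x + T x))"
  have "\<exists>z. x - (P ^^ n) x = z - T z" for n x
  proof (induction n)
    case 0
    show ?case by (auto intro: exI [of _ 0] simp: zero)
  next
    case (Suc n)
    then obtain z where z: "x - (P ^^ n) x = z - T z" by blast
    let ?w = "(P ^^ n) x"
    have "x - (P ^^ Suc n) x = (x - ?w) + (?w - P ?w)" by simp
    also have "?w - P ?w = ((1 / 2) *\<^sub>R ?w + (1 / 2) *\<^sub>R ?w) - P ?w"
      by (simp flip: scaleR_add_left)
    also have "\<dots> = (1 / 2) *\<^sub>R ?w - T ((1 / 2) *\<^sub>R ?w)"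
      by (simp add: P_def scaleR scaleR_add_right)
    finally have "x - (P ^^ Suc n) x = (z + (1 / 2) *\<^sub>R ?w) - T (z + (1 / 2) *\<^sub>R ?w)"
      by (simp add: z add)
    then show ?case by blast
  qed
  then have "x - (P ^^ n) x \<in> range sqrt_op" for n x
    by (metis sqrt_op_sqrt_op rangeI)
  moreover have "(\<lambda>n. x - (P ^^ (2 * n)) x) \<longlonglongrightarrow> x" for x
    using tendsto_diff [OF tendsto_const funpow_half_converges [OF inj], of x x] by (simp add: P_def)
  ultimately have "x \<in> closure (range sqrt_op)" for x
    unfolding closure_sequential by (metis (no_types, lifting))
  then show ?thesis by blast
qed

end

text \<open>Simple random walk on the half line, killed on leaving it; \<open>walk n j\<close> is the probability
  of being at \<open>j\<close> at time \<open>n\<close> after starting at \<open>0\<close>.\<close>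

fun walk :: "nat \<Rightarrow> nat \<Rightarrow> real" where
  "walk 0 j = (if j = 0 then 1 else 0)"
| "walk (Suc n) j = ((if j = 0 then 0 else walk n (j - 1)) + walk n (Suc j)) / 2"

lemma walk_nonneg: "0 \<le> walk n j"
  by (induction n arbitrary: j) auto

lemma walk_eq_0: "n < j \<Longrightarrow> walk n j = 0"
  by (induction n arbitrary: j) auto

text \<open>One step of the walk is moved from the distribution onto the test function, extended by
  0 to the killing site. Vector values let one identity serve both the scalar moments and the orbit
  of \<open>e 0\<close>.\<close>

lemma sum_walk_Suc:
  fixes \<phi> :: "nat \<Rightarrow> 'b :: real_vector"
  shows "(\<Sum>j\<le>Suc n. walk (Suc n) j *\<^sub>R \<phi> j)
    = (\<Sum>j\<le>n. walk n j *\<^sub>R ((1 / 2) *\<^sub>R (\<phi> (Suc j) + (if j = 0 then 0 else \<phi> (j - 1)))))"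
proof -
  have "(\<Sum>j\<le>Suc n. walk (Suc n) j *\<^sub>R \<phi> j)
      = (\<Sum>j\<le>Suc n. ((if j = 0 then 0 else walk n (j - 1)) / 2) *\<^sub>R \<phi> j)
        + (\<Sum>j\<le>Suc n. (walk n (Suc j) / 2) *\<^sub>R \<phi> j)"
    by (simp add: add_divide_distrib scaleR_add_left sum.distrib del: sum.atMost_Suc)
  also have "(\<Sum>j\<le>Suc n. ((if j = 0 then 0 else walk n (j - 1)) / 2) *\<^sub>R \<phi> j)
      = (\<Sum>j\<le>n. (walk n j / 2) *\<^sub>R \<phi> (Suc j))"
    by (simp add: sum.atMost_Suc_shift del: sum.atMost_Suc)
  also have "(\<Sum>j\<le>Suc n. (walk n (Suc j) / 2) *\<^sub>R \<phi> j)
      = (\<Sum>j\<le>Suc (Suc n). (walk n j / 2) *\<^sub>R (if j = 0 then 0 else \<phi> (j - 1)))"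
    by (subst (2) sum.atMost_Suc_shift) simp
  also have "\<dots> = (\<Sum>j\<le>n. (walk n j / 2) *\<^sub>R (if j = 0 then 0 else \<phi> (j - 1)))"
    by (simp add: walk_eq_0)
  finally show ?thesis
    by (simp add: scaleR_add_right sum.distrib)
qed

section \<open>Moments and survival probability of the killed walk\<close>

definition survival :: "nat \<Rightarrow> real" where
  "survival n = (\<Sum>j\<le>n. walk n j)"

lemma survival_nonneg: "0 \<le> survival n"
  by (simp add: survival_def sum_nonneg walk_nonneg)

text \<open>The function \<open>j + 1\<close> is harmonic and vanishes at the killing site -1, so
  its mean is conserved.\<close>

lemma walk_first_moment: "(\<Sum>j\<le>n. walk n j * (real j + 1)) = 1"
proof (induction n)
  case (Suc n)
  have "(\<Sum>j\<le>Suc n. walk (Suc n) j * (real j + 1)) = (\<Sum>j\<le>n. walk n j * (real j + 1))"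
    unfolding real_scaleR_def [symmetric] sum_walk_Suc by (intro sum.cong refl) auto
  with Suc show ?case by simp
qed simp

text \<open>Averaging \<open>(j + 1)^2\<close> over the two neighbours adds exactly 1, so each step
  adds the surviving mass.\<close>

lemma walk_second_moment: "(\<Sum>j\<le>n. walk n j * (real j + 1)\<^sup>2) = 1 + (\<Sum>i<n. survival i)"
proof (induction n)
  case (Suc n)
  have "(\<Sum>j\<le>Suc n. walk (Suc n) j * (real j + 1)\<^sup>2) = (\<Sum>j\<le>n. walk n j * ((real j + 1)\<^sup>2 + 1))"
    unfolding real_scaleR_def [symmetric] sum_walk_Suc
    by (intro sum.cong refl) (auto simp: power2_eq_square algebra_simps)
  also have "\<dots> = (\<Sum>j\<le>n. walk n j * (real j + 1)\<^sup>2) + survival n"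
    by (simp add: distrib_left sum.distrib survival_def)
  finally show ?case using Suc by simp
qed simp

text \<open>Cauchy-Schwarz between the zeroth and second moments, with the first moment equal to
  1.\<close>

lemma survival_mult_ge_1: "1 \<le> survival n * (1 + (\<Sum>i<n. survival i))"
proof -
  have "(\<Sum>j\<le>n. sqrt (walk n j) * (sqrt (walk n j) * (real j + 1)))\<^sup>2
      \<le> (\<Sum>j\<le>n. (sqrt (walk n j))\<^sup>2) * (\<Sum>j\<le>n. (sqrt (walk n j) * (real j + 1))\<^sup>2)"
    by (rule Cauchy_Schwarz_ineq_sum)
  then show ?thesis
    by (simp add: walk_nonneg power_mult_distrib walk_second_moment walk_first_moment survival_def
        flip: mult.assoc)
qed

text \<open>For \<open>q = 1 + (\<Sum>i<n. survival i)\<close>, adding \<open>survival n\<close>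
  raises the square by at least \<open>2 * (survival n * q)\<close>, which is at least 2. This
  bounds accumulated survival directly, with no asymptotics for single probabilities.\<close>

lemma sum_survival_ge: "1 + 2 * real n \<le> (1 + (\<Sum>i<n. survival i))\<^sup>2"
proof (induction n)
  case (Suc n)
  define q where "q = 1 + (\<Sum>i<n. survival i)"
  have 1: "1 + 2 * real n \<le> q\<^sup>2" and 2: "1 \<le> survival n * q"
    unfolding q_def by (fact Suc, fact survival_mult_ge_1)
  have "1 + 2 * real (Suc n) \<le> q\<^sup>2 + 2 * (survival n * q) + (survival n)\<^sup>2"
  proof -
    have "1 + 2 * (1 + x) \<le> a + 2 * b + c" if "1 + 2 * x \<le> a" "1 \<le> b" "0 \<le> c" for a b c x :: real
      using that by simp
    from this [OF 1 2 zero_le_power2] show ?thesis by simp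
  qed
  also have "\<dots> = (q + survival n)\<^sup>2"
    by (simp add: power2_sum)
  also have "q + survival n = 1 + (\<Sum>i<Suc n. survival i)"
    by (simp add: q_def)
  finally show ?case .
qed simp

lemma not_summable_inv_sqrt_coeff_survival:
  "\<not> summable (\<lambda>n. inv_sqrt_coeff n * survival n)"
proof
  let ?f = "\<lambda>n. inv_sqrt_coeff n * survival n"
  assume "summable ?f"
  have f_nonneg: "0 \<le> ?f n" for n
    using inv_sqrt_coeff_pos [of n] survival_nonneg [of n] by simp
  \<comment> \<open>Since \<open>inv_sqrt_coeff\<close> is at least \<open>1 / (2 * sqrt n)\<close>,
    a tail below 1/4 limits the survival accumulated beyond \<open>M\<close> to
    \<open>sqrt n / 2\<close>, half of the growth that \<open>lower\<close> guarantees.\<close>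
  obtain M where M: "\<And>m n. m \<ge> M \<Longrightarrow> norm (sum ?f {m..<n}) < 1 / 4"
    using \<open>summable ?f\<close> unfolding summable_Cauchy by (meson divide_pos_pos zero_less_numeral zero_less_one)
  define q where "q n = 1 + (\<Sum>i<n. survival i)" for n
  have upper: "q (Suc N) \<le> q M + sqrt (real (Suc N)) / 2" if "M \<le> Suc N" for N
  proof -
    let ?S = "\<Sum>i\<in>{M..<Suc N}. survival i"
    have eq: "q (Suc N) = q M + ?S"
      using sum.atLeastLessThan_concat [of 0 M "Suc N" survival] that
      by (simp add: q_def lessThan_atLeast0 del: sum.op_ivl_Suc)
    have "1 / (2 * sqrt (real (Suc N))) * ?S \<le> inv_sqrt_coeff (Suc N) * ?S"
      by (intro mult_right_mono inv_sqrt_coeff_ge sum_nonneg survival_nonneg)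
    also have "\<dots> \<le> sum ?f {M..<Suc N}"
      unfolding sum_distrib_left
      by (intro sum_mono mult_right_mono inv_sqrt_coeff_antimono survival_nonneg) auto
    also have "\<dots> \<le> 1 / 4"
      using M [of M "Suc N"] by (simp del: sum.op_ivl_Suc)
    finally have *: "1 / (2 * sqrt (real (Suc N))) * ?S \<le> 1 / 4" .
    have "?S \<le> r / 2" if "1 / (2 * r) * ?S \<le> 1 / 4" "r > 0" for r
      using that by (simp add: field_simps del: sum.op_ivl_Suc)
    from this [OF *] have "?S \<le> sqrt (real (Suc N)) / 2" by simp
    then show ?thesis unfolding eq by simp
  qed
  have lower: "sqrt (real n) \<le> q n" for n
  proof -
    have "real n \<le> (q n)\<^sup>2" using sum_survival_ge [of n] by (simp add: q_def)
    moreover have "0 \<le> q n" by (simp add: q_def sum_nonneg survival_nonneg add_nonneg_nonneg)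
    ultimately show ?thesis by (simp add: real_le_lsqrt)
  qed
  \<comment> \<open>\<open>upper\<close> and \<open>lower\<close> together force
    \<open>sqrt (Suc N) \<le> 2 * q M\<close>; \<open>K\<close> is chosen to violate this.\<close>
  obtain K where K: "(2 * q M)\<^sup>2 < real K"
    using reals_Archimedean2 by blast
  define N where "N = M + K"
  have N: "M \<le> Suc N" "(2 * q M)\<^sup>2 < real (Suc N)"
    using K by (simp_all add: N_def)
  have "sqrt (real (Suc N)) / 2 \<le> q M"
    using upper [OF N(1)] lower [of "Suc N"] by linarith
  then have "real (Suc N) \<le> (2 * q M)\<^sup>2"
    by (intro sqrt_le_D) simp
  with N(2) show False by simp
qed

section \<open>Truncated inverse roots and the half-line obstruction\<close>

definition truncated_coeff :: "nat \<Rightarrow> nat \<Rightarrow> real" where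
  "truncated_coeff N n = (\<Sum>k\<le>n. (if k \<le> N then inv_sqrt_coeff k else 0) * sqrt_coeff (n - k))"

context symmetric_contraction
begin

text \<open>\<open>truncated_coeff N\<close> lists the coefficients of the truncated series of
  \<open>(1 - t)^(-1/2)\<close> times \<open>(1 - t)^(1/2)\<close>. The constant one is 1, those
  from 1 to \<open>N\<close> vanish as in the full product, and later ones are nonpositive. Since
  partial sums stay nonnegative, the negative part has total at most 1, whence the bound 2.\<close>

lemma truncated_inverse:
  shows "summable (\<lambda>n. \<bar>truncated_coeff N n\<bar>)" and "(\<Sum>n. \<bar>truncated_coeff N n\<bar>) \<le> 2"
    and "(\<Sum>k\<le>N. inv_sqrt_coeff k *\<^sub>R (T ^^ k) (sqrt_op x)) = power_series (truncated_coeff N) x"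
proof -
  let ?\<delta> = truncated_coeff
  define p where "p k = (if k \<le> N then inv_sqrt_coeff k else 0)" for k
  have \<delta>: "?\<delta> N n = (\<Sum>k\<le>n. p k * sqrt_coeff (n - k))" for n
    by (simp add: truncated_coeff_def p_def)
  have \<delta>0: "?\<delta> N 0 = 1" by (simp add: \<delta> p_def)
  have \<delta>_le: "?\<delta> N (Suc n) \<le> 0" for n
  proof (cases "Suc n \<le> N")
    case True
    then have "?\<delta> N (Suc n) = (\<Sum>k\<le>Suc n. inv_sqrt_coeff k * sqrt_coeff (Suc n - k))"
      unfolding \<delta> p_def by (intro sum.cong) auto
    then show ?thesis by (simp only: inv_sqrt_coeff_convolution) simp
  next
    case False
    have "p k * sqrt_coeff (Suc n - k) \<le> 0" if "k \<le> Suc n" for k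
    proof (cases "k = Suc n")
      case True
      with \<open>\<not> Suc n \<le> N\<close> show ?thesis by (simp add: p_def)
    next
      case False
      with that have "Suc n - k = Suc (n - k)" by simp
      then show ?thesis
        using sqrt_coeff_Suc_nonpos [of "n - k"] inv_sqrt_coeff_pos [of k]
        by (simp add: p_def mult_le_0_iff)
    qed
    then show ?thesis unfolding \<delta> by (intro sum_nonpos) auto
  qed
  \<comment> \<open>Summing over the triangle by columns turns the inner sums of
    \<open>sqrt_coeff\<close> into values of \<open>inv_sqrt_coeff\<close>, which are
    positive.\<close>
  have partial: "(\<Sum>n\<le>K. ?\<delta> N n) \<ge> 0" for K
  proof -
    have "(\<Sum>n\<le>K. ?\<delta> N n) = (\<Sum>(k, l)\<in>{(i, j). i + j \<le> K}. p k * sqrt_coeff l)"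
      unfolding \<delta> by (rule sum.triangle_reindex_eq [symmetric])
    also have "{(i, j). i + j \<le> K} = Sigma {..K} (\<lambda>k. {..K - k})" by auto
    also have "(\<Sum>(k, l)\<in>\<dots>. p k * sqrt_coeff l) = (\<Sum>k\<le>K. p k * (\<Sum>l\<le>K - k. sqrt_coeff l))"
      by (simp add: sum.Sigma [symmetric] sum_distrib_left)
    also have "\<dots> \<ge> 0"
      by (intro sum_nonneg) (auto simp: sum_sqrt_coeff p_def less_imp_le [OF inv_sqrt_coeff_pos])
    finally show ?thesis .
  qed
  have "(\<Sum>n\<le>K. \<bar>?\<delta> N n\<bar>) = 2 - (\<Sum>n\<le>K. ?\<delta> N n)" for K
    unfolding sum.atMost_shift using \<delta>_le by (simp add: \<delta>0 sum_negf)
  then have le2: "(\<Sum>n\<le>K. \<bar>?\<delta> N n\<bar>) \<le> 2" for K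
    using partial [of K] by simp
  have le2': "(\<Sum>n<K. \<bar>?\<delta> N n\<bar>) \<le> 2" for K
    by (rule order_trans [OF sum_mono2 le2 [of K]]) auto
  show sum: "summable (\<lambda>n. \<bar>?\<delta> N n\<bar>)"
    by (rule summableI_nonneg_bounded [OF _ le2']) simp
  show "(\<Sum>n. \<bar>?\<delta> N n\<bar>) \<le> 2"
    by (rule suminf_le_const [OF sum le2'])
  have "summable (\<lambda>n. \<bar>p n\<bar>)"
    by (rule summable_finite [of "{..N}"]) (auto simp: p_def)
  from power_series_compose [OF this summable_abs_sqrt_coeff, of x] sum
  have "power_series p (sqrt_op x) = power_series (?\<delta> N) x"
    by (simp add: \<delta>[abs_def] sqrt_op_def)
  moreover have "power_series p y = (\<Sum>k\<le>N. inv_sqrt_coeff k *\<^sub>R (T ^^ k) y)" for y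
    unfolding power_series_def by (subst suminf_finite [of "{..N}"]) (auto simp: p_def)
  ultimately show "(\<Sum>k\<le>N. inv_sqrt_coeff k *\<^sub>R (T ^^ k) (sqrt_op x)) = power_series (?\<delta> N) x"
    by simp
qed

text \<open>Apply the truncated inverse to \<open>e 0 = sqrt_op u\<close> and pair with the sum of
  the first \<open>e j\<close>. Expanding along the walk gives a partial sum of the divergent series
  of \<open>inv_sqrt_coeff n * survival n\<close>; expanding as a series acting on \<open>u\<close>
  bounds it by twice the absolute sum of the coefficients of \<open>u\<close>. No assumption puts
  \<open>u\<close> in the span of the \<open>e j\<close>: only its coefficients enter.\<close>

theorem not_summable_inv_sqrt_half_line:
  assumes orth: "\<And>i j. inner (e i) (e j) = (if i = j then 1 else 0)"
    and e0: "T (e 0) = (1 / 2) *\<^sub>R e 1"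
    and eSuc: "\<And>j. T (e (Suc j)) = (1 / 2) *\<^sub>R (e j + e (Suc (Suc j)))"
    and u: "sqrt_op u = e 0"
  shows "\<not> summable (\<lambda>j. \<bar>inner u (e j)\<bar>)"
proof
  assume summ: "summable (\<lambda>j. \<bar>inner u (e j)\<bar>)"
  define C where "C = (\<Sum>j. \<bar>inner u (e j)\<bar>)"
  have T_e: "T (e j) = (1 / 2) *\<^sub>R (e (Suc j) + (if j = 0 then 0 else e (j - 1)))" for j
    by (cases j) (simp_all add: e0 eSuc add.commute)
  have walk: "(T ^^ n) (e 0) = (\<Sum>j\<le>n. walk n j *\<^sub>R e j)" for n
  proof (induction n)
    case (Suc n)
    have "(T ^^ Suc n) (e 0) = (\<Sum>j\<le>n. walk n j *\<^sub>R T (e j))"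
      by (simp add: Suc sum scaleR)
    also have "\<dots> = (\<Sum>j\<le>Suc n. walk (Suc n) j *\<^sub>R e j)"
      unfolding sum_walk_Suc T_e ..
    finally show ?case .
  qed simp
  \<comment> \<open>By symmetry \<open>T\<close> averages the coefficients over neighbouring
    indices, which does not increase their absolute sum. \<open>J\<close> stays arbitrary because
    the shifted sum reaches one index further.\<close>
  have bound: "(\<Sum>j<J. \<bar>inner ((T ^^ n) u) (e j)\<bar>) \<le> C" for n J
  proof (induction n arbitrary: J)
    case 0
    show ?case unfolding C_def by (simp add: sum_le_suminf [OF summ])
  next
    case (Suc n)
    let ?v = "(T ^^ n) u"
    let ?g = "\<lambda>j. \<bar>inner ?v (e j)\<bar>"
    have "\<bar>inner ((T ^^ Suc n) u) (e j)\<bar> \<le> (?g (Suc j) + (if j = 0 then 0 else ?g (j - 1))) / 2" for j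
      by (simp add: symmetric T_e inner_add_right abs_triangle_ineq)
    then have "(\<Sum>j<J. \<bar>inner ((T ^^ Suc n) u) (e j)\<bar>)
        \<le> (\<Sum>j<J. (?g (Suc j) + (if j = 0 then 0 else ?g (j - 1))) / 2)"
      by (intro sum_mono)
    also have "\<dots> = ((\<Sum>j<J. ?g (Suc j)) + (\<Sum>j<J. if j = 0 then 0 else ?g (j - 1))) / 2"
      by (simp add: sum.distrib sum_divide_distrib add_divide_distrib)
    also have "(\<Sum>j<J. ?g (Suc j)) \<le> C"
      using Suc [of "Suc J"] unfolding sum.lessThan_Suc_shift by simp
    also have "(\<Sum>j<J. if j = 0 then 0 else ?g (j - 1)) \<le> C"
    proof (cases J)
      case 0
      with Suc [of 0] show ?thesis by simp
    next
      case (Suc K)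
      show ?thesis using Suc.IH [of K] unfolding Suc sum.lessThan_Suc_shift by simp
    qed
    finally show ?case by simp
  qed
  have "(\<Sum>n\<le>N. inv_sqrt_coeff n * survival n) \<le> 2 * C" for N
  proof -
    \<comment> \<open>Up to time \<open>N\<close> the walk has not passed site \<open>N\<close>, so
      pairing with these \<open>N + 1\<close> vectors recovers the full survival
      probability.\<close>
    define z where "z = (\<Sum>j<Suc N. e j)"
    let ?\<delta> = "truncated_coeff N"
    note \<delta> = truncated_inverse [where N = N]
    have ez: "inner (e j) z = 1" if "j \<le> N" for j
      using that by (simp add: z_def inner_sum_right orth del: sum.lessThan_Suc)
    have "inner ((T ^^ n) (e 0)) z = survival n" if "n \<le> N" for n
      unfolding walk inner_sum_left survival_def using that by (intro sum.cong) (auto simp: ez)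
    then have "(\<Sum>n\<le>N. inv_sqrt_coeff n * survival n)
        = inner (\<Sum>n\<le>N. inv_sqrt_coeff n *\<^sub>R (T ^^ n) (sqrt_op u)) z"
      by (simp add: inner_sum_left u)
    also have "\<dots> = (\<Sum>n. ?\<delta> n * inner ((T ^^ n) u) z)"
      unfolding \<delta>(3) by (rule inner_power_series [OF \<delta>(1)])
    also have "\<dots> \<le> (\<Sum>n. \<bar>?\<delta> n\<bar> * C)"
    proof (rule suminf_le)
      fix n
      have "\<bar>inner ((T ^^ n) u) z\<bar> \<le> (\<Sum>j<Suc N. \<bar>inner ((T ^^ n) u) (e j)\<bar>)"
        unfolding z_def inner_sum_right by (rule sum_abs)
      also have "\<dots> \<le> C" by (rule bound)
      finally have "\<bar>?\<delta> n * inner ((T ^^ n) u) z\<bar> \<le> \<bar>?\<delta> n\<bar> * C"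
        by (simp add: abs_mult mult_left_mono)
      then show "?\<delta> n * inner ((T ^^ n) u) z \<le> \<bar>?\<delta> n\<bar> * C" by linarith
    qed (rule summable_inner_power_series [OF \<delta>(1)] summable_mult2 [OF \<delta>(1)])+
    also have "\<dots> = (\<Sum>n. \<bar>?\<delta> n\<bar>) * C"
      by (rule suminf_mult2 [OF \<delta>(1), symmetric])
    also have "\<dots> \<le> 2 * C"
      using bound [of 0 0] by (intro mult_right_mono \<delta>(2)) simp
    finally show ?thesis .
  qed
  then have "summable (\<lambda>n. inv_sqrt_coeff n * survival n)"
    by (intro bounded_imp_summable [where B = "2 * C"])
       (simp_all add: survival_nonneg less_imp_le [OF inv_sqrt_coeff_pos])
  then show False using not_summable_inv_sqrt_coeff_survival by simp
qed

end

section \<open>Extension, representation and adjoints of bounded operators\<close>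

lemma bounded_linear_extension_of_dense:
  fixes S :: "'a :: real_normed_vector \<Rightarrow> 'h :: real_normed_vector"
    and G :: "'a \<Rightarrow> 'k :: banach"
  assumes S: "linear S" and G: "linear G" and bound: "\<And>x. norm (G x) \<le> K * norm (S x)"
    and dense: "closure (range S) = UNIV"
  obtains R where "bounded_linear R" and "\<And>x. R (S x) = G x"
proof -
  \<comment> \<open>The preimage is arbitrary: by \<open>bound\<close>, \<open>G\<close> vanishes on
    the kernel of \<open>S\<close>, so the choice does not affect the value.\<close>
  define f where "f y = G (inv S y)" for y
  have f: "f (S x) = G x" for x
  proof -
    have "S (inv S (S x)) = S x" by (rule f_inv_into_f) simp
    then have "S (inv S (S x) - x) = 0" by (simp add: linear_diff [OF S])
    then have "G (inv S (S x) - x) = 0" using bound [of "inv S (S x) - x"] by simp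
    then show ?thesis by (simp add: f_def linear_diff [OF G])
  qed
  have "dist (f (S x)) (f (S y)) \<le> \<bar>K\<bar> * dist (S x) (S y)" for x y
  proof -
    have "dist (f (S x)) (f (S y)) \<le> K * norm (S (x - y))"
      using bound [of "x - y"] by (simp add: f dist_norm linear_diff [OF G])
    also have "\<dots> \<le> \<bar>K\<bar> * norm (S (x - y))" by (intro mult_right_mono) auto
    finally show ?thesis by (simp add: dist_norm linear_diff [OF S])
  qed
  then have "uniformly_continuous_on (range S) f"
    by (intro lipschitz_on_uniformly_continuous [of "\<bar>K\<bar>"] lipschitz_onI) auto
  then obtain R where R: "uniformly_continuous_on (closure (range S)) R"
    and Rf: "\<And>y. y \<in> range S \<Longrightarrow> f y = R y"
    by (rule uniformly_continuous_on_extension_on_closure) blast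
  have RS: "R (S x) = G x" for x
    using Rf [of "S x"] f by simp
  have "continuous_on UNIV R"
    using R dense by (metis uniformly_continuous_imp_continuous)
  then have lim: "(\<lambda>n. R (s n)) \<longlonglongrightarrow> R y" if "s \<longlonglongrightarrow> y" for s y
    by (rule continuous_on_tendsto_compose) (use that in auto)
  have approx: "\<exists>s. (\<lambda>n. S (s n)) \<longlonglongrightarrow> y" for y
  proof -
    have "y \<in> closure (range S)" by (simp add: dense)
    then obtain t where t: "\<And>n. t n \<in> range S" "t \<longlonglongrightarrow> y"
      unfolding closure_sequential by blast
    from t(1) have "\<forall>n. \<exists>x. t n = S x" by blast
    then obtain s where "\<And>n. t n = S (s n)" by metis
    then have "t = (\<lambda>n. S (s n))" by auto
    with t(2) show ?thesis by auto
  qed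
  have "bounded_linear R"
  proof (rule bounded_linear_intro)
    fix x y :: 'h and r :: real
    obtain s t where s: "(\<lambda>n. S (s n)) \<longlonglongrightarrow> x" and t: "(\<lambda>n. S (t n)) \<longlonglongrightarrow> y"
      using approx by metis
    note Gs = lim [OF s, unfolded RS] and Gt = lim [OF t, unfolded RS]
    have "(\<lambda>n. S (s n + t n)) \<longlonglongrightarrow> x + y"
      using tendsto_add [OF s t] by (simp add: linear_add [OF S])
    from lim [OF this] have "(\<lambda>n. G (s n) + G (t n)) \<longlonglongrightarrow> R (x + y)"
      by (simp add: RS linear_add [OF G])
    then show "R (x + y) = R x + R y"
      using tendsto_add [OF Gs Gt] by (rule LIMSEQ_unique)
    have "(\<lambda>n. S (r *\<^sub>R s n)) \<longlonglongrightarrow> r *\<^sub>R x"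
      using tendsto_scaleR [OF tendsto_const s] by (simp add: linear_scale [OF S])
    from lim [OF this] have "(\<lambda>n. r *\<^sub>R G (s n)) \<longlonglongrightarrow> R (r *\<^sub>R x)"
      by (simp add: RS linear_scale [OF G])
    then show "R (r *\<^sub>R x) = r *\<^sub>R R x"
      using tendsto_scaleR [OF tendsto_const Gs] by (rule LIMSEQ_unique)
    show "norm (R x) \<le> norm x * K"
      by (rule LIMSEQ_le [OF tendsto_norm [OF Gs] tendsto_mult_right [OF tendsto_norm [OF s]]])
         (use bound in \<open>auto simp: mult.commute\<close>)
  qed
  then show ?thesis using RS by (rule that)
qed

text \<open>The representing vector minimises \<open>Q\<close>: the parallelogram identity makes a
  minimising sequence Cauchy, and the first-order condition at the limit is the claim.\<close>

lemma riesz_representation: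
  fixes \<phi> :: "'h :: {real_inner, banach} \<Rightarrow> real"
  assumes "bounded_linear \<phi>"
  shows "\<exists>z. \<forall>x. \<phi> x = inner z x"
proof -
  interpret bounded_linear \<phi> by fact
  define Q where "Q x = (norm x)\<^sup>2 - 2 * \<phi> x" for x
  obtain K where K: "\<And>x. norm (\<phi> x) \<le> norm x * K" using bounded by blast
  have lower: "- (K\<^sup>2) \<le> Q x" for x
  proof -
    have "2 * \<phi> x \<le> 2 * (norm x * K)" using K [of x] by simp
    also have "\<dots> \<le> (norm x)\<^sup>2 + K\<^sup>2"
      using zero_le_power2 [of "norm x - K"] by (simp add: power2_diff)
    finally show ?thesis by (simp add: Q_def)
  qed
  define d where "d = Inf (range Q)"
  have bdd: "bdd_below (range Q)" using lower by (intro bdd_belowI2)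
  have d_le: "d \<le> Q x" for x unfolding d_def by (rule cINF_lower [OF bdd]) simp
  have "\<exists>x. Q x < d + 1 / real (Suc n)" for n
    using cInf_lessD [of "range Q" "d + 1 / real (Suc n)"] by (auto simp: d_def)
  then obtain s where s: "\<And>n. Q (s n) < d + 1 / real (Suc n)" by metis
  have par: "(norm (x - y))\<^sup>2 = 2 * Q x + 2 * Q y - 4 * Q ((1 / 2) *\<^sub>R (x + y))" for x y
    by (simp add: Q_def scaleR add power2_norm_eq_inner inner_diff_left inner_diff_right
        inner_add_left inner_add_right inner_commute algebra_simps)
  \<comment> \<open>In \<open>par\<close> both values of \<open>Q\<close> are below
    \<open>d + 1 / Suc M\<close> and the midpoint is at least \<open>d\<close>, which leaves
    \<open>4 / Suc M\<close>.\<close>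
  have close: "(norm (s i - s j))\<^sup>2 \<le> 4 / real (Suc M)" if "M \<le> i" "M \<le> j" for i j M
  proof -
    have "1 / real (Suc i) \<le> 1 / real (Suc M)" "1 / real (Suc j) \<le> 1 / real (Suc M)"
      using that by (simp_all add: frac_le)
    then show ?thesis
      using par [of "s i" "s j"] d_le [of "(1 / 2) *\<^sub>R (s i + s j)"] s [of i] s [of j] by simp
  qed
  have "Cauchy s"
  proof (rule CauchyI)
    fix e :: real assume "e > 0"
    obtain M where M: "4 / e\<^sup>2 < real M" using reals_Archimedean2 by blast
    then have "4 / e\<^sup>2 < real (Suc M)" by simp
    then have M': "4 / real (Suc M) < e\<^sup>2"
      using \<open>e > 0\<close> by (simp add: divide_less_eq mult.commute)
    then have "norm (s i - s j) < e" if "M \<le> i" "M \<le> j" for i j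
      using le_less_trans [OF close [OF that] M'] \<open>e > 0\<close> by (simp add: power2_less_imp_less)
    then show "\<exists>M. \<forall>m\<ge>M. \<forall>n\<ge>M. norm (s m - s n) < e" by blast
  qed
  then obtain z where z: "s \<longlonglongrightarrow> z"
    by (auto simp: Cauchy_convergent_iff convergent_def)
  have "(\<lambda>n. Q (s n)) \<longlonglongrightarrow> Q z"
    unfolding Q_def by (intro tendsto_intros z tendsto)
  moreover have "(\<lambda>n. d + 1 / real (Suc n)) \<longlonglongrightarrow> d + 0"
    by (intro tendsto_add tendsto_const LIMSEQ_Suc [OF lim_1_over_n])
  ultimately have "Q z \<le> d"
    using s by (intro LIMSEQ_le [of "\<lambda>n. Q (s n)" _ "\<lambda>n. d + 1 / real (Suc n)"]) (auto intro: less_imp_le)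
  have "\<phi> x = inner z x" for x
  proof (cases "x = 0")
    case False
    define a where "a = inner z x - \<phi> x"
    have "Q (z + t *\<^sub>R x) = Q z + 2 * t * a + t\<^sup>2 * (norm x)\<^sup>2" for t
      unfolding Q_def power2_norm_eq_inner
      by (simp add: add scaleR a_def inner_add_left inner_add_right inner_commute
          power2_eq_square algebra_simps)
    moreover have "Q z \<le> Q (z + t *\<^sub>R x)" for t
      by (rule order_trans [OF \<open>Q z \<le> d\<close> d_le])
    ultimately have *: "0 \<le> 2 * t * a + t\<^sup>2 * (norm x)\<^sup>2" for t
      by (metis add.assoc le_add_same_cancel1)
    define b where "b = (norm x)\<^sup>2"
    have "b > 0" using False by (simp add: b_def)
    \<comment> \<open>\<open>- (a / b)\<close> is the minimiser of the quadratic in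
      \<open>t\<close>, and its minimum is negative unless \<open>a = 0\<close>.\<close>
    then have "2 * (- (a / b)) * a + (- (a / b))\<^sup>2 * b = - (a * a / b)"
      by (simp add: power2_eq_square)
    with * [of "- (a / b)"] have "a * a / b \<le> 0" by (simp add: b_def)
    with \<open>b > 0\<close> have "a = 0" by (auto simp add: divide_le_0_iff mult_le_0_iff)
    then show ?thesis by (simp add: a_def)
  qed (simp add: zero)
  then show ?thesis by blast
qed

lemma adjoint_exists:
  fixes A :: "'h :: {real_inner, banach} \<Rightarrow> 'k :: real_inner"
  assumes "bounded_linear A"
  obtains B where "bounded_linear B" and "\<And>x y. inner (A x) y = inner x (B y)"
proof -
  interpret A: bounded_linear A by fact
  have "\<exists>z. \<forall>x. inner (A x) y = inner z x" for y
    by (rule riesz_representation [OF bounded_linear_compose [OF bounded_linear_inner_left assms]])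
  then obtain B where B: "\<And>x y. inner (A x) y = inner x (B y)"
    by (metis inner_commute)
  obtain K where K: "\<And>x. norm (A x) \<le> norm x * K" and "0 < K" using A.pos_bounded by blast
  have eqI: "u = v" if "\<And>x. inner x u = inner x v" for u v :: 'h
    using that [of "u - v"] by (metis inner_diff_right inner_eq_zero_iff right_minus_eq)
  have "bounded_linear B"
  proof (rule bounded_linear_intro)
    fix y z r
    show "B (y + z) = B y + B z" by (rule eqI) (simp add: inner_add_right flip: B)
    show "B (r *\<^sub>R y) = r *\<^sub>R B y" by (rule eqI) (simp flip: B)
    have "(norm (B y))\<^sup>2 = inner (A (B y)) y" by (simp add: power2_norm_eq_inner B)
    also have "\<dots> \<le> norm (A (B y)) * norm y" by (rule norm_cauchy_schwarz)
    also have "\<dots> \<le> norm (B y) * K * norm y" by (intro mult_right_mono K) simp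
    finally have "norm (B y) * norm (B y) \<le> norm (B y) * (norm y * K)"
      by (simp add: power2_eq_square mult_ac)
    then show "norm (B y) \<le> norm y * K"
      using \<open>0 < K\<close> by (cases "B y = 0") simp_all
  qed
  with B show ?thesis by (intro that)
qed

section \<open>Square-summable functions\<close>

text \<open>A type cannot depend on the density \<open>m\<close>, so the weight is left out here and
  enters through \<open>to_ell2\<close>. The space is set up over the reals, with the real part of
  the Hermitian product as inner product; complex scalars come back as the operators
  \<open>scaleC\<close>.\<close>

typedef 'a ell2 = "{f :: 'a \<Rightarrow> complex. (\<lambda>x. (norm (f x))\<^sup>2) summable_on UNIV}"
  morphisms ell2_apply Abs_ell2
  by (rule exI [of _ "\<lambda>_. 0"]) simp

setup_lifting type_definition_ell2

lemma summable_ell2_mult_mult: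
  assumes "(\<lambda>x. (norm (f x :: complex))\<^sup>2) summable_on UNIV" "(\<lambda>x. (norm (g x :: complex))\<^sup>2) summable_on UNIV"
  shows "(\<lambda>x. norm (f x) * norm (g x)) summable_on UNIV"
proof (rule abs_summable_summable [OF Infinite_Sum.abs_summable_on_comparison_test])
  show "(\<lambda>x. norm ((norm (f x))\<^sup>2 + (norm (g x))\<^sup>2)) summable_on UNIV"
    using summable_on_add [OF assms] by simp
  show "norm (norm (f x) * norm (g x)) \<le> norm ((norm (f x))\<^sup>2 + (norm (g x))\<^sup>2)" for x
  proof -
    have "norm (f x) * norm (g x) \<le> (norm (f x))\<^sup>2 + (norm (g x))\<^sup>2"
      using zero_le_power2 [of "norm (f x) - norm (g x)"] mult_nonneg_nonneg [of "norm (f x)" "norm (g x)"]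
      by (simp add: power2_diff del: zero_le_power2 mult_nonneg_nonneg)
    then show ?thesis by simp
  qed
qed

lemma summable_ell2_inner:
  assumes "(\<lambda>x. (norm (f x :: complex))\<^sup>2) summable_on UNIV" "(\<lambda>x. (norm (g x :: complex))\<^sup>2) summable_on UNIV"
  shows "(\<lambda>x. inner (f x) (g x)) summable_on UNIV"
  by (rule abs_summable_summable [OF Infinite_Sum.abs_summable_on_comparison_test
        [where g = "\<lambda>x. norm (f x) * norm (g x)"]])
     (use summable_ell2_mult_mult [OF assms] Cauchy_Schwarz_ineq2 in auto)

lemma summable_ell2_add:
  assumes "(\<lambda>x. (norm (f x :: complex))\<^sup>2) summable_on UNIV" "(\<lambda>x. (norm (g x :: complex))\<^sup>2) summable_on UNIV"
  shows "(\<lambda>x. (norm (f x + g x))\<^sup>2) summable_on UNIV"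
proof -
  have "(\<lambda>x. (norm (f x))\<^sup>2 + (norm (g x))\<^sup>2 + 2 * inner (f x) (g x)) summable_on UNIV"
    by (intro summable_on_add summable_on_cmult_right assms summable_ell2_inner)
  also have "(\<lambda>x. (norm (f x))\<^sup>2 + (norm (g x))\<^sup>2 + 2 * inner (f x) (g x)) = (\<lambda>x. (norm (f x + g x))\<^sup>2)"
    by (simp add: power2_norm_eq_inner inner_add_left inner_add_right inner_commute fun_eq_iff)
  finally show ?thesis .
qed

lemma summable_ell2_mult:
  assumes "(\<lambda>x. (norm (f x :: complex))\<^sup>2) summable_on UNIV"
  shows "(\<lambda>x. (norm (c * f x))\<^sup>2) summable_on UNIV"
  by (simp add: norm_mult power_mult_distrib summable_on_cmult_right assms)

instantiation ell2 :: (type) real_inner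
begin

lift_definition zero_ell2 :: "'a ell2" is "\<lambda>_. 0" by simp

lift_definition plus_ell2 :: "'a ell2 \<Rightarrow> 'a ell2 \<Rightarrow> 'a ell2" is "\<lambda>f g x. f x + g x"
  by (rule summable_ell2_add)

lift_definition uminus_ell2 :: "'a ell2 \<Rightarrow> 'a ell2" is "\<lambda>f x. - f x" by simp

lift_definition minus_ell2 :: "'a ell2 \<Rightarrow> 'a ell2 \<Rightarrow> 'a ell2" is "\<lambda>f g x. f x - g x"
  subgoal for f g using summable_ell2_add [of f "\<lambda>x. - g x"] by simp
  done

lift_definition scaleR_ell2 :: "real \<Rightarrow> 'a ell2 \<Rightarrow> 'a ell2" is "\<lambda>r f x. r *\<^sub>R f x"
  using summable_ell2_mult by (simp add: scaleR_conv_of_real)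

lift_definition inner_ell2 :: "'a ell2 \<Rightarrow> 'a ell2 \<Rightarrow> real" is "\<lambda>f g. \<Sum>\<^sub>\<infinity>x. inner (f x) (g x)" .

definition norm_ell2 :: "'a ell2 \<Rightarrow> real" where "norm_ell2 f = sqrt (inner f f)"

definition sgn_ell2 :: "'a ell2 \<Rightarrow> 'a ell2" where "sgn_ell2 f = scaleR (inverse (norm f)) f"

definition dist_ell2 :: "'a ell2 \<Rightarrow> 'a ell2 \<Rightarrow> real" where "dist_ell2 f g = norm (f - g)"

definition uniformity_ell2 :: "('a ell2 \<times> 'a ell2) filter" where
  "uniformity_ell2 = (INF e\<in>{0 <..}. principal {(x, y). dist x y < e})"

definition open_ell2 :: "'a ell2 set \<Rightarrow> bool" where
  "open_ell2 U = (\<forall>x\<in>U. eventually (\<lambda>(x', y). x' = x \<longrightarrow> y \<in> U) uniformity)"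

instance
proof
  fix f g h :: "'a ell2" and r s :: real
  show "f + g + h = f + (g + h)" by transfer (simp add: add.assoc)
  show "f + g = g + f" by transfer (simp add: add.commute)
  show "0 + f = f" by transfer simp
  show "- f + f = 0" by transfer simp
  show "f - g = f + - g" by transfer simp
  show "r *\<^sub>R (f + g) = r *\<^sub>R f + r *\<^sub>R g" by transfer (simp add: scaleR_add_right)
  show "(r + s) *\<^sub>R f = r *\<^sub>R f + s *\<^sub>R f" by transfer (simp add: scaleR_add_left)
  show "r *\<^sub>R s *\<^sub>R f = (r * s) *\<^sub>R f" by transfer simp
  show "1 *\<^sub>R f = f" by transfer simp
  show "sgn f = scaleR (inverse (norm f)) f" by (rule sgn_ell2_def)
  show "dist f g = norm (f - g)" by (rule dist_ell2_def)
  show "uniformity = (INF e\<in>{0 <..}. principal {(x :: 'a ell2, y). dist x y < e})"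
    by (rule uniformity_ell2_def)
  show "open U = (\<forall>x\<in>U. eventually (\<lambda>(x', y). x' = x \<longrightarrow> y \<in> U) uniformity)" for U :: "'a ell2 set"
    by (rule open_ell2_def)
  show "inner f g = inner g f" by transfer (simp add: inner_commute)
  show "inner (f + g) h = inner f h + inner g h"
    by transfer
       (simp add: inner_add_left infsum_add summable_ell2_inner)
  show "inner (r *\<^sub>R f) g = r * inner f g"
    by transfer (simp add: infsum_cmult_right')
  show "0 \<le> inner f f" by transfer (simp add: infsum_nonneg)
  show "(inner f f = 0) = (f = 0)"
  proof transfer
    fix f :: "'a \<Rightarrow> complex"
    assume f: "(\<lambda>x. (norm (f x))\<^sup>2) summable_on UNIV"
    show "((\<Sum>\<^sub>\<infinity>x. inner (f x) (f x)) = 0) = (f = (\<lambda>_. 0))"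
    proof
      assume "(\<Sum>\<^sub>\<infinity>x. inner (f x) (f x)) = 0"
      then have "(norm (f x))\<^sup>2 = 0" for x
        using nonneg_infsum_le_0D [OF _ f, of x] by (simp add: power2_norm_eq_inner)
      then show "f = (\<lambda>_. 0)" by auto
    qed simp
  qed
  show "norm f = sqrt (inner f f)" by (rule norm_ell2_def)
qed

end

lemmas ell2_apply_simps [simp] =
  zero_ell2.rep_eq plus_ell2.rep_eq uminus_ell2.rep_eq minus_ell2.rep_eq scaleR_ell2.rep_eq

lemma ell2_eqI: "(\<And>x. ell2_apply f x = ell2_apply g x) \<Longrightarrow> f = g"
  by (simp add: ell2_apply_inject [symmetric] fun_eq_iff)

lemma summable_ell2_apply: "(\<lambda>x. (norm (ell2_apply f x))\<^sup>2) summable_on UNIV"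
  using ell2_apply [of f] by simp

lemma norm_ell2_power2: "(norm f)\<^sup>2 = (\<Sum>\<^sub>\<infinity>x. (norm (ell2_apply f x))\<^sup>2)"
  by (simp add: power2_norm_eq_inner inner_ell2.rep_eq)

lemma sum_ell2_le: "finite F \<Longrightarrow> (\<Sum>x\<in>F. (norm (ell2_apply f x))\<^sup>2) \<le> (norm f)\<^sup>2"
  unfolding norm_ell2_power2 by (rule finite_sum_le_infsum [OF summable_ell2_apply]) auto

lemma norm_ell2_apply_le: "norm (ell2_apply f x) \<le> norm f"
  using sum_ell2_le [of "{x}" f] by simp

text \<open>The limit is taken pointwise. Cauchy bounds restricted to finite sets pass to the limit
  there, and a bound common to all finite sets bounds the whole sum.\<close>

instance ell2 :: (type) banach
proof
  fix X :: "nat \<Rightarrow> 'a ell2"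
  assume X: "Cauchy X"
  have "Cauchy (\<lambda>n. ell2_apply (X n) x)" for x
  proof (rule CauchyI)
    fix e :: real assume "e > 0"
    then obtain M where M: "\<And>i j. i \<ge> M \<Longrightarrow> j \<ge> M \<Longrightarrow> norm (X i - X j) < e"
      using CauchyD [OF X] by metis
    have "norm (ell2_apply (X i) x - ell2_apply (X j) x) < e" if "i \<ge> M" "j \<ge> M" for i j
      using norm_ell2_apply_le [of "X i - X j" x] M [OF that] by simp
    then show "\<exists>M. \<forall>m\<ge>M. \<forall>n\<ge>M. norm (ell2_apply (X m) x - ell2_apply (X n) x) < e" by blast
  qed
  then have "\<exists>y. (\<lambda>n. ell2_apply (X n) x) \<longlonglongrightarrow> y" for x
    by (auto simp: Cauchy_convergent_iff convergent_def)
  then obtain F where F: "\<And>x. (\<lambda>n. ell2_apply (X n) x) \<longlonglongrightarrow> F x" by metis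
  have tail: "(\<Sum>x\<in>A. (norm (ell2_apply (X i) x - F x))\<^sup>2) \<le> e\<^sup>2"
    if "finite A" "\<And>j. j \<ge> M \<Longrightarrow> norm (X i - X j) < e" for A M i e
  proof (rule LIMSEQ_le_const2)
    show "(\<lambda>j. \<Sum>x\<in>A. (norm (ell2_apply (X i) x - ell2_apply (X j) x))\<^sup>2)
        \<longlonglongrightarrow> (\<Sum>x\<in>A. (norm (ell2_apply (X i) x - F x))\<^sup>2)"
      by (intro tendsto_intros F)
    have "(\<Sum>x\<in>A. (norm (ell2_apply (X i) x - ell2_apply (X j) x))\<^sup>2) \<le> e\<^sup>2" if "j \<ge> M" for j
    proof -
      have "(\<Sum>x\<in>A. (norm (ell2_apply (X i) x - ell2_apply (X j) x))\<^sup>2) \<le> (norm (X i - X j))\<^sup>2"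
        using sum_ell2_le [OF \<open>finite A\<close>, of "X i - X j"] by simp
      also have "\<dots> \<le> e\<^sup>2"
        using \<open>\<And>j. j \<ge> M \<Longrightarrow> norm (X i - X j) < e\<close> [OF that] by (intro power_mono) auto
      finally show ?thesis .
    qed
    then show "\<exists>N. \<forall>j\<ge>N. (\<Sum>x\<in>A. (norm (ell2_apply (X i) x - ell2_apply (X j) x))\<^sup>2) \<le> e\<^sup>2" by blast
  qed
  have tail_summable: "(\<lambda>x. (norm (ell2_apply (X i) x - F x))\<^sup>2) summable_on UNIV"
    if "\<And>j. j \<ge> M \<Longrightarrow> norm (X i - X j) < e" for M i e
    by (rule nonneg_bdd_above_summable_on) (auto intro!: bdd_aboveI2 tail that)
  obtain M1 where M1: "\<And>i j. i \<ge> M1 \<Longrightarrow> j \<ge> M1 \<Longrightarrow> norm (X i - X j) < 1"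
    using CauchyD [OF X, of 1] by auto
  have "(\<lambda>x. (norm (ell2_apply (X M1) x - F x))\<^sup>2) summable_on UNIV"
    by (rule tail_summable [of M1 M1 1]) (simp add: M1)
  from summable_ell2_add [OF summable_ell2_apply [of "X M1"] summable_ell2_mult [OF this, of "- 1"]]
  have F_sum: "(\<lambda>x. (norm (F x))\<^sup>2) summable_on UNIV" by simp
  define L where "L = Abs_ell2 F"
  have L: "ell2_apply L = F" unfolding L_def using F_sum by (simp add: Abs_ell2_inverse)
  have "X \<longlonglongrightarrow> L"
  proof (rule LIMSEQ_I)
    fix e :: real assume "e > 0"
    then obtain M where M: "\<And>i j. i \<ge> M \<Longrightarrow> j \<ge> M \<Longrightarrow> norm (X i - X j) < e / 2"
      using CauchyD [OF X, of "e / 2"] by auto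
    have "norm (X i - L) < e" if "i \<ge> M" for i
    proof -
      have "(norm (X i - L))\<^sup>2 \<le> (e / 2)\<^sup>2"
        unfolding norm_ell2_power2
        by (rule infsum_le_finite_sums [OF summable_ell2_apply])
           (use tail [of _ M i "e / 2"] M [OF that] in \<open>simp add: L\<close>)
      then have "norm (X i - L) \<le> e / 2" using \<open>e > 0\<close> by (simp add: power2_le_iff_abs_le)
      then show ?thesis using \<open>e > 0\<close> by simp
    qed
    then show "\<exists>M. \<forall>i\<ge>M. norm (X i - L) < e" by blast
  qed
  then show "convergent X" by (auto simp: convergent_def)
qed

lift_definition scaleC :: "complex \<Rightarrow> 'a ell2 \<Rightarrow> 'a ell2" is "\<lambda>c f x. c * f x"
  by (rule summable_ell2_mult)

declare scaleC.rep_eq [simp]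

lemma inner_scaleC_left: "inner (scaleC c f) g = inner f (scaleC (cnj c) g)"
  by transfer (auto intro!: infsum_cong simp: inner_complex_def algebra_simps)

lemma norm_scaleC: "norm (scaleC c f) = norm c * norm f"
proof -
  have "(norm (scaleC c f))\<^sup>2 = (norm c * norm f)\<^sup>2"
    by (simp add: norm_ell2_power2 norm_mult power_mult_distrib infsum_cmult_right')
  then show ?thesis by (simp add: power2_eq_iff_nonneg)
qed

lemma bounded_linear_scaleC: "bounded_linear (scaleC c)"
  by (rule bounded_linear_intro [of _ "norm c"])
     (auto intro!: ell2_eqI simp: algebra_simps norm_scaleC)

text \<open>The imaginary part of \<open>w * cnj z\<close> is the real part of
  \<open>w * cnj (\<i> * z)\<close>, so the real inner product determines the Hermitian one.\<close>

lemma inner_ell2_scaleC_ii: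
  "(\<Sum>\<^sub>\<infinity>x. ell2_apply f x * cnj (ell2_apply g x)) = Complex (inner f g) (inner f (scaleC \<i> g))"
proof -
  let ?f = "ell2_apply f" and ?g = "ell2_apply g"
  have "((\<lambda>x. complex_of_real (inner (?f x) (?g x)) + \<i> * complex_of_real (inner (?f x) (\<i> * ?g x)))
      has_sum (complex_of_real (inner f g) + \<i> * complex_of_real (inner f (scaleC \<i> g)))) UNIV"
    unfolding inner_ell2.rep_eq scaleC.rep_eq
    by (intro has_sum_add has_sum_cmult_right has_sum_of_real has_sum_infsum
        summable_ell2_inner summable_ell2_mult summable_ell2_apply)
  moreover have "complex_of_real (inner (?f x) (?g x)) + \<i> * complex_of_real (inner (?f x) (\<i> * ?g x))
      = ?f x * cnj (?g x)" for x
    by (simp add: complex_eq_iff inner_complex_def algebra_simps)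
  ultimately show ?thesis
    by (simp add: infsumI Complex_eq)
qed

section \<open>Trees with a root at infinity\<close>

context infinite_tree
begin

definition nonbacktracking :: "(nat \<Rightarrow> 'a) \<Rightarrow> nat \<Rightarrow> bool" where
  "nonbacktracking w n \<longleftrightarrow>
     (\<forall>i<n. E (w i) (w (Suc i))) \<and> (\<forall>i. Suc i < n \<longrightarrow> w i \<noteq> w (Suc (Suc i)))"

text \<open>Take a shortest return \<open>w i = w (i + d)\<close>. Length 1 would be a loop, length
  2 a backtrack, and from length 3 on its vertices form a cycle.\<close>

lemma nonbacktracking_inj:
  assumes w: "nonbacktracking w n"
  shows "inj_on w {..n}"
proof (rule ccontr)
  assume "\<not> inj_on w {..n}"
  then obtain a b where "a \<le> n" "b \<le> n" "a \<noteq> b" "w a = w b"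
    by (auto simp: inj_on_def)
  moreover have "\<exists>d i. 0 < d \<and> i + d \<le> n \<and> w i = w (i + d)"
    if "a < b" "b \<le> n" "w a = w b" for a b
    using that by (intro exI [of _ "b - a"] exI [of _ a]) auto
  ultimately have "\<exists>d i. 0 < d \<and> i + d \<le> n \<and> w i = w (i + d)"
    by (metis linorder_neqE_nat)
  then obtain d where d: "\<exists>i. 0 < d \<and> i + d \<le> n \<and> w i = w (i + d)"
    and min: "\<And>d'. d' < d \<Longrightarrow> \<not> (\<exists>i. 0 < d' \<and> i + d' \<le> n \<and> w i = w (i + d'))"
    using exists_least_iff [of "\<lambda>d. \<exists>i. 0 < d \<and> i + d \<le> n \<and> w i = w (i + d)"] by auto
  from d obtain i where i: "0 < d" "i + d \<le> n" "w i = w (i + d)" by blast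
  have "d \<noteq> 1"
  proof
    assume "d = 1"
    with i(2) w have "E (w i) (w (Suc i))" by (simp add: nonbacktracking_def)
    with i(3) \<open>d = 1\<close> adj_irrefl show False by simp
  qed
  moreover have "d \<noteq> 2" using i w by (auto simp: nonbacktracking_def)
  ultimately have "3 \<le> d" using i(1) by linarith
  define xs where "xs = map w [i..<i + d]"
  have "inj_on w {i..<i + d}"
  proof (rule linorder_inj_onI')
    fix a b assume "a \<in> {i..<i + d}" "b \<in> {i..<i + d}" "a < b"
    then have "b - a < d" "0 < b - a" "a + (b - a) = b" "b \<le> n" using i(2) by auto
    with min show "w a \<noteq> w b" by metis
  qed
  then have "distinct xs" by (simp add: xs_def distinct_map)
  moreover have "successively E xs"
    using w i(2) by (auto simp: xs_def successively_conv_nth nonbacktracking_def)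
  moreover have "E (last xs) (hd xs)"
  proof -
    have "last xs = w (i + d - 1)" "hd xs = w i"
      using i(1) by (simp_all add: xs_def last_map hd_map)
    moreover have "i + d - 1 < n" using i(1,2) by linarith
    then have "E (w (i + d - 1)) (w (Suc (i + d - 1)))"
      using w unfolding nonbacktracking_def by blast
    ultimately show ?thesis using i by simp
  qed
  ultimately have "cycle E xs" using \<open>3 \<le> d\<close> by (simp add: cycle_def xs_def)
  with acyclic show False by blast
qed

lemma nonbacktracking_unique:
  assumes "nonbacktracking v k" "nonbacktracking w l" "v 0 = w 0" "v k = w l"
  shows "k = l \<and> (\<forall>i\<le>k. v i = w i)"
  using assms
proof (induction k arbitrary: l)
  case 0
  then have "w 0 = w l" by simp
  with nonbacktracking_inj [OF 0(2)] have "l = 0" by (auto dest: inj_onD)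
  with 0 show ?case by simp
next
  case (Suc k)
  show ?case
  proof (cases l)
    case 0
    with Suc.prems have "v 0 = v (Suc k)" by simp
    with nonbacktracking_inj [OF Suc.prems(1)] show ?thesis by (auto dest: inj_onD)
  next
    case l: (Suc l')
    show ?thesis
    proof (cases "v k = w l'")
      case True
      have "k = l' \<and> (\<forall>i\<le>k. v i = w i)"
        by (rule Suc.IH) (use Suc.prems True l in \<open>auto simp: nonbacktracking_def\<close>)
      with Suc.prems(4) l show ?thesis by (auto simp: le_Suc_eq)
    next
      case False
      define n where "n = Suc k + Suc l'"
      \<comment> \<open>Run along \<open>v\<close> and return along \<open>w\<close>: the turn does
        not backtrack exactly because the last steps differ, so \<open>u\<close> would be a closed
        path contradicting \<open>nonbacktracking_inj\<close>.\<close>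
      define u where "u i = (if i \<le> Suc k then v i else w (n - i))" for i
      have u_w: "u i = w (n - i)" if "Suc k \<le> i" for i
        using that Suc.prems(4) l by (cases "i = Suc k") (auto simp: u_def n_def)
      have "nonbacktracking u n"
        unfolding nonbacktracking_def
      proof (intro conjI allI impI)
        fix i assume "i < n"
        show "E (u i) (u (Suc i))"
        proof (cases "i < Suc k")
          case True
          then show ?thesis using Suc.prems(1) by (simp add: u_def nonbacktracking_def)
        next
          case False
          have "E (w (n - Suc i)) (w (Suc (n - Suc i)))"
            using Suc.prems(2) False l by (auto simp: nonbacktracking_def n_def)
          moreover have "Suc (n - Suc i) = n - i" using \<open>i < n\<close> by simp
          ultimately show ?thesis using False by (simp add: u_w adj_sym)
        qed
      next
        fix i assume i: "Suc i < n"
        consider "Suc i < Suc k" | "i = k" | "Suc k \<le> i" by linarith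
        then show "u i \<noteq> u (Suc (Suc i))"
        proof cases
          case 1
          then show ?thesis using Suc.prems(1) by (simp add: u_def nonbacktracking_def)
        next
          case 2
          then have "u i = v k" "u (Suc (Suc i)) = w l'" by (simp_all add: u_def n_def)
          with False show ?thesis by simp
        next
          case 3
          have "w (n - Suc (Suc i)) \<noteq> w (Suc (Suc (n - Suc (Suc i))))"
            using Suc.prems(2) 3 i l by (auto simp: nonbacktracking_def n_def)
          moreover have "Suc (Suc (n - Suc (Suc i))) = n - i" using i by simp
          ultimately show ?thesis using 3 by (simp add: u_w)
        qed
      qed
      moreover have "u 0 = u n" using Suc.prems(3) by (simp add: u_def n_def)
      ultimately show ?thesis
        using nonbacktracking_inj [of u n] by (auto simp: n_def dest: inj_onD)
    qed
  qed
qed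

lemma graph_dist_walk:
  obtains f where "f 0 = x" "f (graph_dist E x y) = y" "\<forall>i<graph_dist E x y. E (f i) (f (Suc i))"
proof -
  have "\<exists>n. (E ^^ n) x y" using connected by (rule rtranclp_imp_relpowp)
  then have "(E ^^ graph_dist E x y) x y" unfolding graph_dist_def by (rule LeastI_ex)
  with that show ?thesis by (auto simp: relpowp_fun_conv)
qed

lemma graph_dist_le: "(E ^^ n) x y \<Longrightarrow> graph_dist E x y \<le> n"
  unfolding graph_dist_def by (rule Least_le)

lemma graph_dist_refl [simp]: "graph_dist E x x = 0"
  using graph_dist_le [of 0 x x] by simp

text \<open>A shortest walk cannot backtrack, since cutting out the detour (\<open>g\<close> below)
  saves two steps; by uniqueness it is therefore the given path.\<close>

lemma graph_dist_nonbacktracking: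
  assumes w: "nonbacktracking w n"
  shows "graph_dist E (w 0) (w n) = n"
proof -
  let ?d = "graph_dist E (w 0) (w n)"
  obtain f where f: "f 0 = w 0" "f ?d = w n" "\<forall>i<?d. E (f i) (f (Suc i))"
    by (rule graph_dist_walk)
  have "f i \<noteq> f (Suc (Suc i))" if i: "Suc i < ?d" for i
  proof
    assume eq: "f i = f (Suc (Suc i))"
    define g where "g j = (if j \<le> i then f j else f (Suc (Suc j)))" for j
    have "g 0 = w 0" using f(1) by (simp add: g_def)
    moreover have "g (?d - 2) = w n"
    proof (cases "?d = Suc (Suc i)")
      case True
      with f(2) eq show ?thesis by (simp add: g_def)
    next
      case False
      then have "\<not> ?d - 2 \<le> i" "Suc (Suc (?d - 2)) = ?d" using i by auto
      with f(2) show ?thesis by (simp add: g_def)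
    qed
    moreover have "E (g j) (g (Suc j))" if "j < ?d - 2" for j
    proof (cases "j = i")
      case True
      then have "E (f (Suc (Suc i))) (f (Suc (Suc (Suc i))))" using f(3) that by auto
      with True eq show ?thesis by (simp add: g_def)
    next
      case False
      with f(3) that show ?thesis by (auto simp: g_def)
    qed
    ultimately have "(E ^^ (?d - 2)) (w 0) (w n)" by (auto simp: relpowp_fun_conv)
    from graph_dist_le [OF this] i show False by simp
  qed
  with f(3) have "nonbacktracking f ?d" by (simp add: nonbacktracking_def)
  from nonbacktracking_unique [OF this w f(1,2)] show ?thesis by simp
qed

lemma graph_dist_adj: "E x y \<Longrightarrow> graph_dist E x y = 1"
  using graph_dist_nonbacktracking [of "\<lambda>i. if i = 0 then x else y" 1]
  by (simp add: nonbacktracking_def)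

lemma graph_dist_eq_1D: "graph_dist E x y = 1 \<Longrightarrow> E x y"
  using graph_dist_walk [of x y] by (metis One_nat_def zero_less_one)

text \<open>A local criterion, so that dropping or prepending a vertex can be checked on the first
  few steps.\<close>

lemma geodesic_ray_iff:
  "geodesic_ray E \<rho> \<longleftrightarrow> (\<forall>i. E (\<rho> i) (\<rho> (Suc i)) \<and> \<rho> i \<noteq> \<rho> (Suc (Suc i)))"
proof
  assume \<rho>: "geodesic_ray E \<rho>"
  show "\<forall>i. E (\<rho> i) (\<rho> (Suc i)) \<and> \<rho> i \<noteq> \<rho> (Suc (Suc i))"
  proof (intro allI conjI)
    fix i
    have "graph_dist E (\<rho> i) (\<rho> (Suc i)) = 1" "graph_dist E (\<rho> i) (\<rho> (Suc (Suc i))) = 2"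
      using \<rho> unfolding geodesic_ray_def by (metis diff_Suc_Suc diff_add_inverse le_add1 plus_1_eq_Suc
          add_2_eq_Suc' add.commute)+
    then show "E (\<rho> i) (\<rho> (Suc i))" "\<rho> i \<noteq> \<rho> (Suc (Suc i))"
      by (auto intro: graph_dist_eq_1D)
  qed
next
  assume \<rho>: "\<forall>i. E (\<rho> i) (\<rho> (Suc i)) \<and> \<rho> i \<noteq> \<rho> (Suc (Suc i))"
  show "geodesic_ray E \<rho>"
    unfolding geodesic_ray_def
  proof (intro allI impI)
    fix i j :: nat assume "i \<le> j"
    have "nonbacktracking (\<lambda>k. \<rho> (i + k)) (j - i)" using \<rho> by (simp add: nonbacktracking_def)
    from graph_dist_nonbacktracking [OF this] \<open>i \<le> j\<close> show "graph_dist E (\<rho> i) (\<rho> j) = j - i" by simp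
  qed
qed

end

context rooted_tree
begin

lemma ray_in_end: "\<rho> \<in> \<omega> \<Longrightarrow> geodesic_ray E \<rho>"
  using root_end by (auto simp: boundary_def quotient_def cofinal_def)

lemma end_cofinal:
  assumes "\<rho> \<in> \<omega>" "geodesic_ray E \<sigma>" "\<And>n. \<rho> (n + k) = \<sigma> (n + l)"
  shows "\<sigma> \<in> \<omega>"
proof -
  obtain \<rho>0 where \<rho>0: "geodesic_ray E \<rho>0" "\<omega> = cofinal E `` {\<rho>0}"
    using root_end by (auto simp: boundary_def quotient_def)
  with assms(1) obtain i j where ij: "\<And>n. \<rho>0 (n + i) = \<rho> (n + j)"
    by (auto simp: cofinal_def)
  have "\<rho>0 (n + (i + k)) = \<sigma> (n + (j + l))" for n
    using ij [of "n + k"] assms(3) [of "n + j"] by (simp add: add_ac)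
  with \<rho>0 assms(2) show ?thesis by (auto simp: cofinal_def)
qed

lemma end_cofinalD:
  assumes "\<rho> \<in> \<omega>" "\<sigma> \<in> \<omega>"
  shows "\<exists>k l. \<forall>n. \<rho> (n + k) = \<sigma> (n + l)"
proof -
  obtain \<rho>0 where \<rho>0: "geodesic_ray E \<rho>0" "\<omega> = cofinal E `` {\<rho>0}"
    using root_end by (auto simp: boundary_def quotient_def)
  with assms obtain i j k l where
    ij: "\<And>n. \<rho>0 (n + i) = \<rho> (n + j)" and kl: "\<And>n. \<rho>0 (n + k) = \<sigma> (n + l)"
    by (auto simp: cofinal_def)
  have "\<rho> (n + (j + k)) = \<sigma> (n + (i + l))" for n
    using ij [of "n + k"] kl [of "n + i"] by (simp add: add_ac)
  then show ?thesis by blast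
qed

text \<open>Both rays reach a common vertex along nonbacktracking paths from the same start, so even
  the offsets \<open>k\<close> and \<open>l\<close> agree.\<close>

lemma ray_from_unique:
  assumes "\<rho> \<in> \<omega>" "\<sigma> \<in> \<omega>" "\<rho> 0 = \<sigma> 0"
  shows "\<rho> = \<sigma>"
proof
  fix n
  obtain k l where kl: "\<And>n. \<rho> (n + k) = \<sigma> (n + l)" using end_cofinalD [OF assms(1,2)] by blast
  have nb: "nonbacktracking \<tau> i" if "\<tau> \<in> \<omega>" for \<tau> i
    using ray_in_end [OF that] by (simp add: geodesic_ray_iff nonbacktracking_def)
  from nonbacktracking_unique [OF nb nb, OF assms, of "n + k" "n + l"] kl
  show "\<rho> n = \<sigma> n" by simp
qed

lemma ray_shift: "\<rho> \<in> \<omega> \<Longrightarrow> (\<lambda>n. \<rho> (Suc n)) \<in> \<omega>"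
  by (rule end_cofinal [of \<rho> _ 1 0]) (use ray_in_end [of \<rho>] in \<open>auto simp: geodesic_ray_iff\<close>)

lemma ray_cons:
  assumes "\<rho> \<in> \<omega>" "E y (\<rho> 0)" "y \<noteq> \<rho> 1"
  shows "case_nat y \<rho> \<in> \<omega>"
proof (rule end_cofinal [of \<rho> _ 0 1])
  show "geodesic_ray E (case_nat y \<rho>)"
    using ray_in_end [OF assms(1)] assms(2,3) by (auto simp: geodesic_ray_iff split: nat.split)
qed (use assms in auto)

text \<open>Move the start of some ray of the end along a walk to \<open>x\<close>: a neighbour of
  the start is either the next vertex, and the first is dropped, or it can be prepended.\<close>

lemma ray_from_exists: "\<exists>\<rho>\<in>\<omega>. \<rho> 0 = x"
proof -
  obtain \<rho> where \<rho>: "\<rho> \<in> \<omega>"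
    using root_end by (auto simp: boundary_def quotient_def cofinal_def)
  show ?thesis
    using connected [of "\<rho> 0" x]
  proof (induction rule: rtranclp_induct)
    case base
    with \<rho> show ?case by blast
  next
    case (step y z)
    then obtain \<sigma> where \<sigma>: "\<sigma> \<in> \<omega>" "\<sigma> 0 = y" by blast
    show ?case
    proof (cases "z = \<sigma> 1")
      case True
      with ray_shift [OF \<sigma>(1)] show ?thesis by auto
    next
      case False
      with ray_cons [OF \<sigma>(1)] step(2) \<sigma>(2) adj_sym show ?thesis by (metis nat.case(1))
    qed
  qed
qed

lemma geodesic_to: "geodesic_to \<omega> x \<in> \<omega>" "geodesic_to \<omega> x 0 = x"
proof -
  have "\<exists>!\<rho>. \<rho> \<in> \<omega> \<and> \<rho> 0 = x" using ray_from_exists ray_from_unique by metis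
  from theI' [OF this] show "geodesic_to \<omega> x \<in> \<omega>" "geodesic_to \<omega> x 0 = x"
    by (simp_all add: geodesic_to_def)
qed

lemma geodesic_to_eq: "geodesic_to \<omega> x n = (predecessor \<omega> ^^ n) x"
proof (induction n arbitrary: x)
  case 0
  show ?case by (simp add: geodesic_to)
next
  case (Suc n)
  have "(\<lambda>n. geodesic_to \<omega> x (Suc n)) = geodesic_to \<omega> (predecessor \<omega> x)"
    by (rule ray_from_unique) (simp_all add: ray_shift geodesic_to predecessor_def)
  then have "geodesic_to \<omega> x (Suc n) = geodesic_to \<omega> (predecessor \<omega> x) n" by metis
  with Suc show ?case by (simp add: funpow_swap1)
qed

lemma geodesic_ray_predecessor: "geodesic_ray E (\<lambda>n. (predecessor \<omega> ^^ n) x)"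
  using ray_in_end [OF geodesic_to(1) [of x]] by (simp add: geodesic_to_eq [abs_def])

lemma funpow_predecessor_eq_iff: "(predecessor \<omega> ^^ i) x = (predecessor \<omega> ^^ j) x \<longleftrightarrow> i = j"
proof -
  have "(predecessor \<omega> ^^ i) x \<noteq> (predecessor \<omega> ^^ j) x" if "i < j" for i j
  proof
    assume "(predecessor \<omega> ^^ i) x = (predecessor \<omega> ^^ j) x"
    moreover have "graph_dist E ((predecessor \<omega> ^^ i) x) ((predecessor \<omega> ^^ j) x) = j - i"
      using geodesic_ray_predecessor [of x] that by (simp add: geodesic_ray_def)
    ultimately show False using that by simp
  qed
  from this [of i j] this [of j i] show ?thesis by (cases i j rule: linorder_cases) auto
qed

lemma adj_predecessor: "E x (predecessor \<omega> x)"
  using geodesic_ray_predecessor [of x] unfolding geodesic_ray_iff by (metis funpow_0 funpow_simps_right(2) o_apply)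

text \<open>A neighbour other than the predecessor can be prepended to the ray of \<open>x\<close>.
  In this form the flow condition becomes a statement about fibres of the predecessor map.\<close>

lemma successors_eq: "successors E \<omega> x = {y. predecessor \<omega> y = x}"
proof (intro equalityI subsetI)
  fix y assume "y \<in> successors E \<omega> x"
  then have "E x y" "y \<noteq> geodesic_to \<omega> x 1" by (auto simp: successors_def predecessor_def)
  with adj_sym geodesic_to [of x] have "case_nat y (geodesic_to \<omega> x) \<in> \<omega>"
    by (intro ray_cons) auto
  then have "case_nat y (geodesic_to \<omega> x) = geodesic_to \<omega> y"
    by (rule ray_from_unique) (simp_all add: geodesic_to)
  then have "geodesic_to \<omega> y 1 = geodesic_to \<omega> x 0" by (metis One_nat_def nat.case(2))
  then show "y \<in> {y. predecessor \<omega> y = x}" by (simp add: predecessor_def geodesic_to)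
next
  fix y assume y: "y \<in> {y. predecessor \<omega> y = x}"
  have "y \<noteq> predecessor \<omega> x"
    using funpow_predecessor_eq_iff [of 0 y 2] y by (auto simp: numeral_2_eq_2)
  with y adj_predecessor [of y] adj_sym show "y \<in> successors E \<omega> x" by (auto simp: successors_def)
qed

lemma finite_successors: "finite {y. predecessor \<omega> y = x}"
  unfolding successors_eq [symmetric] successors_def using locally_finite by simp

lemma belowI: "predecessor \<omega> y = x \<Longrightarrow> below \<omega> y x"
  unfolding below_def predecessor_def by blast

text \<open>The ratio 2 / 1 is the smallest admissible one, so each full set of siblings can carry
  an atom.\<close>

lemma trapezoid_1_2: "trapezoid E \<omega> 1 2 x = {y. predecessor \<omega> y = x}"
proof (intro equalityI subsetI)
  fix y assume "y \<in> trapezoid E \<omega> 1 2 x"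
  then obtain n where n: "x = (predecessor \<omega> ^^ n) y" and "graph_dist E x y = 1"
    by (auto simp: trapezoid_def below_def geodesic_to_eq)
  then have "E y x" using graph_dist_eq_1D adj_sym by blast
  then have "graph_dist E y x = 1" by (rule graph_dist_adj)
  moreover have "graph_dist E ((predecessor \<omega> ^^ 0) y) ((predecessor \<omega> ^^ n) y) = n"
    using geodesic_ray_predecessor [of y] unfolding geodesic_ray_def by (metis diff_zero le0)
  ultimately have "n = 1" using n by simp
  with n show "y \<in> {y. predecessor \<omega> y = x}" by simp
next
  fix y assume "y \<in> {y. predecessor \<omega> y = x}"
  moreover from this have "E x y" using adj_predecessor adj_sym by blast
  ultimately show "y \<in> trapezoid E \<omega> 1 2 x"
    by (auto simp: trapezoid_def graph_dist_adj belowI)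
qed

end

section \<open>Operators on the weighted space\<close>

lemma integrable_flow_measure:
  fixes f :: "'a \<Rightarrow> 'b :: {banach, second_countable_topology}"
  assumes "\<And>x. 0 < m x"
  shows "integrable (flow_measure m) f \<longleftrightarrow> (\<lambda>x. m x * norm (f x)) summable_on UNIV"
proof -
  have "integrable (flow_measure m) f \<longleftrightarrow> integrable (count_space UNIV) (\<lambda>x. m x *\<^sub>R f x)"
    unfolding point_measure_def using assms by (intro integrable_density) (auto intro: less_imp_le)
  also have "\<dots> \<longleftrightarrow> Infinite_Set_Sum.abs_summable_on (\<lambda>x. m x *\<^sub>R f x) UNIV"
    by (simp add: Infinite_Set_Sum.abs_summable_on_def)
  also have "\<dots> \<longleftrightarrow> (\<lambda>x. m x * norm (f x)) summable_on UNIV"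
    using assms by (simp add: abs_summable_equivalent [symmetric] less_imp_le)
  finally show ?thesis .
qed

lemma integral_flow_measure:
  fixes f :: "'a \<Rightarrow> 'b :: {banach, second_countable_topology}"
  assumes "\<And>x. 0 < m x" and "(\<lambda>x. m x * norm (f x)) summable_on UNIV"
  shows "integral\<^sup>L (flow_measure m) f = (\<Sum>\<^sub>\<infinity>x. m x *\<^sub>R f x)"
proof -
  have "integral\<^sup>L (flow_measure m) f = integral\<^sup>L (count_space UNIV) (\<lambda>x. m x *\<^sub>R f x)"
    unfolding point_measure_def using assms(1) by (intro integral_density) (auto intro: less_imp_le)
  also have "\<dots> = infsetsum (\<lambda>x. m x *\<^sub>R f x) UNIV" by (simp add: infsetsum_def)
  also have "\<dots> = (\<Sum>\<^sub>\<infinity>x. m x *\<^sub>R f x)"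
    by (rule infsetsum_infsum)
       (use assms in \<open>simp add: abs_summable_equivalent [symmetric] less_imp_le\<close>)
  finally show ?thesis .
qed

lemma integral_flow_measure_finite:
  fixes f :: "'a \<Rightarrow> 'b :: {banach, second_countable_topology}"
  assumes "\<And>x. 0 < m x" and "finite F" and "\<And>x. x \<notin> F \<Longrightarrow> f x = 0"
  shows "integrable (flow_measure m) f"
    and "integral\<^sup>L (flow_measure m) f = (\<Sum>x\<in>F. m x *\<^sub>R f x)"
proof -
  have "(\<lambda>x. m x * norm (f x)) summable_on F" using assms(2) by simp
  then have sum: "(\<lambda>x. m x * norm (f x)) summable_on UNIV"
    by (rule summable_on_cong_neutral [THEN iffD1, rotated -1]) (auto simp: assms(3))
  then show "integrable (flow_measure m) f" by (simp add: integrable_flow_measure assms(1))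
  have "(\<Sum>\<^sub>\<infinity>x. m x *\<^sub>R f x) = (\<Sum>\<^sub>\<infinity>x\<in>F. m x *\<^sub>R f x)"
    by (rule infsum_cong_neutral) (auto simp: assms(3))
  with sum assms show "integral\<^sup>L (flow_measure m) f = (\<Sum>x\<in>F. m x *\<^sub>R f x)"
    by (simp add: integral_flow_measure)
qed

lemma measure_flow_measure_finite:
  assumes "\<And>x. 0 < m x" and "finite F"
  shows "measure (flow_measure m) F = (\<Sum>x\<in>F. m x)"
  using assms
  by (simp add: measure_def emeasure_point_measure_finite2 sum_ennreal less_imp_le sum_nonneg)

definition complex_linear :: "('a ell2 \<Rightarrow> 'a ell2) \<Rightarrow> bool" where
  "complex_linear A \<longleftrightarrow> bounded_linear A \<and> (\<forall>c h. A (scaleC c h) = scaleC c (A h))"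

lemma complex_linear_adjoint:
  assumes A: "complex_linear A" and "bounded_linear B" and adj: "\<And>f g. inner (A f) g = inner f (B g)"
  shows "complex_linear B"
  unfolding complex_linear_def
proof (intro conjI allI assms(2))
  fix c g
  have "inner f (B (scaleC c g)) = inner f (scaleC c (B g))" for f
  proof -
    have "inner f (B (scaleC c g)) = inner (A f) (scaleC c g)" by (simp add: adj)
    also have "\<dots> = inner (A (scaleC (cnj c) f)) g"
      using A by (simp add: complex_linear_def inner_scaleC_left)
    also have "\<dots> = inner f (scaleC c (B g))" by (simp add: adj inner_scaleC_left)
    finally show ?thesis .
  qed
  then show "B (scaleC c g) = scaleC c (B g)"
    by (metis inner_diff_right inner_eq_zero_iff right_minus_eq)
qed

locale positive_density =
  fixes m :: "'a \<Rightarrow> real"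
  assumes density_pos: "0 < m x"
begin

text \<open>The weight \<open>sqrt (m x)\<close> makes this an isometry of L2(m) onto
  \<open>'a ell2\<close>. Off L2(m) the value of \<open>Abs_ell2\<close> is unspecified, hence the
  membership premises below.\<close>

definition to_ell2 :: "('a \<Rightarrow> complex) \<Rightarrow> 'a ell2" where
  "to_ell2 f = Abs_ell2 (\<lambda>x. of_real (sqrt (m x)) * f x)"

definition of_ell2 :: "'a ell2 \<Rightarrow> 'a \<Rightarrow> complex" where
  "of_ell2 h = (\<lambda>x. ell2_apply h x / of_real (sqrt (m x)))"

lemma L2_iff: "f \<in> L2 m \<longleftrightarrow> (\<lambda>x. m x * (norm (f x))\<^sup>2) summable_on UNIV"
  by (simp add: L2_def integrable_flow_measure density_pos)

lemma norm_to_ell2_power2: "(norm (of_real (sqrt (m x)) * z :: complex))\<^sup>2 = m x * (norm z)\<^sup>2"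
  using density_pos [of x] by (simp add: norm_mult power_mult_distrib)

lemma ell2_apply_to_ell2: "f \<in> L2 m \<Longrightarrow> ell2_apply (to_ell2 f) x = of_real (sqrt (m x)) * f x"
  by (simp add: to_ell2_def Abs_ell2_inverse norm_to_ell2_power2 L2_iff)

lemma sqrt_density_nonzero: "complex_of_real (sqrt (m x)) \<noteq> 0"
  using density_pos [of x] by simp

lemma ell2_apply_eq: "ell2_apply h x = of_real (sqrt (m x)) * of_ell2 h x"
  using sqrt_density_nonzero [of x] by (simp add: of_ell2_def)

lemma of_ell2_L2: "of_ell2 h \<in> L2 m"
  using summable_ell2_apply [of h] by (simp add: L2_iff ell2_apply_eq norm_to_ell2_power2)

lemma to_ell2_of_ell2 [simp]: "to_ell2 (of_ell2 h) = h"
  by (rule ell2_eqI) (simp add: ell2_apply_to_ell2 of_ell2_L2 ell2_apply_eq [of h])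

lemma of_ell2_to_ell2 [simp]: "f \<in> L2 m \<Longrightarrow> of_ell2 (to_ell2 f) = f"
  using sqrt_density_nonzero by (simp add: of_ell2_def ell2_apply_to_ell2 fun_eq_iff)

lemma of_ell2_linear:
  "of_ell2 (h + k) = (\<lambda>x. of_ell2 h x + of_ell2 k x)"
  "of_ell2 (h - k) = (\<lambda>x. of_ell2 h x - of_ell2 k x)"
  "of_ell2 (r *\<^sub>R h) = (\<lambda>x. of_real r * of_ell2 h x)"
  "of_ell2 (scaleC c h) = (\<lambda>x. c * of_ell2 h x)"
  by (auto simp: of_ell2_def add_divide_distrib diff_divide_distrib scaleR_conv_of_real)

lemma to_ell2_add:
  assumes "f \<in> L2 m" "g \<in> L2 m"
  shows "(\<lambda>x. f x + g x) \<in> L2 m" "to_ell2 (\<lambda>x. f x + g x) = to_ell2 f + to_ell2 g"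
  using of_ell2_L2 [of "to_ell2 f + to_ell2 g"] to_ell2_of_ell2 [of "to_ell2 f + to_ell2 g"] assms
  by (simp_all only: of_ell2_linear of_ell2_to_ell2)

lemma to_ell2_scale:
  assumes "f \<in> L2 m"
  shows "(\<lambda>x. c * f x) \<in> L2 m" "to_ell2 (\<lambda>x. c * f x) = scaleC c (to_ell2 f)"
  using of_ell2_L2 [of "scaleC c (to_ell2 f)"] to_ell2_of_ell2 [of "scaleC c (to_ell2 f)"] assms
  by (simp_all only: of_ell2_linear of_ell2_to_ell2)

lemma of_ell2_inject: "of_ell2 h = of_ell2 k \<longleftrightarrow> h = k"
  by (metis to_ell2_of_ell2)

lemma norm_L2_of_ell2: "norm_L2 m (of_ell2 h) = norm h"
proof -
  have "(\<integral>x. (norm (of_ell2 h x))\<^sup>2 \<partial>flow_measure m) = (\<Sum>\<^sub>\<infinity>x. m x * (norm (of_ell2 h x))\<^sup>2)"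
    using of_ell2_L2 [of h] by (subst integral_flow_measure) (auto simp: density_pos L2_iff)
  also have "\<dots> = (norm h)\<^sup>2"
    by (simp add: norm_ell2_power2 ell2_apply_eq norm_to_ell2_power2)
  finally show ?thesis by (simp add: norm_L2_def)
qed

lemma inner_L2_of_ell2:
  "inner_L2 m (of_ell2 h) (of_ell2 k) = Complex (inner h k) (inner h (scaleC \<i> k))"
proof -
  have eq: "m x *\<^sub>R (of_ell2 h x * cnj (of_ell2 k x)) = ell2_apply h x * cnj (ell2_apply k x)" for x
  proof -
    have "complex_of_real (m x) = of_real (sqrt (m x)) * of_real (sqrt (m x))"
      using density_pos [of x] by (simp flip: of_real_mult)
    then show ?thesis by (simp add: ell2_apply_eq scaleR_conv_of_real mult_ac)
  qed
  have "m x * norm (of_ell2 h x * cnj (of_ell2 k x)) = norm (ell2_apply h x) * norm (ell2_apply k x)" for x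
    using arg_cong [OF eq, of norm x] density_pos [of x] by (simp add: norm_mult)
  then have "(\<lambda>x. m x * norm (of_ell2 h x * cnj (of_ell2 k x))) summable_on UNIV"
    using summable_ell2_mult_mult [OF summable_ell2_apply summable_ell2_apply, of h k] by simp
  then have "inner_L2 m (of_ell2 h) (of_ell2 k) = (\<Sum>\<^sub>\<infinity>x. ell2_apply h x * cnj (ell2_apply k x))"
    unfolding inner_L2_def by (subst integral_flow_measure) (auto simp: density_pos eq)
  then show ?thesis by (simp add: inner_ell2_scaleC_ii)
qed

definition lift_op :: "('a ell2 \<Rightarrow> 'a ell2) \<Rightarrow> ('a \<Rightarrow> complex) \<Rightarrow> 'a \<Rightarrow> complex" where
  "lift_op A = (\<lambda>f\<in>L2 m. of_ell2 (A (to_ell2 f)))"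

lemma lift_op_of_ell2 [simp]: "lift_op A (of_ell2 h) = of_ell2 (A h)"
  by (simp add: lift_op_def of_ell2_L2)

lemma L2_of_ell2E: assumes "f \<in> L2 m" obtains h where "f = of_ell2 h"
  using assms of_ell2_to_ell2 by metis

lemma lift_op_inject: "lift_op A = lift_op B \<longleftrightarrow> A = B"
  by (metis to_ell2_of_ell2 lift_op_of_ell2 ext)

lemma bounded_op_lift_op: assumes "complex_linear A" shows "bounded_op_L2 m (lift_op A)"
proof -
  interpret bounded_linear A using assms by (simp add: complex_linear_def)
  obtain K where K: "\<And>h. norm (A h) \<le> norm h * K" using bounded by blast
  show ?thesis
    unfolding bounded_op_L2_def
  proof (intro conjI ballI allI exI [of _ K])
    show "lift_op A \<in> L2 m \<rightarrow>\<^sub>E L2 m" by (auto simp: lift_op_def of_ell2_L2)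
    fix f assume f: "f \<in> L2 m"
    show "lift_op A (\<lambda>x. f x + g x) = (\<lambda>x. lift_op A f x + lift_op A g x)" if "g \<in> L2 m" for g
      using f that by (simp add: lift_op_def to_ell2_add to_ell2_scale add of_ell2_linear)
    show "lift_op A (\<lambda>x. c * f x) = (\<lambda>x. c * lift_op A f x)" for c
      using f assms by (simp add: lift_op_def to_ell2_add to_ell2_scale complex_linear_def of_ell2_linear)
    from f obtain h where "f = of_ell2 h" by (rule L2_of_ell2E)
    then show "norm_L2 m (lift_op A f) \<le> K * norm_L2 m f"
      using K [of h] by (simp add: norm_L2_of_ell2 mult.commute)
  qed
qed

text \<open>Every candidate in a definite description over L2(m) is thus the lift of a unique
  operator on \<open>'a ell2\<close>, where uniqueness is decided; extensionality fixes its values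
  off L2(m).\<close>

lemma bounded_opE:
  assumes B: "bounded_op_L2 m B"
  obtains A where "complex_linear A" "B = lift_op A"
proof -
  define A where "A h = to_ell2 (B (of_ell2 h))" for h
  have BL: "B f \<in> L2 m" if "f \<in> L2 m" for f using B that by (auto simp: bounded_op_L2_def)
  have add: "B (\<lambda>x. f x + g x) = (\<lambda>x. B f x + B g x)" if "f \<in> L2 m" "g \<in> L2 m" for f g
    using B that by (auto simp: bounded_op_L2_def)
  have scale: "B (\<lambda>x. c * f x) = (\<lambda>x. c * B f x)" if "f \<in> L2 m" for c f
    using B that by (auto simp: bounded_op_L2_def)
  obtain C where C: "\<And>f. f \<in> L2 m \<Longrightarrow> norm_L2 m (B f) \<le> C * norm_L2 m f"
    using B unfolding bounded_op_L2_def by meson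
  have scaleC: "A (scaleC c h) = scaleC c (A h)" for c h
    by (simp add: A_def of_ell2_linear scale of_ell2_L2 BL to_ell2_add to_ell2_scale)
  have "bounded_linear A"
  proof (rule bounded_linear_intro)
    fix h k r
    show "A (h + k) = A h + A k"
      by (simp add: A_def of_ell2_linear add of_ell2_L2 BL to_ell2_add to_ell2_scale)
    have "scaleC (of_real r) g = r *\<^sub>R g" for g :: "'a ell2"
      by (rule ell2_eqI) (simp add: scaleR_conv_of_real)
    with scaleC [of "of_real r" h] show "A (r *\<^sub>R h) = r *\<^sub>R A h" by simp
    have "norm (A h) = norm_L2 m (B (of_ell2 h))"
      using norm_L2_of_ell2 [of "A h"] by (simp add: A_def BL of_ell2_L2)
    then show "norm (A h) \<le> norm h * C"
      using C [OF of_ell2_L2 [of h]] by (simp add: norm_L2_of_ell2 mult.commute)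
  qed
  with scaleC have "complex_linear A" by (simp add: complex_linear_def)
  moreover have "B = lift_op A"
  proof
    fix f
    have "B f = undefined" if "f \<notin> L2 m"
      using B that unfolding bounded_op_L2_def by (blast intro: PiE_arb)
    then show "B f = lift_op A f" by (simp add: lift_op_def A_def BL)
  qed
  ultimately show ?thesis by (rule that)
qed

text \<open>The real part of the complex identity is the real one; its imaginary part is the real
  one at \<open>scaleC \<i> k\<close>, which \<open>B\<close> respects.\<close>

lemma inner_L2_adjoint_iff:
  assumes "complex_linear B"
  shows "(\<forall>h k. inner_L2 m (of_ell2 (A h)) (of_ell2 k) = inner_L2 m (of_ell2 h) (of_ell2 (B k)))
    \<longleftrightarrow> (\<forall>h k. inner (A h) k = inner h (B k))"
proof -
  have "scaleC \<i> (B k) = B (scaleC \<i> k)" for k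
    using assms by (simp add: complex_linear_def)
  then show ?thesis by (auto simp: inner_L2_of_ell2)
qed

lemma ball_L2_iff: "(\<forall>f\<in>L2 m. P f) \<longleftrightarrow> (\<forall>h. P (of_ell2 h))"
  by (metis L2_of_ell2E of_ell2_L2)

text \<open>\<open>T\<close> is prescribed on L2(m) only, because \<open>flow_gradient\<close> acts
  on all functions and is not itself a lift.\<close>

lemma adjoint_L2_eq:
  assumes T: "\<And>h. T (of_ell2 h) = of_ell2 (A h)"
    and B: "complex_linear B" and adj: "\<And>h k. inner (A h) k = inner h (B k)"
  shows "adjoint_L2 m T = lift_op B"
  unfolding adjoint_L2_def
proof (rule the_equality)
  show "bounded_op_L2 m (lift_op B) \<and>
      (\<forall>f\<in>L2 m. \<forall>g\<in>L2 m. inner_L2 m (T f) g = inner_L2 m f (lift_op B g))"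
    using inner_L2_adjoint_iff [OF B, of A] adj
    by (simp add: bounded_op_lift_op [OF B] ball_L2_iff T)
next
  fix B' assume B': "bounded_op_L2 m B' \<and>
      (\<forall>f\<in>L2 m. \<forall>g\<in>L2 m. inner_L2 m (T f) g = inner_L2 m f (B' g))"
  then obtain C where C: "complex_linear C" "B' = lift_op C" by (metis bounded_opE)
  with B' have "inner (A h) k = inner h (C k)" for h k
    using inner_L2_adjoint_iff [OF C(1), of A] by (simp add: ball_L2_iff T)
  then have "inner h (C k - B k) = 0" for h k by (simp add: inner_diff_right flip: adj)
  then have "C k = B k" for k by (metis inner_eq_zero_iff right_minus_eq)
  then show "B' = lift_op B" by (simp add: C(2) lift_op_inject ext)
qed

lemma sqrt_op_L2_eq:
  assumes "symmetric_contraction X" and X: "\<And>c h. X (scaleC c h) = scaleC c (X h)"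
    and L: "\<And>h. L (of_ell2 h) = of_ell2 (h - X h)"
  shows "sqrt_op_L2 m L = lift_op (symmetric_contraction.sqrt_op X)"
    and "complex_linear (symmetric_contraction.sqrt_op X)"
proof -
  interpret X: symmetric_contraction X by fact
  have comm: "X.sqrt_op (scaleC c h) = scaleC c (X.sqrt_op h)" for c h
    by (rule X.sqrt_op_commute [symmetric]) (simp_all add: bounded_linear_scaleC X)
  then show lin: "complex_linear X.sqrt_op"
    by (simp add: complex_linear_def X.bounded_linear_sqrt_op)
  show "sqrt_op_L2 m L = lift_op X.sqrt_op"
    unfolding sqrt_op_L2_def
  proof (rule the_equality)
    show "positive_op_L2 m (lift_op X.sqrt_op) \<and> (\<forall>f\<in>L2 m. lift_op X.sqrt_op (lift_op X.sqrt_op f) = L f)"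
      using inner_L2_adjoint_iff [OF lin, of X.sqrt_op] X.sqrt_op_nonneg
      by (simp add: positive_op_L2_def bounded_op_lift_op lin ball_L2_iff L X.sqrt_op_sqrt_op
          X.sqrt_op_symmetric inner_L2_of_ell2)
  next
    fix S assume S: "positive_op_L2 m S \<and> (\<forall>f\<in>L2 m. S (S f) = L f)"
    then obtain C where C: "complex_linear C" "S = lift_op C"
      by (metis bounded_opE positive_op_L2_def)
    with S have "inner (C h) k = inner h (C k)" for h k
      using inner_L2_adjoint_iff [OF C(1), of C] by (simp add: positive_op_L2_def ball_L2_iff)
    moreover have "0 \<le> inner (C h) h" for h
    proof -
      have "0 \<le> Re (inner_L2 m (S (of_ell2 h)) (of_ell2 h))"
        using S of_ell2_L2 [of h] unfolding positive_op_L2_def by blast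
      then show ?thesis by (simp only: C(2) lift_op_of_ell2 inner_L2_of_ell2 complex.sel)
    qed
    moreover from S C have "C (C h) = h - X h" for h
      by (simp add: ball_L2_iff L of_ell2_inject)
    ultimately have "C = X.sqrt_op"
      using C(1) by (intro X.sqrt_op_unique) (auto simp: complex_linear_def)
    with C show "S = lift_op X.sqrt_op" by simp
  qed
qed

end

section \<open>The flow Laplacian and its Riesz transform\<close>

sublocale flow_tree \<subseteq> positive_density m
  by unfold_locales (rule flow_pos)

context flow_tree
begin

lemma sum_over_successors: "(\<Sum>x | predecessor \<omega> x = y. m x) = m y"
  using flow [of y] by (simp add: successors_eq)

lemma density_predecessor_ge: "m x \<le> m (predecessor \<omega> x)"
proof -
  have "m x \<le> (\<Sum>z | predecessor \<omega> z = predecessor \<omega> x. m z)"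
    by (rule member_le_sum) (auto simp: finite_successors less_imp_le flow_pos)
  then show ?thesis by (simp add: sum_over_successors)
qed

lemma density_funpow_predecessor_ge: "m x \<le> m ((predecessor \<omega> ^^ n) x)"
  by (induction n) (auto intro: order_trans [OF _ density_predecessor_ge])

text \<open>Sum over the fibres of the predecessor map: by the flow condition the fibre over
  \<open>y\<close> has mass \<open>m y\<close>. This is why the shift is an isometry.\<close>

lemma has_sum_predecessor:
  fixes F :: "'a \<Rightarrow> real"
  assumes "((\<lambda>y. m y * F y) has_sum S) UNIV" and "\<And>y. 0 \<le> F y"
  shows "((\<lambda>x. m x * F (predecessor \<omega> x)) has_sum S) UNIV"
proof -
  let ?B = "\<lambda>y. {x. predecessor \<omega> x = y}" and ?f = "\<lambda>(y, x). m x * F y"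
  have fibre: "((\<lambda>x. ?f (y, x)) has_sum m y * F y) (?B y)" for y
    by (rule has_sum_finiteI)
       (simp_all add: finite_successors sum_over_successors flip: sum_distrib_right)
  have "(?f has_sum S) (Sigma UNIV ?B)"
    by (rule has_sum_SigmaI [OF fibre assms(1) summable_on_SigmaI [OF fibre]])
       (use assms in \<open>auto simp: summable_on_def less_imp_le flow_pos\<close>)
  then show ?thesis
    by (subst (asm) has_sum_reindex_bij_witness
        [where i = "\<lambda>x. (predecessor \<omega> x, x)" and j = snd and T = UNIV
          and h = "\<lambda>x. m x * F (predecessor \<omega> x)"]) auto
qed

lemma predecessor_L2: "f \<in> L2 m \<Longrightarrow> (\<lambda>x. f (predecessor \<omega> x)) \<in> L2 m"
  using has_sum_predecessor [of "\<lambda>x. (norm (f x))\<^sup>2"] by (auto simp: L2_iff summable_on_def)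

definition shift :: "'a ell2 \<Rightarrow> 'a ell2" where
  "shift h = to_ell2 (\<lambda>x. of_ell2 h (predecessor \<omega> x))"

lemma of_ell2_shift: "of_ell2 (shift h) = (\<lambda>x. of_ell2 h (predecessor \<omega> x))"
  by (simp add: shift_def predecessor_L2 of_ell2_L2)

lemma of_ell2_shift_funpow:
  "of_ell2 ((shift ^^ n) h) = (\<lambda>x. of_ell2 h ((predecessor \<omega> ^^ n) x))"
  by (induction n arbitrary: h) (simp_all add: of_ell2_shift funpow_swap1)

lemma norm_power2_of_ell2: "(norm h)\<^sup>2 = (\<Sum>\<^sub>\<infinity>x. m x * (norm (of_ell2 h x))\<^sup>2)"
  by (simp add: norm_ell2_power2 ell2_apply_eq norm_to_ell2_power2)

lemma norm_shift: "norm (shift h) = norm h"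
proof -
  have "((\<lambda>x. m x * (norm (of_ell2 h x))\<^sup>2) has_sum (norm h)\<^sup>2) UNIV"
    unfolding norm_power2_of_ell2 using of_ell2_L2 [of h] by (simp add: L2_iff)
  from has_sum_predecessor [OF this] have "(norm (shift h))\<^sup>2 = (norm h)\<^sup>2"
    unfolding norm_power2_of_ell2 [of "shift h"] of_ell2_shift by (simp add: infsumI)
  then show ?thesis by (simp add: power2_eq_iff_nonneg)
qed

lemma complex_linear_shift: "complex_linear shift"
  unfolding complex_linear_def
  by (auto intro!: bounded_linear_intro [of _ 1] simp: norm_shift of_ell2_shift of_ell2_linear
      simp flip: of_ell2_inject)

sublocale shift: bounded_linear shift
  using complex_linear_shift by (simp add: complex_linear_def)

lemma inner_shift: "inner (shift h) (shift k) = inner h k"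
proof -
  have "inner u v = ((norm (u + v))\<^sup>2 - (norm u)\<^sup>2 - (norm v)\<^sup>2) / 2" for u v :: "'a ell2"
    by (simp add: power2_norm_eq_inner inner_add_left inner_add_right inner_commute)
  from this [of "shift h" "shift k"] this [of h k] show ?thesis
    by (simp add: norm_shift flip: shift.add)
qed

text \<open>In coordinates this is the \<open>m\<close>-weighted mean over the successors; it enters
  through the adjoint relation.\<close>

definition shift_adj :: "'a ell2 \<Rightarrow> 'a ell2" where
  "shift_adj = (SOME B. bounded_linear B \<and> (\<forall>h k. inner (shift h) k = inner h (B k)))"

lemma bounded_linear_shift_adj: "bounded_linear shift_adj"
  and inner_shift_adj: "inner (shift h) k = inner h (shift_adj k)"
proof -
  have "\<exists>B. bounded_linear B \<and> (\<forall>h k. inner (shift h) k = inner h (B k))"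
    using adjoint_exists [OF shift.bounded_linear_axioms] by metis
  from someI_ex [OF this, folded shift_adj_def]
  show "bounded_linear shift_adj" "inner (shift h) k = inner h (shift_adj k)"
    by blast+
qed

lemma complex_linear_shift_adj: "complex_linear shift_adj"
  by (rule complex_linear_adjoint [OF complex_linear_shift bounded_linear_shift_adj inner_shift_adj])

sublocale shift_adj: bounded_linear shift_adj
  by (rule bounded_linear_shift_adj)

lemma inner_left_shift_adj: "inner (shift_adj h) k = inner h (shift k)"
  by (metis inner_commute inner_shift_adj)

lemma ell2_inner_eqI: "(\<And>k. inner h k = inner h' k) \<Longrightarrow> h = (h' :: 'a ell2)"
  by (metis inner_diff_left inner_eq_zero_iff right_minus_eq)

lemma shift_adj_shift [simp]: "shift_adj (shift h) = h"
  by (rule ell2_inner_eqI) (simp add: inner_left_shift_adj inner_shift)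

definition mean_shift :: "'a ell2 \<Rightarrow> 'a ell2" where
  "mean_shift h = (1 / 2) *\<^sub>R (shift h + shift_adj h)"

lemma norm_shift_adj_le: "norm (shift_adj h) \<le> norm h"
proof -
  have "(norm (shift_adj h))\<^sup>2 = inner (shift (shift_adj h)) h"
    by (simp add: power2_norm_eq_inner inner_shift_adj)
  also have "\<dots> \<le> norm (shift_adj h) * norm h"
    using norm_cauchy_schwarz [of "shift (shift_adj h)" h] by (simp add: norm_shift)
  finally show ?thesis
    by (cases "shift_adj h = 0") (auto simp: power2_eq_square)
qed

sublocale symmetric_contraction mean_shift
proof (intro symmetric_contraction.intro symmetric_contraction_axioms.intro)
  show "bounded_linear mean_shift"
    unfolding mean_shift_def
    by (intro bounded_linear_compose [OF bounded_linear_scaleR_right] bounded_linear_add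
        shift.bounded_linear_axioms shift_adj.bounded_linear_axioms)
  fix h k
  show "inner (mean_shift h) k = inner h (mean_shift k)"
    by (simp add: mean_shift_def inner_add_left inner_add_right inner_shift_adj inner_left_shift_adj)
  show "norm (mean_shift h) \<le> norm h"
    using norm_triangle_ineq [of "shift h" "shift_adj h"] norm_shift_adj_le [of h]
    by (simp add: mean_shift_def norm_shift)
qed

lemma mean_shift_scaleC: "mean_shift (scaleC c h) = scaleC c (mean_shift h)"
  using complex_linear_shift complex_linear_shift_adj
  by (simp add: mean_shift_def complex_linear_def bounded_linear.linear [OF bounded_linear_scaleC]
      linear_add linear_scale)

definition grad :: "'a ell2 \<Rightarrow> 'a ell2" where "grad h = h - shift h"

definition grad_adj :: "'a ell2 \<Rightarrow> 'a ell2" where "grad_adj h = h - shift_adj h"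

lemma flow_gradient_of_ell2: "flow_gradient \<omega> (of_ell2 h) = of_ell2 (grad h)"
  by (simp add: flow_gradient_def grad_def of_ell2_linear of_ell2_shift fun_eq_iff)

lemma complex_linear_grad_adj: "complex_linear grad_adj"
  using complex_linear_shift_adj
  by (auto simp: complex_linear_def grad_adj_def [abs_def]
      intro!: bounded_linear_sub bounded_linear_ident
        linear_diff [OF bounded_linear.linear [OF bounded_linear_scaleC], symmetric])

lemma inner_grad: "inner (grad h) k = inner h (grad_adj k)"
  by (simp add: grad_def grad_adj_def inner_diff_left inner_diff_right inner_shift_adj)

text \<open>The shift is an isometry, so the two identity terms add up; the factor 2 cancels the 1/2
  in the Laplacian.\<close>

lemma grad_adj_grad: "grad_adj (grad h) = 2 *\<^sub>R (h - mean_shift h)"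
  by (simp add: grad_def grad_adj_def mean_shift_def shift_adj.diff scaleR_diff_right scaleR_2)

lemma flow_laplacian_of_ell2: "flow_laplacian \<omega> m (of_ell2 h) = of_ell2 (h - mean_shift h)"
proof -
  have "adjoint_L2 m (flow_gradient \<omega>) = lift_op grad_adj"
    by (rule adjoint_L2_eq [OF flow_gradient_of_ell2 complex_linear_grad_adj inner_grad])
  then show ?thesis
    by (simp add: flow_laplacian_def fun_eq_iff flow_gradient_of_ell2 grad_adj_grad of_ell2_linear)
qed

lemma laplacian_half_eq: "laplacian_half \<omega> m = lift_op sqrt_op"
  and complex_linear_sqrt_op: "complex_linear sqrt_op"
  unfolding laplacian_half_def
  using sqrt_op_L2_eq [OF symmetric_contraction_axioms mean_shift_scaleC flow_laplacian_of_ell2] by auto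

lemma norm_grad: "(norm (grad h))\<^sup>2 = 2 * (norm (sqrt_op h))\<^sup>2"
  by (simp add: power2_norm_eq_inner inner_grad grad_adj_grad sqrt_op_symmetric sqrt_op_sqrt_op)

text \<open>A fixed vector of the mean shift is invariant along the rays to the root, on which the density
  does not decrease; hence it is not square summable unless it vanishes.\<close>

lemma mean_shift_fixed_eq_0: assumes "mean_shift h = h" shows "h = 0"
proof (rule ccontr)
  assume "h \<noteq> 0"
  have "(norm (grad h))\<^sup>2 = 0"
    using assms by (simp add: power2_norm_eq_inner inner_grad grad_adj_grad)
  then have "shift h = h" by (simp add: grad_def)
  then have "(shift ^^ n) h = h" for n by (induction n) simp_all
  then have inv: "of_ell2 h ((predecessor \<omega> ^^ n) x) = of_ell2 h x" for n x
    by (metis of_ell2_shift_funpow)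
  have "of_ell2 h \<noteq> of_ell2 0" using \<open>h \<noteq> 0\<close> by (simp add: of_ell2_inject)
  then obtain x where "of_ell2 h x \<noteq> of_ell2 0 x" by blast
  then have x: "of_ell2 h x \<noteq> 0" by (simp add: of_ell2_def)
  define c where "c = m x * (norm (of_ell2 h x))\<^sup>2"
  have "c > 0" using x flow_pos [of x] by (simp add: c_def)
  have "real n * c \<le> (norm h)\<^sup>2" for n
  proof -
    let ?r = "\<lambda>i. (predecessor \<omega> ^^ i) x"
    have "inj_on ?r {..<n}" by (auto simp: inj_on_def funpow_predecessor_eq_iff)
    have "real n * c = (\<Sum>i<n. c)" by simp
    also have "\<dots> \<le> (\<Sum>i<n. (norm (ell2_apply h (?r i)))\<^sup>2)"
      by (intro sum_mono)
         (simp add: c_def ell2_apply_eq norm_to_ell2_power2 inv density_funpow_predecessor_ge mult_right_mono)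
    also have "\<dots> = (\<Sum>y\<in>?r ` {..<n}. (norm (ell2_apply h y))\<^sup>2)"
      by (simp add: sum.reindex [OF \<open>inj_on ?r {..<n}\<close>])
    also have "\<dots> \<le> (norm h)\<^sup>2" by (rule sum_ell2_le) simp
    finally show ?thesis .
  qed
  moreover obtain n where "(norm h)\<^sup>2 / c < real n" using reals_Archimedean2 by blast
  ultimately show False using \<open>c > 0\<close> by (metis divide_less_eq not_le)
qed

lemma laplacian_minus_half_eq:
  "laplacian_minus_half \<omega> m (of_ell2 (sqrt_op h)) = of_ell2 h"
proof -
  have "inj_on (laplacian_half \<omega> m) (L2 m)"
  proof (rule inj_onI)
    fix f g assume "f \<in> L2 m" "g \<in> L2 m" and eq: "laplacian_half \<omega> m f = laplacian_half \<omega> m g"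
    then obtain h k where hk: "f = of_ell2 h" "g = of_ell2 k" by (metis L2_of_ell2E)
    with eq have "sqrt_op h = sqrt_op k" by (simp add: laplacian_half_eq of_ell2_inject)
    then have "sqrt_op (sqrt_op (h - k)) = 0"
      by (simp add: linear_diff [OF bounded_linear.linear [OF bounded_linear_sqrt_op]]
          linear_0 [OF bounded_linear.linear [OF bounded_linear_sqrt_op]])
    then have "h - k = 0" by (intro mean_shift_fixed_eq_0) (simp add: sqrt_op_sqrt_op)
    with hk show "f = g" by simp
  qed
  then show ?thesis
    unfolding laplacian_minus_half_def
    by (metis inv_into_f_f laplacian_half_eq lift_op_of_ell2 of_ell2_L2)
qed

definition riesz_op :: "'a ell2 \<Rightarrow> 'a ell2" where
  "riesz_op = (SOME R. bounded_linear R \<and> (\<forall>h. R (sqrt_op h) = grad h))"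

text \<open>By \<open>norm_grad\<close> the gradient is controlled by the root with constant
  \<open>sqrt 2\<close>, and the range of the root is dense because the mean shift fixes no nonzero
  vector.\<close>

lemma bounded_linear_riesz_op: "bounded_linear riesz_op"
  and riesz_op_sqrt_op: "riesz_op (sqrt_op h) = grad h"
proof -
  have "norm (grad h) \<le> sqrt 2 * norm (sqrt_op h)" for h
    using norm_grad [of h] by (metis norm_ge_zero order_refl real_sqrt_mult real_sqrt_abs abs_norm_cancel)
  moreover have "linear grad"
    unfolding grad_def [abs_def]
    by (intro bounded_linear.linear bounded_linear_sub bounded_linear_ident shift.bounded_linear_axioms)
  ultimately have "\<exists>R. bounded_linear R \<and> (\<forall>h. R (sqrt_op h) = grad h)"
    using bounded_linear_extension_of_dense [OF bounded_linear.linear [OF bounded_linear_sqrt_op],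
        of grad "sqrt 2"] closure_range_sqrt_op [OF mean_shift_fixed_eq_0] by metis
  from someI_ex [OF this, folded riesz_op_def]
  show "bounded_linear riesz_op" "riesz_op (sqrt_op h) = grad h"
    by blast+
qed

lemma eq_on_range_sqrt_op:
  assumes "bounded_linear A" "bounded_linear B" "\<And>h. A (sqrt_op h) = B (sqrt_op h)"
  shows "A = B"
proof
  fix h
  have "A h - B h = 0"
  proof (rule continuous_constant_on_closure [of "range sqrt_op" "\<lambda>h. A h - B h"])
    show "continuous_on (closure (range sqrt_op)) (\<lambda>h. A h - B h)"
      by (intro linear_continuous_on bounded_linear_sub assms)
    show "h \<in> closure (range sqrt_op)"
      by (simp add: closure_range_sqrt_op [OF mean_shift_fixed_eq_0])
  qed (use assms(3) in auto)
  then show "A h = B h" by simp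
qed

lemma complex_linear_riesz_op: "complex_linear riesz_op"
  unfolding complex_linear_def
proof (intro conjI allI bounded_linear_riesz_op)
  fix c h
  have "(\<lambda>h. riesz_op (scaleC c h)) = (\<lambda>h. scaleC c (riesz_op h))"
  proof (rule eq_on_range_sqrt_op)
    show "bounded_linear (\<lambda>h. riesz_op (scaleC c h))" "bounded_linear (\<lambda>h. scaleC c (riesz_op h))"
      by (auto intro: bounded_linear_compose [OF bounded_linear_riesz_op bounded_linear_scaleC]
          bounded_linear_compose [OF bounded_linear_scaleC bounded_linear_riesz_op])
    fix h
    have "riesz_op (scaleC c (sqrt_op h)) = riesz_op (sqrt_op (scaleC c h))"
      using complex_linear_sqrt_op by (simp add: complex_linear_def)
    also have "\<dots> = scaleC c (grad h)"
      using complex_linear_shift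
      by (simp add: riesz_op_sqrt_op grad_def complex_linear_def
          linear_diff [OF bounded_linear.linear [OF bounded_linear_scaleC]])
    finally show "riesz_op (scaleC c (sqrt_op h)) = scaleC c (riesz_op (sqrt_op h))"
      by (simp add: riesz_op_sqrt_op)
  qed
  then show "riesz_op (scaleC c h) = scaleC c (riesz_op h)" by metis
qed

lemma riesz_eq: "riesz \<omega> m = lift_op riesz_op"
proof -
  have iff: "(\<forall>f\<in>laplacian_half \<omega> m ` L2 m. R f = flow_gradient \<omega> (laplacian_minus_half \<omega> m f))
      \<longleftrightarrow> (\<forall>h. R (of_ell2 (sqrt_op h)) = of_ell2 (grad h))" for R
    by (simp add: ball_L2_iff laplacian_half_eq laplacian_minus_half_eq flow_gradient_of_ell2)
  show ?thesis
    unfolding riesz_def iff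
  proof (rule the_equality)
    show "bounded_op_L2 m (lift_op riesz_op) \<and>
        (\<forall>h. lift_op riesz_op (of_ell2 (sqrt_op h)) = of_ell2 (grad h))"
      by (simp add: bounded_op_lift_op complex_linear_riesz_op riesz_op_sqrt_op)
  next
    fix R assume R: "bounded_op_L2 m R \<and> (\<forall>h. R (of_ell2 (sqrt_op h)) = of_ell2 (grad h))"
    then obtain A where A: "complex_linear A" "R = lift_op A" by (metis bounded_opE)
    with R have "A = riesz_op"
      by (intro eq_on_range_sqrt_op bounded_linear_riesz_op)
         (auto simp: complex_linear_def of_ell2_inject riesz_op_sqrt_op)
    with A show "R = lift_op riesz_op" by simp
  qed
qed

lemma riesz_adjoint_exists:
  obtains B where "riesz_adjoint \<omega> m = lift_op B" and "\<And>h k. inner (riesz_op h) k = inner h (B k)"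
    and "complex_linear B"
proof -
  obtain B where B: "bounded_linear B" "\<And>h k. inner (riesz_op h) k = inner h (B k)"
    using adjoint_exists [OF bounded_linear_riesz_op] by metis
  have lin: "complex_linear B" by (rule complex_linear_adjoint [OF complex_linear_riesz_op B])
  moreover have "riesz_adjoint \<omega> m = lift_op B"
    unfolding riesz_adjoint_def riesz_eq by (rule adjoint_L2_eq [OF _ lin B(2)]) simp
  ultimately show ?thesis using B(2) by (intro that)
qed

lemma inner_L2_riesz:
  assumes "f \<in> L2 m" "g \<in> L2 m"
  shows "inner_L2 m (riesz \<omega> m f) g = inner_L2 m f (riesz_adjoint \<omega> m g)"
proof -
  obtain B where B: "riesz_adjoint \<omega> m = lift_op B" "\<And>h k. inner (riesz_op h) k = inner h (B k)"
    "complex_linear B" by (rule riesz_adjoint_exists) blast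
  from inner_L2_adjoint_iff [OF B(3), of riesz_op] B(2) assms show ?thesis
    by (auto simp: riesz_eq B(1) elim!: L2_of_ell2E)
qed

text \<open>Taking adjoints in \<open>riesz_op_sqrt_op\<close> characterises the adjoint Riesz
  transform by an equation, without a formula for the inverse root.\<close>

lemma sqrt_op_riesz_adjoint:
  assumes "f \<in> L2 m"
  shows "sqrt_op (to_ell2 (riesz_adjoint \<omega> m f)) = grad_adj (to_ell2 f)"
    and "riesz_adjoint \<omega> m f \<in> L2 m"
proof -
  obtain B where B: "riesz_adjoint \<omega> m = lift_op B" "\<And>h k. inner (riesz_op h) k = inner h (B k)"
    by (rule riesz_adjoint_exists) blast
  obtain k where k: "f = of_ell2 k" using assms by (rule L2_of_ell2E)
  have "inner (sqrt_op (B k)) h = inner (grad_adj k) h" for h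
  proof -
    have "inner (sqrt_op (B k)) h = inner (sqrt_op h) (B k)"
      by (metis sqrt_op_symmetric inner_commute)
    also have "\<dots> = inner (grad h) k" by (simp add: riesz_op_sqrt_op flip: B(2))
    finally show ?thesis by (metis inner_grad inner_commute)
  qed
  then have "sqrt_op (B k) = grad_adj k" by (rule ell2_inner_eqI)
  then show "sqrt_op (to_ell2 (riesz_adjoint \<omega> m f)) = grad_adj (to_ell2 f)"
    "riesz_adjoint \<omega> m f \<in> L2 m"
    by (simp_all add: B(1) k of_ell2_L2)
qed

text \<open>A ray to the root passes \<open>z\<close> at most once, so it meets the successors of
  \<open>z\<close> at most once. Orthogonality of the translates and the summability bound both rest
  on this.\<close>

lemma disjoint_generations:
  assumes "predecessor \<omega> ((predecessor \<omega> ^^ i) x) = z" "predecessor \<omega> ((predecessor \<omega> ^^ j) x) = z"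
  shows "i = j"
  using assms funpow_predecessor_eq_iff [of "Suc i" x "Suc j"] by simp

section \<open>Mean-zero functions on the successors of one vertex\<close>

context
  fixes z :: 'a and a :: "'a \<Rightarrow> complex"
  assumes supp: "\<And>x. predecessor \<omega> x \<noteq> z \<Longrightarrow> a x = 0"
    and mean_zero: "(\<Sum>x | predecessor \<omega> x = z. of_real (m x) * a x) = 0"
    and nontrivial: "a \<noteq> (\<lambda>_. 0)"
begin

lemma siblings_L2: "a \<in> L2 m"
  unfolding L2_def
  by (auto intro!: integral_flow_measure_finite(1) [OF flow_pos finite_successors [of z]] supp)

text \<open>A shifted function is constant on the successors of \<open>z\<close>, and
  \<open>a\<close> has mean zero there.\<close>

lemma shift_adj_siblings: "shift_adj (to_ell2 a) = 0"
proof -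
  have "inner (shift_adj (to_ell2 a)) k = 0" for k
  proof -
    have eq: "inner (ell2_apply (to_ell2 a) x) (ell2_apply (shift k) x)
        = Re (of_real (m x) * a x * cnj (of_ell2 k z))" for x
    proof (cases "predecessor \<omega> x = z")
      case True
      have "complex_of_real (m x) = of_real (sqrt (m x)) * of_real (sqrt (m x))"
        using flow_pos [of x] by (simp flip: of_real_mult)
      with True show ?thesis
        by (simp add: ell2_apply_eq siblings_L2 of_ell2_shift inner_complex_def algebra_simps)
    qed (simp add: ell2_apply_to_ell2 siblings_L2 supp)
    have "inner (shift_adj (to_ell2 a)) k = (\<Sum>\<^sub>\<infinity>x. Re (of_real (m x) * a x * cnj (of_ell2 k z)))"
      unfolding inner_left_shift_adj unfolding inner_ell2.rep_eq eq ..
    also have "\<dots> = (\<Sum>\<^sub>\<infinity>x\<in>{x. predecessor \<omega> x = z}. Re (of_real (m x) * a x * cnj (of_ell2 k z)))"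
      by (rule infsum_cong_neutral) (auto simp: supp)
    also have "\<dots> = Re ((\<Sum>x | predecessor \<omega> x = z. of_real (m x) * a x) * cnj (of_ell2 k z))"
      by (simp add: finite_successors sum_distrib_right del: times_complex.sel)
    finally show ?thesis by (simp add: mean_zero)
  qed
  then show ?thesis by (intro ell2_inner_eqI) simp
qed

lemma inner_shift_funpow_siblings:
  "i \<noteq> j \<Longrightarrow> inner ((shift ^^ i) (to_ell2 a)) ((shift ^^ j) (to_ell2 a)) = 0"
  unfolding inner_ell2.rep_eq ell2_apply_eq of_ell2_shift_funpow of_ell2_to_ell2 [OF siblings_L2]
proof (rule infsum_0)
  fix x assume "i \<noteq> j"
  then have "a ((predecessor \<omega> ^^ i) x) = 0 \<or> a ((predecessor \<omega> ^^ j) x) = 0"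
    using disjoint_generations [of i x z j] supp by blast
  then show "inner (of_real (sqrt (m x)) * a ((predecessor \<omega> ^^ i) x))
      (of_real (sqrt (m x)) * a ((predecessor \<omega> ^^ j) x)) = 0" by auto
qed

text \<open>By \<open>shift_adj_siblings\<close> the mean shift acts on the span of the translates of \<open>a\<close> as the killed
  random walk on the half line.\<close>

lemma riesz_adjoint_siblings_not_L1: "riesz_adjoint \<omega> m a \<notin> L1 m"
proof
  define U where "U = riesz_adjoint \<omega> m a"
  assume "riesz_adjoint \<omega> m a \<in> L1 m"
  then have summ: "(\<lambda>x. m x * norm (U x)) summable_on UNIV"
    by (simp add: L1_def integrable_flow_measure flow_pos U_def)
  have U_L2: "U \<in> L2 m" unfolding U_def by (rule sqrt_op_riesz_adjoint(2) [OF siblings_L2])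
  define \<alpha> where "\<alpha> = to_ell2 a"
  have "\<alpha> \<noteq> 0"
  proof
    assume "\<alpha> = 0"
    then have "a = of_ell2 0" using siblings_L2 unfolding \<alpha>_def by (metis of_ell2_to_ell2)
    with nontrivial show False by (simp add: of_ell2_def)
  qed
  define N where "N = norm \<alpha>"
  have "N > 0" using \<open>\<alpha> \<noteq> 0\<close> by (simp add: N_def)
  define e where "e j = (1 / N) *\<^sub>R (shift ^^ j) \<alpha>" for j
  have norm_pow: "norm ((shift ^^ j) \<alpha>) = N" for j
    by (induction j) (simp_all add: N_def norm_shift)
  have "inner (e i) (e j) = (if i = j then 1 else 0)" for i j
  proof (cases "i = j")
    case True
    have "inner ((shift ^^ j) \<alpha>) ((shift ^^ j) \<alpha>) = N * N"
      using norm_pow [of j] by (metis power2_norm_eq_inner power2_eq_square)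
    with True \<open>N > 0\<close> show ?thesis by (simp add: e_def)
  next
    case False
    with inner_shift_funpow_siblings show ?thesis by (simp add: e_def \<alpha>_def)
  qed
  moreover have "mean_shift (e 0) = (1 / 2) *\<^sub>R e 1"
    using shift_adj_siblings by (simp add: mean_shift_def e_def \<alpha>_def shift.scaleR shift_adj.scaleR)
  moreover have "mean_shift (e (Suc j)) = (1 / 2) *\<^sub>R (e j + e (Suc (Suc j)))" for j
    by (simp add: mean_shift_def e_def shift.scaleR shift_adj.scaleR add.commute)
  moreover have "sqrt_op ((1 / N) *\<^sub>R to_ell2 U) = e 0"
    using sqrt_op_riesz_adjoint(1) [OF siblings_L2] shift_adj_siblings
    by (simp add: linear_scale [OF bounded_linear.linear [OF bounded_linear_sqrt_op]] U_def grad_adj_def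
        e_def \<alpha>_def)
  ultimately have "\<not> summable (\<lambda>j. \<bar>inner ((1 / N) *\<^sub>R to_ell2 U) (e j)\<bar>)"
    by (rule not_summable_inv_sqrt_half_line)
  moreover have "summable (\<lambda>j. \<bar>inner ((1 / N) *\<^sub>R to_ell2 U) (e j)\<bar>)"
  proof -
    let ?g = "\<lambda>j x. (predecessor \<omega> ^^ j) x"
    define K where "K = (\<Sum>x | predecessor \<omega> x = z. norm (a x))"
    have K: "norm (a x) \<le> K" for x
      by (cases "predecessor \<omega> x = z")
         (auto simp: K_def supp finite_successors intro!: member_le_sum sum_nonneg)
    \<comment> \<open>At most one term is nonzero, so pairing \<open>U\<close> with all translates
      at once costs only the factor \<open>K\<close>; integrability of \<open>U\<close> would thus
      make its coefficients summable.\<close>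
    have gen: "(\<Sum>j<J. norm (a (?g j x))) \<le> K" for J x
    proof (cases "\<exists>i<J. a (?g i x) \<noteq> 0")
      case True
      then obtain i where i: "i < J" "a (?g i x) \<noteq> 0" by blast
      then have "predecessor \<omega> (?g i x) = z" using supp by blast
      then have "a (?g j x) = 0" if "j \<noteq> i" for j
        using disjoint_generations [of i x z j] that supp by blast
      then have "(\<Sum>j<J. norm (a (?g j x))) = (\<Sum>j<J. if j = i then norm (a (?g i x)) else 0)"
        by (intro sum.cong) auto
      also have "\<dots> \<le> K" using i(1) K by simp
      finally show ?thesis .
    next
      case False
      then have "(\<Sum>j<J. norm (a (?g j x))) = 0" by simp
      also have "0 \<le> K" by (simp add: K_def sum_nonneg)
      finally show ?thesis .
    qed
    have eq: "norm (inner (ell2_apply (to_ell2 U) x) (ell2_apply ((shift ^^ j) \<alpha>) x))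
        \<le> m x * norm (U x) * norm (a (?g j x))" for x j
    proof -
      have "norm (inner (ell2_apply (to_ell2 U) x) (ell2_apply ((shift ^^ j) \<alpha>) x))
          \<le> norm (ell2_apply (to_ell2 U) x) * norm (ell2_apply ((shift ^^ j) \<alpha>) x)"
        using Cauchy_Schwarz_ineq2 by simp
      also have "\<dots> = (sqrt (m x) * sqrt (m x)) * norm (U x) * norm (a (?g j x))"
        using flow_pos [of x]
        by (simp add: ell2_apply_eq U_L2 of_ell2_shift_funpow \<alpha>_def siblings_L2 norm_mult)
      finally show ?thesis using flow_pos [of x] by simp
    qed
    have summ_j: "(\<lambda>x. m x * norm (U x) * norm (a (?g j x))) summable_on UNIV" for j
    proof (rule abs_summable_summable [OF Infinite_Sum.abs_summable_on_comparison_test])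
      show "(\<lambda>x. norm (m x * norm (U x) * K)) summable_on UNIV"
        using summable_on_cmult_left [OF summ, of "\<bar>K\<bar>"] flow_pos by (simp add: abs_mult less_imp_le)
      show "norm (m x * norm (U x) * norm (a (?g j x))) \<le> norm (m x * norm (U x) * K)" for x
        using flow_pos [of x] K [of "?g j x"] by (simp add: abs_mult mult_left_mono)
    qed
    have le: "\<bar>inner (to_ell2 U) ((shift ^^ j) \<alpha>)\<bar> \<le> (\<Sum>\<^sub>\<infinity>x. m x * norm (U x) * norm (a (?g j x)))" for j
      unfolding inner_ell2.rep_eq real_norm_def [symmetric]
      by (rule norm_infsum_le [OF has_sum_infsum has_sum_infsum])
         (intro summable_ell2_inner summable_ell2_apply summ_j eq)+
    have "(\<Sum>j<J. \<bar>inner (to_ell2 U) ((shift ^^ j) \<alpha>)\<bar>) \<le> (\<Sum>\<^sub>\<infinity>x. m x * norm (U x) * K)" for J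
    proof -
      have "(\<Sum>j<J. \<bar>inner (to_ell2 U) ((shift ^^ j) \<alpha>)\<bar>)
          \<le> (\<Sum>j<J. \<Sum>\<^sub>\<infinity>x. m x * norm (U x) * norm (a (?g j x)))"
        by (intro sum_mono le)
      also have "\<dots> \<le> (\<Sum>\<^sub>\<infinity>x. m x * norm (U x) * K)"
      proof (rule has_sum_mono)
        show "((\<lambda>x. \<Sum>j<J. m x * norm (U x) * norm (a (?g j x))) has_sum
            (\<Sum>j<J. \<Sum>\<^sub>\<infinity>x. m x * norm (U x) * norm (a (?g j x)))) UNIV"
        proof (induction J)
          case (Suc J)
          then show ?case
            unfolding sum.lessThan_Suc by (rule has_sum_add [OF _ has_sum_infsum [OF summ_j]])
        qed simp
        show "((\<lambda>x. m x * norm (U x) * K) has_sum (\<Sum>\<^sub>\<infinity>x. m x * norm (U x) * K)) UNIV"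
          by (rule has_sum_infsum [OF summable_on_cmult_left [OF summ]])
        show "(\<Sum>j<J. m x * norm (U x) * norm (a (?g j x))) \<le> m x * norm (U x) * K" for x
          unfolding sum_distrib_left [symmetric]
          using flow_pos [of x] gen by (intro mult_left_mono) auto
      qed
      finally show ?thesis .
    qed
    then have "summable (\<lambda>j. \<bar>inner (to_ell2 U) ((shift ^^ j) \<alpha>)\<bar>)"
      by (intro summableI_nonneg_bounded) auto
    from summable_mult [OF this, of "1 / N * (1 / N)"] show ?thesis
      using \<open>N > 0\<close> by (simp add: e_def abs_mult)
  qed
  ultimately show False by blast
qed

end

lemma atom_L2_not_L1:
  assumes "1 < card (successors E \<omega> z)"
  obtains a where "a \<in> L2 m" "riesz_adjoint \<omega> m a \<notin> L1 m" "\<And>x. predecessor \<omega> x \<noteq> z \<Longrightarrow> a x = 0"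
    "(\<Sum>x | predecessor \<omega> x = z. m x *\<^sub>R a x) = 0" "\<And>x. norm (a x) \<le> 1 / m z"
proof -
  let ?R = "{x. predecessor \<omega> x = z}"
  have "1 < card ?R" using assms by (simp add: successors_eq)
  then obtain y1 y2 where y: "y1 \<in> ?R" "y2 \<in> ?R" "y1 \<noteq> y2"
    using card_le_Suc0_iff_eq [OF finite_successors, of z] by (metis One_nat_def not_le)
  \<comment> \<open>Values \<open>k / m y1\<close> and \<open>- (k / m y2)\<close> balance in
    \<open>m\<close>-mean; the minimum keeps both within \<open>1 / m z\<close>, the bound for an
    atom.\<close>
  define k where "k = min (m y1) (m y2) / m z"
  have "k > 0" using flow_pos by (simp add: k_def)
  define a :: "'a \<Rightarrow> complex" where
    "a x = of_real (if x = y1 then k / m y1 else if x = y2 then - (k / m y2) else 0)" for x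
  have supp: "a x = 0" if "predecessor \<omega> x \<noteq> z" for x using that y by (auto simp: a_def)
  have "(\<Sum>x\<in>?R. of_real (m x) * a x) = (\<Sum>x\<in>{y1, y2}. of_real (m x) * a x)"
    by (rule sum.mono_neutral_right) (use y in \<open>auto simp: a_def finite_successors\<close>)
  also have "\<dots> = 0"
    using y(3) flow_pos [of y1] flow_pos [of y2] by (simp add: a_def)
  finally have mean_zero: "(\<Sum>x\<in>?R. of_real (m x) * a x) = 0" .
  have "a y1 \<noteq> 0" using \<open>k > 0\<close> flow_pos [of y1] by (simp add: a_def)
  then have nontrivial: "a \<noteq> (\<lambda>_. 0)" by metis
  have bound: "norm (a x) \<le> 1 / m z" for x
  proof -
    have "k / m y \<le> 1 / m z" if "min (m y1) (m y2) \<le> m y" for y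
    proof -
      have "k / m y = (min (m y1) (m y2) / m y) / m z" by (simp add: k_def)
      also have "\<dots> \<le> 1 / m z"
        using that flow_pos [of y] flow_pos [of z] by (intro divide_right_mono) (auto simp: divide_le_eq)
      finally show ?thesis .
    qed
    from this [of y1] this [of y2] show ?thesis
      using \<open>k > 0\<close> flow_pos [of y1] flow_pos [of y2] flow_pos [of z]
      by (auto simp: a_def norm_divide abs_of_pos simp flip: of_real_divide of_real_minus)
  qed
  show ?thesis
    using that siblings_L2 [OF supp mean_zero nontrivial]
      riesz_adjoint_siblings_not_L1 [OF supp mean_zero nontrivial] supp mean_zero bound
    by (simp add: scaleR_conv_of_real)
qed

end

section \<open>From the atom to the two endpoint spaces\<close>

lemma H1_atom:
  assumes "atom E \<omega> m a" "a \<in> L1 m"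
  shows "a \<in> H1 E \<omega> m"
proof -
  \<comment> \<open>A decomposition is an infinite sequence of atoms, so \<open>a\<close> is
    repeated with coefficient 0.\<close>
  let ?c = "\<lambda>j :: nat. if j = 0 then 1 else 0 :: complex"
  have "(\<lambda>j. norm (?c j)) = (\<lambda>j. if j = 0 then 1 else 0)" by auto
  then have "summable (\<lambda>j. norm (?c j))" by simp
  moreover have "(\<Sum>j<n. ?c j * a x) = a x" if "n > 0" for n x
    using that by (simp add: sum_distrib_right [symmetric])
  then have "\<forall>\<^sub>F n in sequentially. norm_L1 m (\<lambda>x. a x - (\<Sum>j<n. ?c j * a x)) = 0"
    by (intro eventually_sequentiallyI [of 1]) (simp add: norm_L1_def)
  then have "(\<lambda>n. norm_L1 m (\<lambda>x. a x - (\<Sum>j<n. ?c j * a x))) \<longlonglongrightarrow> 0"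
    by (rule tendsto_eventually)
  ultimately have "atomic_decomposition E \<omega> m a ?c (\<lambda>_. a)"
    using assms by (simp add: atomic_decomposition_def)
  then show ?thesis by (auto simp: H1_def)
qed

theorem proposition6p8:
  fixes E :: "'a \<Rightarrow> 'a \<Rightarrow> bool" and \<omega> :: "(nat \<Rightarrow> 'a) set" and m :: "'a \<Rightarrow> real"
  assumes "flow_tree E \<omega> m"
    and "locally_doubling E m"
    and "\<exists>x. 1 < card (successors E \<omega> x)"
  shows "\<not> bounded_between m (riesz_adjoint \<omega> m) (H1 E \<omega> m) (norm_H1 E \<omega> m) (L1 m) (norm_L1 m)
       \<and> \<not> bounded_between m (riesz \<omega> m) Linf norm_Linf (BMO E \<omega> m) (norm_BMO E \<omega> m)"
proof -
  interpret flow_tree E \<omega> m by fact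
  obtain z where "1 < card (successors E \<omega> z)" using assms(3) by blast
  then obtain a where a: "a \<in> L2 m" "riesz_adjoint \<omega> m a \<notin> L1 m"
    and supp: "\<And>x. predecessor \<omega> x \<noteq> z \<Longrightarrow> a x = 0"
    and mean_zero: "(\<Sum>x | predecessor \<omega> x = z. m x *\<^sub>R a x) = 0"
    and bound: "\<And>x. norm (a x) \<le> 1 / m z"
    by (rule atom_L2_not_L1) blast
  define R where "R = {x. predecessor \<omega> x = z}"
  have fin: "finite R" by (simp add: R_def finite_successors)
  have mR: "measure (flow_measure m) R = m z"
    by (simp add: measure_flow_measure_finite flow_pos fin) (simp add: R_def sum_over_successors)
  have adm: "admissible E \<omega> R"
    unfolding admissible_def R_def trapezoid_1_2 [symmetric]
    by (intro disjI2 exI [of _ z] exI [of _ 1] exI [of _ 2]) simp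
  note fin_int = integral_flow_measure_finite [OF flow_pos fin]
  have supp_R: "a x = 0" if "x \<notin> R" for x using supp that by (simp add: R_def)
  have "a \<in> L1 m" unfolding L1_def by (auto intro: fin_int supp_R)
  moreover have "(\<integral>x. a x \<partial>flow_measure m) = 0"
    using fin_int(2) [of a] supp_R mean_zero by (simp add: R_def)
  then have "atom E \<omega> m a"
    unfolding atom_def using adm supp_R bound by (intro exI [of _ R]) (simp add: mR)
  ultimately have "a \<in> H1 E \<omega> m" by (intro H1_atom)
  \<comment> \<open>What fails is membership of the image in L1(m), so no norm of \<open>a\<close>
    has to be estimated.\<close>
  with a have part1: "\<not> bounded_between m (riesz_adjoint \<omega> m) (H1 E \<omega> m) (norm_H1 E \<omega> m) (L1 m) (norm_L1 m)"
    by (auto simp: bounded_between_def)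
  have "\<not> bounded_between m (riesz \<omega> m) Linf norm_Linf (BMO E \<omega> m) (norm_BMO E \<omega> m)"
  proof
    assume "bounded_between m (riesz \<omega> m) Linf norm_Linf (BMO E \<omega> m) (norm_BMO E \<omega> m)"
    then obtain C where C: "\<And>f. f \<in> L2 m \<Longrightarrow> f \<in> Linf \<Longrightarrow> riesz \<omega> m f \<in> BMO E \<omega> m
        \<and> norm_BMO E \<omega> m (riesz \<omega> m f) \<le> C * norm_Linf f"
      unfolding bounded_between_def by blast
    define U where "U = riesz_adjoint \<omega> m a"
    have "(\<Sum>x\<in>F. m x * norm (U x)) \<le> \<bar>C\<bar>" if "finite F" for F
    proof -
      \<comment> \<open>Cutting the sign of \<open>U\<close> off to a finite set puts it in L2(m),
        where the adjoint relation holds; the final bound does not depend on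
        \<open>F\<close>.\<close>
      define g where "g x = (if x \<in> F then sgn (U x) else 0)" for x
      note int_F = integral_flow_measure_finite [OF flow_pos \<open>finite F\<close>]
      have g_le: "norm (g x) \<le> 1" for x by (simp add: g_def norm_sgn)
      have "g \<in> L2 m" unfolding L2_def by (auto intro!: int_F(1) simp: g_def)
      moreover have "g \<in> Linf" unfolding Linf_def by (auto intro!: bdd_aboveI2 [where M = 1] g_le)
      ultimately have G: "riesz \<omega> m g \<in> BMO E \<omega> m" "norm_BMO E \<omega> m (riesz \<omega> m g) \<le> C * norm_Linf g"
        using C by auto
      have "norm_Linf g \<le> 1" unfolding norm_Linf_def by (rule cSUP_least) (auto simp: g_le)
      moreover have "0 \<le> norm_Linf g"
        unfolding norm_Linf_def
        by (rule cSUP_upper2 [of _ _ z]) (auto intro!: bdd_aboveI2 [where M = 1] g_le)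
      ultimately have "C * norm_Linf g \<le> \<bar>C\<bar> * 1"
        by (intro mult_mono) auto
      define G where "G = riesz \<omega> m g"
      have "inner_L2 m g U = (\<Sum>x\<in>F. m x *\<^sub>R (g x * cnj (U x)))"
        unfolding inner_L2_def by (rule int_F(2)) (simp add: g_def)
      also have "\<dots> = (\<Sum>x\<in>F. of_real (m x * norm (U x)))"
      proof (rule sum.cong [OF refl])
        fix x assume "x \<in> F"
        have "sgn w * cnj w = of_real (norm w)" for w :: complex
          using complex_norm_square [of w]
          by (cases "w = 0") (simp_all add: sgn_div_norm scaleR_conv_of_real power2_eq_square field_simps)
        with \<open>x \<in> F\<close> show "m x *\<^sub>R (g x * cnj (U x)) = of_real (m x * norm (U x))"
          by (simp add: g_def scaleR_conv_of_real)
      qed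
      finally have "inner_L2 m g U = of_real (\<Sum>x\<in>F. m x * norm (U x))" by simp
      moreover have "inner_L2 m G a = inner_L2 m g U"
        unfolding G_def U_def by (rule inner_L2_riesz [OF \<open>g \<in> L2 m\<close> a(1)])
      ultimately have "(\<Sum>x\<in>F. m x * norm (U x)) \<le> norm (inner_L2 m G a)"
        by (metis abs_ge_self norm_of_real)
      also have "inner_L2 m G a = (\<Sum>x\<in>R. m x *\<^sub>R (G x * cnj (a x)))"
        unfolding inner_L2_def by (rule fin_int(2)) (simp add: supp_R)
      \<comment> \<open>Since \<open>a\<close> has mean zero, the average of \<open>G\<close> may be
        subtracted; with the bound \<open>1 / m z\<close> on \<open>a\<close> this produces the mean
        oscillation over \<open>R\<close>.\<close>
      also have "\<dots> = (\<Sum>x\<in>R. m x *\<^sub>R ((G x - average m G R) * cnj (a x)))"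
      proof -
        have "(\<Sum>x\<in>R. m x *\<^sub>R (average m G R * cnj (a x)))
            = average m G R * cnj (\<Sum>x\<in>R. m x *\<^sub>R a x)"
          by (simp add: sum_distrib_left)
        also have "\<dots> = 0" using mean_zero by (simp add: R_def)
        finally show ?thesis
          by (simp add: left_diff_distrib scaleR_diff_right sum_subtractf)
      qed
      also have "norm \<dots> \<le> (\<Sum>x\<in>R. m x * norm (G x - average m G R) * (1 / m z))"
      proof (rule sum_norm_le)
        fix x
        have "m x * norm (G x - average m G R) * norm (a x)
            \<le> m x * norm (G x - average m G R) * (1 / m z)"
          by (intro mult_left_mono bound) (simp add: less_imp_le flow_pos)
        then show "norm (m x *\<^sub>R ((G x - average m G R) * cnj (a x)))
            \<le> m x * norm (G x - average m G R) * (1 / m z)"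
          using flow_pos [of x] by (simp add: norm_mult mult.assoc)
      qed
      also have "\<dots> = mean_oscillation m G R"
      proof -
        have "(\<integral>x\<in>R. norm (G x - average m G R) \<partial>flow_measure m)
            = (\<Sum>x\<in>R. m x *\<^sub>R (indicator R x *\<^sub>R norm (G x - average m G R)))"
          unfolding set_lebesgue_integral_def by (rule fin_int(2)) simp
        also have "\<dots> = (\<Sum>x\<in>R. m x * norm (G x - average m G R))"
          by (intro sum.cong) auto
        finally show ?thesis
          by (simp add: mean_oscillation_def mR sum_divide_distrib)
      qed
      also have "\<dots> \<le> norm_BMO E \<omega> m G"
        unfolding norm_BMO_def
        by (rule cSUP_upper) (use adm G(1) in \<open>auto simp: BMO_def G_def\<close>)
      also have "\<dots> \<le> C * norm_Linf g" unfolding G_def by (rule G(2))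
      also have "\<dots> \<le> \<bar>C\<bar>" using \<open>C * norm_Linf g \<le> \<bar>C\<bar> * 1\<close> by simp
      finally show ?thesis .
    qed
    then have "(\<lambda>x. m x * norm (U x)) summable_on UNIV"
      by (intro nonneg_bdd_above_summable_on bdd_aboveI2 [where M = "\<bar>C\<bar>"])
         (auto simp: less_imp_le flow_pos)
    then have "U \<in> L1 m" by (simp add: L1_def integrable_flow_measure flow_pos)
    with a(2) show False by (simp add: U_def)
  qed
  with part1 show ?thesis by blast
qed

end
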